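(* Let $n,m,l$ be positive integers, let $f:\mathbb{R}^n\times\mathbb{R}^m\to\mathbb{R}^n$ and $g:\mathbb{R}^n\times\mathbb{R}^m\to\mathbb{R}^{n\times l}$ be smooth with $f(0,0)=0$, $g(0,0)=0$, and consider the control system $$\dot x=f(x,u)+g(x,u)\theta,\qquad x\in\mathbb{R}^n,\ u\in\mathbb{R}^m,$$ where $\theta\in\mathbb{R}^l$ is a constant unknown parameter vector. Let $k:\mathbb{R}^l\times\mathbb{R}^n\to\mathbb{R}^m$ be smooth with $k(\vartheta,0)=0$ for all $\vartheta\in\mathbb{R}^l$, and let $V_\vartheta,Q_\vartheta:\mathbb{R}^n\to\mathbb{R}_+$ ($\vartheta\in\mathbb{R}^l$) be continuous, positive definite, radially unbounded functions such that $(\vartheta,x)\mapsto V_\vartheta(x)$ and $(\vartheta,x)\mapsto Q_\vartheta(x)$ are continuous. Assume: (H1) For each $\vartheta\in\mathbb{R}^l$, the origin is globally asymptotically stable for $\dot x=f(x,k(\vartheta,x))+g(x,k(\vartheta,x))\vartheta$, and every solution of this system satisfies $V_\vartheta(x(t))\le Q_\vartheta(x(0))$ for all $t\ge0$. (H2) For every nonempty compact $\Theta\subset\mathbb{R}^l$ and every $M\ge0$ there exists $R>0$ such that $V_\vartheta(x)\le M$, $\vartheta\in\Theta$ imply $|x|\le R$. (H3) There is a positive integer $N$ such that: if there exist times $0=\tau_0<\tau_1<\dots<\tau_N$, vectors $\theta,d_0,\dots,d_N\in\mathbb{R}^l$ with $d_i\neq0$ for $i=0,\dots,N$, and a right differentiable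 map $x\in C^0([0,\tau_N];\mathbb{R}^n)\cap C^1([0,\tau_N]\setminus\{\tau_0,\dots,\tau_N\};\mathbb{R}^n)$ with $\dot x(t)=f(x(t),k(\theta+d_i,x(t)))+g(x(t),k(\theta+d_i,x(t)))\theta$ for $t\in[\tau_i,\tau_{i+1})$, $i=0,\dots,N-1$, and $g(x(t),k(\theta+d_j,x(t)))d_{i+1}=0$ for all $t\in[\tau_j,\tau_{j+1}]$, $i=0,\dots,N-1$, $j=0,\dots,i$, then $x(t)=0$ for all $t\in[0,\tau_N]$. Let $T>0$, let $a:\mathbb{R}^n\to\mathbb{R}_+$ be continuous and positive definite, and let $\tilde N$ be a positive integer with $\tilde N>N$. Consider the hybrid closed-loop system described in the context. Then there exists a family of functions $\tilde\sigma_{\theta,\hat\theta}\in KL$ parameterized by $(\theta,\hat\theta)\in\mathbb{R}^l\times\mathbb{R}^l$ such that for every $\theta\in\mathbb{R}^l$, $x_0\in\mathbb{R}^n$, $\hat\theta_0\in\mathbb{R}^l$ the solution of the hybrid closed-loop system with $x(0)=x_0$, $\hat\theta(0)=\hat\theta_0$ is unique, is defined for all $t\ge0$ and satisfies $|x(t)|\le\tilde\sigma_{\theta,\hat\theta_0}(|x_0|,t)$ for all $t\ge0$. Moreover, if $x_0\neq0$ then $\hat\theta(t)=\theta$ for all $t\ge NT$.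
   Context: Hybrid closed-loop system: event times $\tau_0=0$, $\tau_{i+1}=\min(\tau_i+T,r_i)$ for $i\in\mathbb{Z}_+$. On each $[\tau_i,\tau_{i+1})$: $u(t)=k(\hat\theta(\tau_i),x(t))$, $\hat\theta(t)=\hat\theta(\tau_i)$, and $x$ is continuous and solves $\dot x=f(x,u)+g(x,u)\theta$. The trigger: if $x(\tau_i)\neq0$, $r_i=\inf\{t>\tau_i: V_{\hat\theta(\tau_i)}(x(t))=Q_{\hat\theta(\tau_i)}(x(\tau_i))+a(x(\tau_i))\}$ (with $\inf\emptyset=+\infty$); if $x(\tau_i)=0$, $r_i=\tau_i+T$. Define $p(t,\sigma)=x(t)-x(\sigma)-\int_\sigma^t f(x(s),u(s))ds$, $q(t,\sigma)=\int_\sigma^t g(x(s),u(s))ds\in\mathbb{R}^{n\times l}$, $\mu_{i+1}=\min\{\tau_j: j\in\{0,\dots,i\},\ \tau_j\ge\tau_{i+1}-\tilde NT\}$, $G=\int_{\mu_{i+1}}^{\tau_{i+1}}\int_{\mu_{i+1}}^{\tau_{i+1}}q'(t,\sigma)q(t,\sigma)\,d\sigma\,dt$, $Z=\int_{\mu_{i+1}}^{\tau_{i+1}}\int_{\mu_{i+1}}^{\tau_{i+1}}q'(t,\sigma)p(t,\sigma)\,d\sigma\,dt$. The parameter update at event times is $\hat\theta(\tau_{i+1})=\arg\min\{|\vartheta-\hat\theta(\tau_i)|^2:\vartheta\in\mathbb{R}^l,\ Z=G\vartheta\}$. Here $|\cdot|$ is the Euclidean norm, $'$ denotes transpose. A function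 $V$ is positive definite if $V(0)=0$, $V(x)>0$ for $x\ne0$; radially unbounded if all sublevel sets $\{V\le M\}$ are compact. $K$: continuous strictly increasing $\alpha:\mathbb{R}_+\to\mathbb{R}_+$ with $\alpha(0)=0$; $KL$: continuous $\sigma:\mathbb{R}_+\times\mathbb{R}_+\to\mathbb{R}_+$ with $\sigma(\cdot,t)\in K$ for each $t$ and $\sigma(s,\cdot)$ nonincreasing with limit $0$ for each $s$. *)

theory Defs
  imports "HOL-Analysis.Analysis"
begin

text \<open>C-infinity smoothness of a real-valued function on a Euclidean space: all iterated
  partial derivatives (of all orders) exist everywhere and are continuous.
  Equivalently: the function lies in some family of continuous functions that is
  closed under taking partial derivatives along every basis direction.\<close>
definition smooth_real :: "('a::euclidean_space \<Rightarrow> real) \<Rightarrow> bool" where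
  "smooth_real h \<longleftrightarrow>
     (\<exists>S. h \<in> S \<and>
        (\<forall>\<phi>\<in>S. continuous_on UNIV \<phi> \<and>
           (\<forall>b\<in>Basis. \<exists>\<psi>\<in>S. \<forall>z. ((\<lambda>t. \<phi> (z + t *\<^sub>R b)) has_real_derivative \<psi> z) (at 0))))"

definition smooth_map :: "('a::euclidean_space \<Rightarrow> 'b::euclidean_space) \<Rightarrow> bool" where
  "smooth_map F \<longleftrightarrow> (\<forall>b\<in>Basis. smooth_real (\<lambda>z. F z \<bullet> b))"

definition pos_def :: "('a::real_normed_vector \<Rightarrow> real) \<Rightarrow> bool" where
  "pos_def V \<longleftrightarrow> V 0 = 0 \<and> (\<forall>x. x \<noteq> 0 \<longrightarrow> V x > 0)"

definition radially_unbounded :: "('a::real_normed_vector \<Rightarrow> real) \<Rightarrow> bool" where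
  "radially_unbounded V \<longleftrightarrow> (\<forall>M. compact {x. V x \<le> M})"

definition class_K :: "(real \<Rightarrow> real) \<Rightarrow> bool" where
  "class_K \<alpha> \<longleftrightarrow> continuous_on {0..} \<alpha> \<and> strict_mono_on {0..} \<alpha> \<and> \<alpha> 0 = 0
                  \<and> (\<forall>s\<ge>0. \<alpha> s \<ge> 0)"

definition class_KL :: "(real \<Rightarrow> real \<Rightarrow> real) \<Rightarrow> bool" where
  "class_KL \<sigma> \<longleftrightarrow> continuous_on ({0..} \<times> {0..}) (\<lambda>(s, t). \<sigma> s t)
     \<and> (\<forall>t\<ge>0. class_K (\<lambda>s. \<sigma> s t))
     \<and> (\<forall>s\<ge>0. antimono_on {0..} (\<sigma> s) \<and> ((\<sigma> s) \<longlongrightarrow> 0) at_top)"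

definition ode_sol :: "('a::real_normed_vector \<Rightarrow> 'a) \<Rightarrow> 'a \<Rightarrow> (real \<Rightarrow> 'a) \<Rightarrow> bool" where
  "ode_sol F x0 x \<longleftrightarrow> x 0 = x0 \<and> continuous_on {0..} x \<and>
     (\<forall>t\<ge>0. (x has_vector_derivative F (x t)) (at t within {0..}))"

definition GAS :: "('a::real_normed_vector \<Rightarrow> 'a) \<Rightarrow> bool" where
  "GAS F \<longleftrightarrow>
     (\<forall>x0. \<exists>x. ode_sol F x0 x) \<and>
     (\<forall>\<epsilon>>0. \<exists>\<delta>>0. \<forall>x0 x. ode_sol F x0 x \<and> norm x0 < \<delta> \<longrightarrow> (\<forall>t\<ge>0. norm (x t) < \<epsilon>)) \<and>
     (\<forall>x0 x. ode_sol F x0 x \<longrightarrow> (x \<longlongrightarrow> 0) at_top)"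

definition oint :: "real \<Rightarrow> real \<Rightarrow> (real \<Rightarrow> 'a::euclidean_space) \<Rightarrow> 'a" where
  "oint a b h = (if a \<le> b then integral {a..b} h else - integral {b..a} h)"

definition qfun :: "(real^'n \<Rightarrow> real^'m \<Rightarrow> real^'l^'n) \<Rightarrow> (real^'l \<Rightarrow> real^'n \<Rightarrow> real^'m)
    \<Rightarrow> (real \<Rightarrow> real^'n) \<Rightarrow> (real \<Rightarrow> real^'l) \<Rightarrow> real \<Rightarrow> real \<Rightarrow> real^'l^'n" where
  "qfun g k x th t \<sigma> = oint \<sigma> t (\<lambda>s. g (x s) (k (th s) (x s)))"

definition pfun :: "(real^'n \<Rightarrow> real^'m \<Rightarrow> real^'n) \<Rightarrow> (real^'l \<Rightarrow> real^'n \<Rightarrow> real^'m)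
    \<Rightarrow> (real \<Rightarrow> real^'n) \<Rightarrow> (real \<Rightarrow> real^'l) \<Rightarrow> real \<Rightarrow> real \<Rightarrow> real^'n" where
  "pfun f k x th t \<sigma> = x t - x \<sigma> - oint \<sigma> t (\<lambda>s. f (x s) (k (th s) (x s)))"

definition Gmat :: "(real^'n \<Rightarrow> real^'m \<Rightarrow> real^'l^'n) \<Rightarrow> (real^'l \<Rightarrow> real^'n \<Rightarrow> real^'m)
    \<Rightarrow> (real \<Rightarrow> real^'n) \<Rightarrow> (real \<Rightarrow> real^'l) \<Rightarrow> real \<Rightarrow> real \<Rightarrow> real^'l^'l" where
  "Gmat g k x th a b = integral {a..b} (\<lambda>t. integral {a..b} (\<lambda>\<sigma>.
      transpose (qfun g k x th t \<sigma>) ** qfun g k x th t \<sigma>))"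

definition Zvec :: "(real^'n \<Rightarrow> real^'m \<Rightarrow> real^'n) \<Rightarrow> (real^'n \<Rightarrow> real^'m \<Rightarrow> real^'l^'n)
    \<Rightarrow> (real^'l \<Rightarrow> real^'n \<Rightarrow> real^'m)
    \<Rightarrow> (real \<Rightarrow> real^'n) \<Rightarrow> (real \<Rightarrow> real^'l) \<Rightarrow> real \<Rightarrow> real \<Rightarrow> real^'l" where
  "Zvec f g k x th a b = integral {a..b} (\<lambda>t. integral {a..b} (\<lambda>\<sigma>.
      transpose (qfun g k x th t \<sigma>) *v pfun f k x th t \<sigma>))"

text \<open>Event-time recursion \<tau>_{i+1} = min(\<tau>_i + T, r_i), with inf of the empty set = +\<infinity>.\<close>
definition next_event :: "(real^'l \<Rightarrow> real^'n \<Rightarrow> real) \<Rightarrow> (real^'l \<Rightarrow> real^'n \<Rightarrow> real)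
    \<Rightarrow> (real^'n \<Rightarrow> real) \<Rightarrow> real \<Rightarrow> (real \<Rightarrow> real^'n) \<Rightarrow> (real \<Rightarrow> real^'l) \<Rightarrow> real \<Rightarrow> real" where
  "next_event V Q a T x th s =
     (if x s \<noteq> 0 then
        (let S = {t. t > s \<and> V (th s) (x t) = Q (th s) (x s) + a (x s)}
         in if S = {} then s + T else min (s + T) (Inf S))
      else s + T)"

definition mu_time :: "(nat \<Rightarrow> real) \<Rightarrow> nat \<Rightarrow> real \<Rightarrow> nat \<Rightarrow> real" where
  "mu_time \<tau> Nt T i = Min {\<tau> j | j. j \<le> i \<and> \<tau> j \<ge> \<tau> (Suc i) - real Nt * T}"

definition hybrid_sol ::
  "(real^'n \<Rightarrow> real^'m \<Rightarrow> real^'n) \<Rightarrow> (real^'n \<Rightarrow> real^'m \<Rightarrow> real^'l^'n)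
   \<Rightarrow> (real^'l \<Rightarrow> real^'n \<Rightarrow> real^'m) \<Rightarrow> (real^'l \<Rightarrow> real^'n \<Rightarrow> real)
   \<Rightarrow> (real^'l \<Rightarrow> real^'n \<Rightarrow> real) \<Rightarrow> (real^'n \<Rightarrow> real) \<Rightarrow> real \<Rightarrow> nat \<Rightarrow> real^'l
   \<Rightarrow> (real \<Rightarrow> real^'n) \<Rightarrow> (real \<Rightarrow> real^'l) \<Rightarrow> bool" where
  "hybrid_sol f g k V Q a T Nt \<theta> x th \<longleftrightarrow>
     (\<exists>\<tau> :: nat \<Rightarrow> real.
        \<tau> 0 = 0 \<and> filterlim \<tau> at_top sequentially \<and>
        continuous_on {0..} x \<and>
        (\<forall>i. \<tau> (Suc i) = next_event V Q a T x th (\<tau> i)) \<and>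
        (\<forall>i. \<forall>t\<in>{\<tau> i..<\<tau> (Suc i)}.
            th t = th (\<tau> i) \<and>
            (x has_vector_derivative
               (f (x t) (k (th (\<tau> i)) (x t)) + g (x t) (k (th (\<tau> i)) (x t)) *v \<theta>))
              (at t within {\<tau> i..\<tau> (Suc i)})) \<and>
        (\<forall>i. is_arg_min (\<lambda>\<phi>. (norm (\<phi> - th (\<tau> i)))\<^sup>2)
               (\<lambda>\<phi>. Zvec f g k x th (mu_time \<tau> Nt T i) (\<tau> (Suc i))
                     = Gmat g k x th (mu_time \<tau> Nt T i) (\<tau> (Suc i)) *v \<phi>)
               (th (\<tau> (Suc i)))))"

end

theory Submission
  imports Defs
begin

text \<open>
  The true parameter always satisfies the least-squares constraint, so each update is the
  projection of the current estimate onto an affine subspace containing \<open>\<theta>\<close>. Hence estimates never move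
  away from \<open>\<theta>\<close>, remain in a compact ball, and are never changed once they equal \<open>\<theta>\<close>. The Gram matrix
  of a window annihilates the estimation error, so \<open>g d\<close> vanishes along the whole window; if
  \<open>\<theta>\<close> were not identified after \<open>N\<close> events, (H3) would force the trajectory to be zero. After
  identification no event is triggered by \<open>V\<close> (by (H1)), so events cannot accumulate. The KL bound
  combines at most \<open>N\<close> applications of a sublevel estimate, uniform over the compact ball of
  estimates by (H2), with uniform attractivity of the nominal closed loop.
\<close>

subsection \<open>Functions that are Lipschitz on balls\<close>

text \<open>Integrating the equation over a window gives p = q \<theta> exactly, which is why
  \<theta> is always feasible; and d . G d is the double integral of |q d|^2, so a vector in the
  kernel of G is invisible to q on the whole window. The time \<open>N * T\<close> comes from the
  bound \<open>T\<close> on the length of every interval: the first \<open>N\<close> events occur no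
  later than it, and since \<open>Nt > N\<close> all their windows begin at time 0, as (H3)
  requires. The obstacle is a circularity: the trigger looks at the whole future of
  \<open>x\<close>, while a global trajectory exists only once events are known not to accumulate. A
  run is therefore described by finitely many events and a local form of the trigger, and
  identification, uniqueness and a lower bound for event times are derived for such finite runs
  before any global solution is available. The start \<open>x 0 = 0\<close> is treated apart:
  nothing has to be identified there, but the trajectory is zero and only the clock \<open>T\<close>
  causes events. Up to event \<open>N\<close> the state is controlled by the trigger thresholds,
  afterwards by the nominal loop.\<close>

definition lipschitz_on_balls :: "('a::real_normed_vector \<Rightarrow> 'b::real_normed_vector) \<Rightarrow> bool" where
  "lipschitz_on_balls F \<longleftrightarrow> (\<forall>R. \<exists>L. L-lipschitz_on (cball 0 R) F)"

lemma lipschitz_on_ballsE: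
  assumes "lipschitz_on_balls F"
  obtains L where "L-lipschitz_on (cball 0 R) F"
  using assms unfolding lipschitz_on_balls_def by blast

lemma lipschitz_on_balls_bounded:
  assumes "lipschitz_on_balls F"
  obtains B where "\<And>x. norm x \<le> R \<Longrightarrow> norm (F x) \<le> B"
proof (cases "R \<ge> 0")
  case True
  obtain L where L: "L-lipschitz_on (cball 0 R) F" using lipschitz_on_ballsE[OF assms] .
  have "norm (F x) \<le> norm (F 0) + L * R" if "norm x \<le> R" for x
  proof -
    have "dist (F x) (F 0) \<le> L * dist x 0"
      using lipschitz_onD[OF L, of x 0] that True by simp
    also have "\<dots> \<le> L * R"
      using that lipschitz_on_nonneg[OF L] by (simp add: mult_left_mono)
    finally show ?thesis
      using norm_triangle_ineq2[of "F x" "F 0"] by (simp add: dist_norm)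
  qed
  then show ?thesis using that by blast
next
  case False
  then show ?thesis using that[of 0] by (meson norm_ge_zero order_trans)
qed

lemma lipschitz_on_balls_continuous_on:
  fixes F :: "'a::real_normed_vector \<Rightarrow> 'b::real_normed_vector"
  assumes "lipschitz_on_balls F"
  shows "continuous_on S F"
proof (rule continuous_at_imp_continuous_on, rule ballI)
  fix x :: 'a
  obtain L where L: "L-lipschitz_on (cball 0 (norm x + 1)) F" using lipschitz_on_ballsE[OF assms] .
  then have "continuous_on (ball 0 (norm x + 1)) F"
    using lipschitz_on_continuous_on lipschitz_on_subset ball_subset_cball by blast
  then show "continuous (at x) F"
    by (subst (asm) continuous_on_eq_continuous_at) auto
qed

lemma lipschitz_on_balls_compose:
  assumes G: "lipschitz_on_balls G" and F: "lipschitz_on_balls F"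
  shows "lipschitz_on_balls (\<lambda>x. G (F x))"
  unfolding lipschitz_on_balls_def
proof
  fix R
  obtain B where B: "\<And>x. norm x \<le> R \<Longrightarrow> norm (F x) \<le> B"
    using lipschitz_on_balls_bounded[OF F] by metis
  obtain L where L: "L-lipschitz_on (cball 0 R) F" using lipschitz_on_ballsE[OF F] .
  obtain M where M: "M-lipschitz_on (cball 0 B) G" using lipschitz_on_ballsE[OF G] .
  have "M-lipschitz_on (F ` cball 0 R) G"
    by (rule lipschitz_on_subset[OF M]) (use B in auto)
  then show "\<exists>L. L-lipschitz_on (cball 0 R) (\<lambda>x. G (F x))"
    using lipschitz_on_compose2[OF L] by blast
qed

lemma lipschitz_on_balls_Pair:
  assumes "lipschitz_on_balls F" "lipschitz_on_balls G"
  shows "lipschitz_on_balls (\<lambda>x. (F x, G x))"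
  using assms unfolding lipschitz_on_balls_def by (blast intro: lipschitz_on_Pair)

lemma lipschitz_on_balls_add:
  assumes "lipschitz_on_balls F" "lipschitz_on_balls G"
  shows "lipschitz_on_balls (\<lambda>x. F x + G x)"
  using assms unfolding lipschitz_on_balls_def by (blast intro: lipschitz_on_add)

lemma lipschitz_on_balls_const: "lipschitz_on_balls (\<lambda>x. c)"
  unfolding lipschitz_on_balls_def by (blast intro: lipschitz_on_constant)

lemma lipschitz_on_balls_id: "lipschitz_on_balls (\<lambda>x. x)"
  unfolding lipschitz_on_balls_def by (blast intro: lipschitz_on_id)

lemma lipschitz_on_balls_linear:
  assumes "bounded_linear h"
  shows "lipschitz_on_balls h"
proof -
  interpret bounded_linear h by fact
  show ?thesis unfolding lipschitz_on_balls_def by (meson lipschitz_boundE)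
qed

text \<open>Only derivatives along basis vectors are at hand, so \<open>x\<close> is moved to
  \<open>y\<close> by changing one coordinate at a time, with the mean value theorem on each leg. A
  box contains all intermediate points of this path; a ball might not. The dimension enters when the
  sum of the coordinates is bounded by the Euclidean norm.\<close>

lemma partial_derivatives_bound_imp_lipschitz_on_cbox:
  fixes h :: "'a::euclidean_space \<Rightarrow> real"
  assumes deriv: "\<And>b z. b \<in> Basis \<Longrightarrow> ((\<lambda>t. h (z + t *\<^sub>R b)) has_real_derivative D b z) (at 0)"
    and bound: "\<And>b z. b \<in> Basis \<Longrightarrow> z \<in> cbox l u \<Longrightarrow> \<bar>D b z\<bar> \<le> C"
    and C: "C \<ge> 0"
  shows "(C * DIM('a))-lipschitz_on (cbox l u) h"
proof (rule lipschitz_onI)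
  fix x y :: 'a assume x: "x \<in> cbox l u" and y: "y \<in> cbox l u"
  \<comment> \<open>\<open>z B\<close> has the coordinates of \<open>y\<close> along
    \<open>B\<close> and those of \<open>x\<close> elsewhere.\<close>
  define z where "z B = x + (\<Sum>b\<in>B. ((y - x) \<bullet> b) *\<^sub>R b)" for B
  have "\<bar>h (z B) - h x\<bar> \<le> C * (\<Sum>b\<in>B. \<bar>(y - x) \<bullet> b\<bar>)" if "finite B" "B \<subseteq> Basis" for B
    using that
  proof (induction B rule: finite_induct)
    case empty
    then show ?case by (simp add: z_def)
  next
    case (insert b B)
    have b: "b \<in> Basis" and B: "B \<subseteq> Basis" using insert by auto
    define c where "c = (y - x) \<bullet> b"
    have zi: "z (insert b B) = z B + c *\<^sub>R b"
      using insert by (simp add: z_def c_def algebra_simps)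
    have comp: "(z B + s *\<^sub>R b) \<bullet> i = (if i = b then x \<bullet> b + s else if i \<in> B then y \<bullet> i else x \<bullet> i)"
      if "i \<in> Basis" for i s
    proof -
      have "(\<Sum>b\<in>B. ((y - x) \<bullet> b) *\<^sub>R b) \<bullet> i = (\<Sum>b\<in>B. if b = i then (y - x) \<bullet> b else 0)"
        unfolding inner_sum_left using B \<open>i \<in> Basis\<close>
        by (intro sum.cong) (auto simp: inner_Basis)
      also have "\<dots> = (if i \<in> B then (y - x) \<bullet> i else 0)"
        using insert(1) by simp
      finally show ?thesis
        using insert(2) b \<open>i \<in> Basis\<close> unfolding z_def
        by (auto simp: inner_add_left inner_diff_left inner_Basis)
    qed
    have der: "((\<lambda>t. h (z B + t *\<^sub>R b)) has_real_derivative D b (z B + s *\<^sub>R b)) (at s)" for s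
      using deriv[OF b, of "z B + s *\<^sub>R b"] DERIV_shift[of "\<lambda>t. h (z B + t *\<^sub>R b)" _ 0 s]
      by (simp add: algebra_simps)
    have inbox: "z B + s *\<^sub>R b \<in> cbox l u" if "min 0 c \<le> s" "s \<le> max 0 c" for s
    proof -
      have "l \<bullet> b \<le> x \<bullet> b + s \<and> x \<bullet> b + s \<le> u \<bullet> b"
        using that x y b by (auto simp: c_def mem_box inner_diff_left min_def max_def split: if_splits)
      then show ?thesis
        using x y by (auto simp: mem_box comp)
    qed
    have "\<bar>h (z B + c *\<^sub>R b) - h (z B)\<bar> \<le> C * \<bar>c\<bar>"
    proof -
      have "norm (h (z B + c *\<^sub>R b) - h (z B + 0 *\<^sub>R b)) \<le> C * norm (c - 0)"
      proof (rule field_differentiable_bound[where f = "\<lambda>t. h (z B + t *\<^sub>R b)"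
            and f' = "\<lambda>s. D b (z B + s *\<^sub>R b)" and S = "{min 0 c..max 0 c}"])
        show "((\<lambda>t. h (z B + t *\<^sub>R b)) has_field_derivative D b (z B + s *\<^sub>R b))
            (at s within {min 0 c..max 0 c})" for s
          using der has_field_derivative_at_within by blast
      qed (use inbox bound b in auto)
      then show ?thesis by simp
    qed
    then show ?case
      using insert(3)[OF B] insert(1,2) unfolding zi by (simp add: c_def algebra_simps)
  qed
  from this[of Basis] have "\<bar>h y - h x\<bar> \<le> C * (\<Sum>b\<in>Basis. \<bar>(y - x) \<bullet> b\<bar>)"
    by (simp add: z_def euclidean_representation)
  also have "\<dots> \<le> C * (\<Sum>b\<in>(Basis::'a set). norm (y - x))"
    using C by (intro mult_left_mono sum_mono) (auto simp: Basis_le_norm)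
  finally show "dist (h x) (h y) \<le> C * DIM('a) * dist x y"
    by (simp add: dist_norm norm_minus_commute algebra_simps)
qed (use C in simp)

text \<open>The continuous first partial derivatives are bounded on the compact box circumscribed
  about the ball. This is the form in which smoothness enters every argument about differential
  equations below.\<close>

lemma smooth_real_imp_lipschitz_on_balls:
  fixes h :: "'a::euclidean_space \<Rightarrow> real"
  assumes "smooth_real h"
  shows "lipschitz_on_balls h"
  unfolding lipschitz_on_balls_def
proof
  fix R :: real
  obtain D where D: "\<And>b z. b \<in> Basis \<Longrightarrow> ((\<lambda>t. h (z + t *\<^sub>R b)) has_real_derivative D b z) (at 0)"
    and Dc: "\<And>b. b \<in> Basis \<Longrightarrow> continuous_on UNIV (D b)"
    using assms unfolding smooth_real_def by metis
  define u :: 'a where "u = R *\<^sub>R One"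
  have "\<exists>C. \<forall>z\<in>cbox (- u) u. \<bar>D b z\<bar> \<le> C" if "b \<in> Basis" for b
    using compact_imp_bounded[OF compact_continuous_image[OF continuous_on_subset[OF Dc[OF that]] compact_cbox]]
    by (auto simp: bounded_iff)
  then obtain C where C: "\<And>b z. b \<in> Basis \<Longrightarrow> z \<in> cbox (- u) u \<Longrightarrow> \<bar>D b z\<bar> \<le> C b"
    by metis
  have *: "\<bar>D b z\<bar> \<le> (\<Sum>b\<in>Basis. \<bar>C b\<bar>)" if b: "b \<in> Basis" and z: "z \<in> cbox (- u) u" for b z
    using C[OF b z] member_le_sum[OF b, of "\<lambda>b. \<bar>C b\<bar>"] by fastforce
  have "((\<Sum>b\<in>Basis. \<bar>C b\<bar>) * DIM('a))-lipschitz_on (cbox (- u) u) h"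
    by (rule partial_derivatives_bound_imp_lipschitz_on_cbox[OF D *]) (auto intro: sum_nonneg)
  moreover have "cball 0 R \<subseteq> cbox (- u) u"
  proof
    fix z :: 'a assume "z \<in> cball 0 R"
    then have "\<bar>z \<bullet> i\<bar> \<le> R" if "i \<in> Basis" for i
      using Basis_le_norm[OF that, of z] by simp
    then show "z \<in> cbox (- u) u" by (force simp: mem_box u_def abs_le_iff)
  qed
  ultimately show "\<exists>L. L-lipschitz_on (cball 0 R) h"
    using lipschitz_on_subset by blast
qed

lemma smooth_map_imp_lipschitz_on_balls:
  fixes F :: "'a::euclidean_space \<Rightarrow> 'b::euclidean_space"
  assumes "smooth_map F"
  shows "lipschitz_on_balls F"
  unfolding lipschitz_on_balls_def
proof
  fix R :: real
  have "\<forall>b\<in>Basis. \<exists>L. L-lipschitz_on (cball 0 R) (\<lambda>z. F z \<bullet> b)"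
    using assms smooth_real_imp_lipschitz_on_balls unfolding smooth_map_def lipschitz_on_balls_def by blast
  then obtain L where L: "\<And>b. b \<in> Basis \<Longrightarrow> (L b)-lipschitz_on (cball 0 R) (\<lambda>z. F z \<bullet> b)"
    by metis
  have "(\<Sum>b\<in>Basis. L b)-lipschitz_on (cball 0 R) F"
  proof (rule lipschitz_onI)
    fix x y :: 'a assume xy: "x \<in> cball 0 R" "y \<in> cball 0 R"
    have "dist (F x) (F y) \<le> (\<Sum>b\<in>Basis. \<bar>(F x - F y) \<bullet> b\<bar>)"
      by (simp add: dist_norm norm_le_l1)
    also have "\<dots> \<le> (\<Sum>b\<in>Basis. L b * dist x y)"
      using lipschitz_onD[OF L xy] by (intro sum_mono) (auto simp: dist_real_def inner_diff_left)
    finally show "dist (F x) (F y) \<le> (\<Sum>b\<in>Basis. L b) * dist x y"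
      by (simp add: sum_distrib_right)
  qed (use L lipschitz_on_nonneg in \<open>blast intro: sum_nonneg\<close>)
  then show "\<exists>L. L-lipschitz_on (cball 0 R) F" ..
qed

subsection \<open>Ordinary differential equations\<close>

text \<open>Picard iteration in the norm weighted by \<open>exp (- K * t)\<close>, which is a contraction on the whole interval
  as soon as \<open>K > L\<close>.\<close>

lemma ode_exists_lipschitz:
  fixes F :: "'a::euclidean_space \<Rightarrow> 'a"
  assumes L: "L-lipschitz_on UNIV F" and b: "0 \<le> b"
  shows "\<exists>x. x 0 = x0 \<and> (\<forall>t\<in>{0..b}. (x has_vector_derivative F (x t)) (at t within {0..b}))"
proof -
  \<comment> \<open>This choice makes the contraction factor \<open>L / K\<close> at most 1/2 and
    keeps \<open>K\<close> positive when \<open>L = 0\<close>.\<close>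
  define K where "K = 2 * L + 1"
  have L0: "L \<ge> 0" and K: "K > 0" using lipschitz_on_nonneg[OF L] by (auto simp: K_def)
  have Fc: "continuous_on S F" for S
    using lipschitz_on_continuous_on[OF L] continuous_on_subset by blast
  \<comment> \<open>The Picard operator for x, rewritten for y with x t = exp (K t) y t: the plain
    supremum norm of y is the weighted norm of x.\<close>
  define P where "P y t = exp (- K * t) *\<^sub>R (x0 + integral {0..t} (\<lambda>s. F (exp (K * s) *\<^sub>R y s)))"
    for y :: "real \<Rightarrow> 'a" and t
  have Fy: "continuous_on S (\<lambda>s. F (exp (K * s) *\<^sub>R y s))" if "continuous_on S y" for S y
    by (rule continuous_on_compose2[OF Fc[of UNIV]]) (auto intro!: continuous_intros that)
  have Pc: "continuous_on (cbox 0 b) (P (apply_bcontfun y))" for y :: "real \<Rightarrow>\<^sub>C 'a"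
  proof -
    have "continuous_on {0..b} (\<lambda>t. integral {0..t} (\<lambda>s. F (exp (K * s) *\<^sub>R y s)))"
      by (intro indefinite_integral_continuous_1 integrable_continuous_interval Fy) simp
    then show ?thesis unfolding P_def by (auto intro!: continuous_intros)
  qed
  \<comment> \<open>Clamping the time to the interval extends each iterate to a bounded continuous
    function on the line, so the fixed point is sought in the complete space of such
    functions.\<close>
  have "\<exists>g :: real \<Rightarrow>\<^sub>C 'a. \<forall>t. g t = P y (clamp 0 b t)" for y :: "real \<Rightarrow>\<^sub>C 'a"
    using continuous_on_cbox_bcontfunE[OF Pc] by metis
  then obtain \<Phi> :: "(real \<Rightarrow>\<^sub>C 'a) \<Rightarrow> (real \<Rightarrow>\<^sub>C 'a)" where \<Phi>: "\<And>y t. \<Phi> y t = P y (clamp 0 b t)"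
    by metis
  have contr: "dist (\<Phi> y) (\<Phi> z) \<le> 1/2 * dist y z" for y z
  proof (rule dist_bound)
    fix u :: real
    define t where "t = clamp 0 b u"
    have t: "t \<in> {0..b}" using clamp_in_interval[of 0 b u] b by (simp add: t_def)
    define d where "d = dist y z"
    have int: "((\<lambda>s. exp (K * s)) has_integral (exp (K * t) / K - exp (K * 0) / K)) {0..t}"
    proof (rule fundamental_theorem_of_calculus)
      show "((\<lambda>s. exp (K * s) / K) has_vector_derivative exp (K * s)) (at s within {0..t})" for s
        unfolding has_real_derivative_iff_has_vector_derivative[symmetric]
        using K by (auto intro!: derivative_eq_intros)
    qed (use t in auto)
    then have int': "((\<lambda>s. L * d * exp (K * s)) has_integral L * d * (exp (K * t) / K - exp (K * 0) / K)) {0..t}"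
      by (rule has_integral_mult_right)
    have iy: "(\<lambda>s. F (exp (K * s) *\<^sub>R w s)) integrable_on {0..t}" for w :: "real \<Rightarrow>\<^sub>C 'a"
      by (intro integrable_continuous_interval Fy) simp
    have "norm (integral {0..t} (\<lambda>s. F (exp (K * s) *\<^sub>R y s)) - integral {0..t} (\<lambda>s. F (exp (K * s) *\<^sub>R z s)))
        = norm (integral {0..t} (\<lambda>s. F (exp (K * s) *\<^sub>R y s) - F (exp (K * s) *\<^sub>R z s)))"
      by (simp add: integral_diff iy)
    also have "\<dots> \<le> integral {0..t} (\<lambda>s. L * d * exp (K * s))"
    proof (rule integral_norm_bound_integral)
      fix s
      have "norm (F (exp (K * s) *\<^sub>R y s) - F (exp (K * s) *\<^sub>R z s))
        \<le> L * norm (exp (K * s) *\<^sub>R y s - exp (K * s) *\<^sub>R z s)"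
        using lipschitz_on_normD[OF L] by blast
      also have "\<dots> = L * (exp (K * s) * dist (y s) (z s))"
        by (simp add: dist_norm flip: scaleR_diff_right)
      also have "\<dots> \<le> L * (exp (K * s) * d)"
        using L0 dist_bounded[of y s z] by (intro mult_left_mono) (auto simp: d_def)
      finally show "norm (F (exp (K * s) *\<^sub>R y s) - F (exp (K * s) *\<^sub>R z s)) \<le> L * d * exp (K * s)"
        by (simp add: algebra_simps)
    qed (use int' iy in \<open>auto intro: integrable_diff\<close>)
    also have "\<dots> = L * d * (exp (K * t) / K - exp (K * 0) / K)"
      using int' by blast
    also have "\<dots> \<le> (L / K) * d * exp (K * t)"
      using L0 K by (simp add: field_simps d_def)
    also have "\<dots> \<le> (1/2) * d * exp (K * t)"
      using K by (intro mult_right_mono) (auto simp: d_def K_def field_simps)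
    finally have *: "norm (integral {0..t} (\<lambda>s. F (exp (K * s) *\<^sub>R y s))
        - integral {0..t} (\<lambda>s. F (exp (K * s) *\<^sub>R z s))) \<le> 1/2 * d * exp (K * t)" .
    have "dist (\<Phi> y u) (\<Phi> z u) = exp (- K * t) * norm (integral {0..t} (\<lambda>s. F (exp (K * s) *\<^sub>R y s))
        - integral {0..t} (\<lambda>s. F (exp (K * s) *\<^sub>R z s)))"
      by (simp add: \<Phi> P_def dist_norm flip: t_def scaleR_diff_right)
    also have "\<dots> \<le> exp (- K * t) * (1/2 * d * exp (K * t))"
      using * by (intro mult_left_mono) auto
    also have "\<dots> = 1/2 * d" by (simp add: exp_minus field_simps)
    finally show "dist (\<Phi> y u) (\<Phi> z u) \<le> 1/2 * dist y z" by (simp add: d_def)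
  qed
  obtain y where y: "\<Phi> y = y"
    using banach_fix_type[of "1/2" \<Phi>] contr by auto
  define x where "x t = exp (K * t) *\<^sub>R y t" for t
  have xc: "continuous_on S (\<lambda>s. F (x s))" for S
    unfolding x_def by (rule Fy) simp
  have x: "x t = x0 + integral {0..t} (\<lambda>s. F (x s))" if "t \<in> {0..b}" for t
  proof -
    have "y t = P y t" using \<Phi>[of y t] that y by simp
    then show ?thesis by (simp add: x_def P_def exp_minus)
  qed
  have "(x has_vector_derivative F (x t)) (at t within {0..b})" if t: "t \<in> {0..b}" for t
  proof (rule has_vector_derivative_transform[OF t x])
    show "((\<lambda>t. x0 + integral {0..t} (\<lambda>s. F (x s))) has_vector_derivative F (x t)) (at t within {0..b})"
      using integral_has_vector_derivative[OF xc t] by (auto intro!: derivative_eq_intros)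
  qed
  moreover have "x 0 = x0" using x[of 0] b by simp
  ultimately show ?thesis by blast
qed

text \<open>Gronwall's inequality in differential form: the squared distance times exp (-2 L t) does
  not increase, by Cauchy-Schwarz. Derivatives are taken in the open interval, so the lemma fits
  arcs whose derivative is one-sided at an event.\<close>

lemma ode_lipschitz_dist_le:
  fixes F :: "'a::real_inner \<Rightarrow> 'a"
  assumes L: "L-lipschitz_on X F" and ab: "a \<le> b"
    and xc: "continuous_on {a..b} x" and yc: "continuous_on {a..b} y"
    and xd: "\<And>t. a < t \<Longrightarrow> t < b \<Longrightarrow> (x has_vector_derivative F (x t)) (at t)"
    and yd: "\<And>t. a < t \<Longrightarrow> t < b \<Longrightarrow> (y has_vector_derivative F (y t)) (at t)"
    and X: "\<And>t. a < t \<Longrightarrow> t < b \<Longrightarrow> x t \<in> X" "\<And>t. a < t \<Longrightarrow> t < b \<Longrightarrow> y t \<in> X"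
  shows "dist (x b) (y b) \<le> exp (L * (b - a)) * dist (x a) (y a)"
proof (cases "a = b")
  case False
  define w where "w t = x t - y t" for t
  define v where "v t = exp (- 2 * L * t) * (w t \<bullet> w t)" for t
  have "v b \<le> v a"
  proof (rule DERIV_nonpos_imp_decreasing_open[where f = v])
    show "continuous_on {a..b} v"
      unfolding v_def w_def by (intro continuous_intros xc yc)
    fix t assume t: "a < t" "t < b"
    have wd: "(w has_vector_derivative F (x t) - F (y t)) (at t)"
      unfolding w_def by (intro has_vector_derivative_diff xd yd t)
    have "((\<lambda>t. w t \<bullet> w t) has_real_derivative 2 * (w t \<bullet> (F (x t) - F (y t)))) (at t)"
    proof -
      have "((\<lambda>t. w t \<bullet> w t) has_derivative (\<lambda>h. w t \<bullet> h *\<^sub>R (F (x t) - F (y t)) + h *\<^sub>R (F (x t) - F (y t)) \<bullet> w t)) (at t)"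
        by (intro has_derivative_inner wd[unfolded has_vector_derivative_def])
      moreover have "(\<lambda>h. w t \<bullet> h *\<^sub>R (F (x t) - F (y t)) + h *\<^sub>R (F (x t) - F (y t)) \<bullet> w t)
          = (*) (2 * (w t \<bullet> (F (x t) - F (y t))))"
        by (simp add: fun_eq_iff inner_commute)
      ultimately show ?thesis by (simp add: has_field_derivative_def)
    qed
    then have vd: "(v has_real_derivative exp (- 2 * L * t) * (2 * (w t \<bullet> (F (x t) - F (y t)))
        - 2 * L * (w t \<bullet> w t))) (at t)"
      unfolding v_def by (auto intro!: derivative_eq_intros simp: algebra_simps)
    have "w t \<bullet> (F (x t) - F (y t)) \<le> norm (w t) * norm (F (x t) - F (y t))"
      by (rule norm_cauchy_schwarz)
    also have "\<dots> \<le> norm (w t) * (L * norm (w t))"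
      using lipschitz_on_normD[OF L X(1)[OF t] X(2)[OF t]] by (intro mult_left_mono) (auto simp: w_def)
    also have "\<dots> = L * (w t \<bullet> w t)" by (simp add: dot_square_norm power2_eq_square)
    finally show "\<exists>y. (v has_real_derivative y) (at t) \<and> y \<le> 0"
      using vd by (intro exI conjI) (auto simp: mult_le_0_iff)
  qed (use ab in simp)
  then have "exp (2 * L * b) * v b \<le> exp (2 * L * b) * v a" by (intro mult_left_mono) auto
  then have "(norm (w b))\<^sup>2 \<le> exp (2 * (L * (b - a))) * (norm (w a))\<^sup>2"
  proof -
    have "exp (2 * L * b) * exp (- 2 * L * b) = 1"
      by (simp flip: exp_add)
    moreover have "exp (2 * L * b) * exp (- 2 * L * a) = exp (2 * (L * (b - a)))"
      by (simp add: right_diff_distrib flip: exp_add)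
    moreover have "exp (2 * L * b) * v t = exp (2 * L * b) * exp (- 2 * L * t) * (norm (w t))\<^sup>2" for t
      by (simp add: v_def dot_square_norm)
    ultimately have "exp (2 * L * b) * v b = 1 * (norm (w b))\<^sup>2"
      "exp (2 * L * b) * v a = exp (2 * (L * (b - a))) * (norm (w a))\<^sup>2" by metis+
    then show ?thesis using \<open>exp (2 * L * b) * v b \<le> exp (2 * L * b) * v a\<close> by argo
  qed
  also have "\<dots> = (exp (L * (b - a)) * norm (w a))\<^sup>2"
    by (simp only: power_mult_distrib exp_double)
  finally have "norm (w b) \<le> exp (L * (b - a)) * norm (w a)"
    by (rule power2_le_imp_le) simp
  then show ?thesis by (simp add: w_def dist_norm)
qed (use ab in simp)

lemma ode_unique:
  fixes F :: "'a::real_inner \<Rightarrow> 'a"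
  assumes F: "lipschitz_on_balls F"
    and xc: "continuous_on {a..b} x" and yc: "continuous_on {a..b} y"
    and xd: "\<And>t. a < t \<Longrightarrow> t < b \<Longrightarrow> (x has_vector_derivative F (x t)) (at t)"
    and yd: "\<And>t. a < t \<Longrightarrow> t < b \<Longrightarrow> (y has_vector_derivative F (y t)) (at t)"
    and eq: "x a = y a" and t: "a \<le> t" "t \<le> b"
  shows "x t = y t"
proof -
  have "bounded (x ` {a..b} \<union> y ` {a..b})"
    by (simp add: compact_imp_bounded compact_continuous_image xc yc)
  then obtain R where "\<forall>z\<in>x ` {a..b} \<union> y ` {a..b}. norm z \<le> R"
    unfolding bounded_iff by blast
  then have R: "x ` {a..b} \<union> y ` {a..b} \<subseteq> cball 0 R" by auto
  obtain L where L: "L-lipschitz_on (cball 0 R) F" using lipschitz_on_ballsE[OF F] .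
  have "dist (x t) (y t) \<le> exp (L * (t - a)) * dist (x a) (y a)"
  proof (rule ode_lipschitz_dist_le[OF L])
    show "continuous_on {a..t} x" "continuous_on {a..t} y"
      using xc yc t by (auto elim: continuous_on_subset)
  qed (use R t xd yd in \<open>auto simp: image_subset_iff\<close>)
  then show ?thesis using eq by simp
qed

lemma ode_sol_at:
  assumes "ode_sol F x0 x" "t > 0"
  shows "(x has_vector_derivative F (x t)) (at t)"
proof -
  have "(x has_vector_derivative F (x t)) (at t within {0..})"
    using assms by (simp add: ode_sol_def)
  moreover have "at t within {0..} = at t"
    by (rule at_within_interior) (use assms in simp)
  ultimately show ?thesis by simp
qed

lemma ode_sol_shift:
  assumes x: "ode_sol F x0 x" and s: "s \<ge> 0"
  shows "ode_sol F (x s) (\<lambda>t. x (s + t))"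
  unfolding ode_sol_def
proof (intro conjI allI impI)
  show "continuous_on {0..} (\<lambda>t. x (s + t))"
  proof (rule continuous_on_compose2[where f = "\<lambda>t. s + t" and g = x and t = "{0..}"])
    show "continuous_on {0..} x" using x by (simp add: ode_sol_def)
    show "continuous_on {0..} (\<lambda>t. s + t)" by (intro continuous_intros)
  qed (use s in auto)
  fix t :: real assume t: "t \<ge> 0"
  have "((\<lambda>t. s + t) has_vector_derivative 1) (at t within {0..})"
    by (auto intro!: derivative_eq_intros)
  moreover have "(x has_vector_derivative F (x (s + t))) (at (s + t) within (+) s ` {0..})"
  proof (rule has_vector_derivative_within_subset)
    show "(x has_vector_derivative F (x (s + t))) (at (s + t) within {0..})"
      using x s t by (simp add: ode_sol_def)
  qed (use s in auto)
  ultimately show "((\<lambda>t. x (s + t)) has_vector_derivative F (x (s + t))) (at t within {0..})"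
    using vector_diff_chain_within[of "\<lambda>t. s + t" 1 t "{0..}" x] by (simp add: o_def)
qed simp

text \<open>\<open>GAS\<close> gives attraction for each solution separately. At some time the
  solution from a given centre is well inside the ball supplied by stability for \<open>e\<close>;
  by continuous dependence so are the solutions from nearby points, and stability keeps them small
  afterwards. Compactness reduces this to finitely many centres. The bound \<open>B\<close> provides
  one Lipschitz constant for all solutions involved.\<close>

lemma GAS_uniformly_attractive:
  fixes F :: "'a::euclidean_space \<Rightarrow> 'a"
  assumes F: "lipschitz_on_balls F" and G: "GAS F"
    and B: "\<And>x0 x t. ode_sol F x0 x \<Longrightarrow> norm x0 \<le> r \<Longrightarrow> t \<ge> 0 \<Longrightarrow> norm (x t) \<le> B"
    and e: "e > 0"
  shows "\<exists>t0\<ge>0. \<forall>x0 x t. ode_sol F x0 x \<and> norm x0 \<le> r \<and> t0 \<le> t \<longrightarrow> norm (x t) \<le> e"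
proof -
  obtain \<delta> where \<delta>: "\<delta> > 0" "\<And>x0 x t. ode_sol F x0 x \<Longrightarrow> norm x0 < \<delta> \<Longrightarrow> t \<ge> 0 \<Longrightarrow> norm (x t) < e"
    using G e unfolding GAS_def by meson
  obtain z where z: "\<And>\<xi>. ode_sol F \<xi> (z \<xi>)" using G unfolding GAS_def by metis
  have "\<exists>s\<ge>0. norm (z \<xi> s) < \<delta> / 2" for \<xi>
  proof -
    have "(z \<xi> \<longlongrightarrow> 0) at_top" using G z unfolding GAS_def by blast
    from tendstoD[OF this, of "\<delta> / 2"] have "\<forall>\<^sub>F s in at_top. norm (z \<xi> s) < \<delta> / 2"
      using \<delta>(1) by simp
    then have "\<forall>\<^sub>F s in at_top. 0 \<le> s \<and> norm (z \<xi> s) < \<delta> / 2"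
      using eventually_ge_at_top[of 0] by eventually_elim simp
    then show ?thesis using eventually_happens'[OF trivial_limit_at_top_linorder] by fastforce
  qed
  then obtain s where s: "\<And>\<xi>. s \<xi> \<ge> 0" "\<And>\<xi>. norm (z \<xi> (s \<xi>)) < \<delta> / 2" by metis
  obtain L where L: "L-lipschitz_on (cball 0 B) F" using lipschitz_on_ballsE[OF F] .
  \<comment> \<open>At this distance from the centre, Gronwall growth over time
    \<open>s \<xi>\<close> uses up less than \<delta> / 2; the centre's own solution uses less than
    the other half.\<close>
  define \<rho> where "\<rho> \<xi> = \<delta> / 2 * exp (- L * s \<xi>)" for \<xi>
  have near: "norm (x t) < e" if "norm \<xi> \<le> r" "norm x0 \<le> r" "dist \<xi> x0 < \<rho> \<xi>" "ode_sol F x0 x" "s \<xi> \<le> t" for \<xi> x0 x t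
  proof -
    have "dist (x (s \<xi>)) (z \<xi> (s \<xi>)) \<le> exp (L * (s \<xi> - 0)) * dist (x 0) (z \<xi> 0)"
    proof (rule ode_lipschitz_dist_le[OF L s(1)])
      show "continuous_on {0..s \<xi>} x" "continuous_on {0..s \<xi>} (z \<xi>)"
        using that(4) z[of \<xi>] unfolding ode_sol_def by (auto elim: continuous_on_subset)
      show "x t \<in> cball 0 B" "z \<xi> t \<in> cball 0 B" if "0 < t" for t
        using B[OF \<open>ode_sol F x0 x\<close>] B[OF z] \<open>norm \<xi> \<le> r\<close> \<open>norm x0 \<le> r\<close> that by simp_all
    qed (use that(4) z ode_sol_at in blast)+
    also have "\<dots> = exp (L * s \<xi>) * dist \<xi> x0"
      using that(4) z unfolding ode_sol_def by (simp add: dist_commute)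
    also have "\<dots> < exp (L * s \<xi>) * \<rho> \<xi>" using that(3) by simp
    also have "\<dots> = \<delta> / 2" by (simp add: \<rho>_def exp_minus)
    finally have "norm (x (s \<xi>)) < \<delta>"
      using s(2)[of \<xi>] norm_triangle_sub[of "x (s \<xi>)" "z \<xi> (s \<xi>)"] by (simp add: dist_norm)
    then show ?thesis
      using \<delta>(2)[OF ode_sol_shift[OF that(4) s(1)], of \<xi> "t - s \<xi>"] that(5) by simp
  qed
  have "\<rho> \<xi> > 0" for \<xi> using \<delta>(1) by (simp add: \<rho>_def)
  then have "cball 0 r \<subseteq> (\<Union>\<xi>\<in>cball 0 r. ball \<xi> (\<rho> \<xi>))" by (auto intro!: UN_I)
  from compactE_image[OF compact_cball open_ball this] obtain C
    where C: "C \<subseteq> cball 0 r" "finite C" "cball 0 r \<subseteq> (\<Union>\<xi>\<in>C. ball \<xi> (\<rho> \<xi>))" by metis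
  define t0 where "t0 = sum s C"
  have "norm (x t) \<le> e" if x: "ode_sol F x0 x" "norm x0 \<le> r" "t0 \<le> t" for x0 x t
  proof -
    obtain \<xi> where \<xi>: "\<xi> \<in> C" "x0 \<in> ball \<xi> (\<rho> \<xi>)" using C(3) x(2) by force
    moreover have "s \<xi> \<le> t0" unfolding t0_def using \<xi>(1) C(2) s(1) by (intro member_le_sum) auto
    ultimately show ?thesis using near[of \<xi> x0 x t] x C(1) by force
  qed
  moreover have "t0 \<ge> 0" using s(1) by (simp add: t0_def sum_nonneg)
  ultimately show ?thesis by blast
qed

subsection \<open>Majorants of class KL\<close>

text \<open>The majorant is \<open>s\<close> plus the average of \<open>A\<close> over \<open>[s, 2 s]\<close>.\<close>

lemma class_K_majorant:
  fixes A :: "real \<Rightarrow> real"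
  assumes mono: "mono_on {0..} A" and nonneg: "\<And>s. s \<ge> 0 \<Longrightarrow> A s \<ge> 0"
    and lim: "\<And>e. e > 0 \<Longrightarrow> \<exists>d>0. \<forall>s. 0 \<le> s \<and> s \<le> d \<longrightarrow> A s \<le> e"
  shows "\<exists>\<alpha>. class_K \<alpha> \<and> (\<forall>s\<ge>0. A s \<le> \<alpha> s)"
proof -
  define I where "I s = integral {0..s} A" for s
  define m where "m s = (I (2 * s) - I s) / s" for s
  \<comment> \<open>The summand \<open>s\<close> turns monotonicity into strict monotonicity; at 0,
    where the average makes no sense, the value 0 is put in by hand.\<close>
  define \<alpha> where "\<alpha> s = (if s \<le> 0 then 0 else s + m s)" for s
  have int: "A integrable_on {p..q}" if "0 \<le> p" for p q
    by (rule integrable_on_mono_on) (use mono that in \<open>auto simp: mono_on_def\<close>)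
  have Idiff: "I q - I p = integral {p..q} A" if "0 \<le> p" "p \<le> q" for p q
    using Henstock_Kurzweil_Integration.integral_combine[OF that int[OF order_refl]] by (simp add: I_def)
  have lower: "A p * (q - p) \<le> I q - I p" if "0 \<le> p" "p \<le> q" for p q
  proof -
    have "integral {p..q} (\<lambda>_. A p) \<le> integral {p..q} A"
      by (rule integral_le) (use int that mono in \<open>auto simp: mono_on_def\<close>)
    then show ?thesis using Idiff[OF that] that by (simp add: mult.commute)
  qed
  have upper: "I q - I p \<le> A q * (q - p)" if "0 \<le> p" "p \<le> q" for p q
  proof -
    have "integral {p..q} A \<le> integral {p..q} (\<lambda>_. A q)"
      by (rule integral_le) (use int that mono in \<open>auto simp: mono_on_def\<close>)
    then show ?thesis using Idiff[OF that] that by (simp add: mult.commute)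
  qed
  have m_lower: "A s \<le> m s" if "0 < s" for s
    using lower[of s "2 * s"] that by (simp add: m_def field_simps)
  have m_upper: "m s \<le> A (2 * s)" if "0 < s" for s
    using upper[of s "2 * s"] that by (simp add: m_def field_simps)
  \<comment> \<open>If the windows [s, 2s] and [r, 2r] overlap, cut [s, 2r] at r and 2s into
    integrals u, v, w. Then \<open>m s\<close> = (u + v) / s and \<open>m r\<close> = (v + w) / r,
    and the bounds of \<open>A\<close> on the three pieces give r (u + v) \<le> s (v + w). Without
    overlap the value of \<open>A\<close> at r separates the two averages.\<close>
  have m_mono: "m s \<le> m r" if s: "0 < s" and sr: "s < r" for s r
  proof (cases "r \<le> 2 * s")
    case True
    have "A r * (2 * r - 2 * s) \<le> A (2 * s) * (2 * r - 2 * s) \<and> I r - I s \<le> A r * (r - s) \<and>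
        A (2 * s) * (2 * r - 2 * s) \<le> I (2 * r) - I (2 * s) \<and> I (2 * s) - I r \<le> A (2 * s) * (2 * s - r)
        \<and> A r * (2 * s - r) \<le> I (2 * s) - I r"
      using upper[of s r] lower[of "2 * s" "2 * r"] upper[of r "2 * s"] lower[of r "2 * s"] s sr True mono
      by (auto simp: mono_on_def intro!: mult_right_mono)
    moreover have "A r * s \<le> A (2 * s) * s" "A r \<le> A (2 * s)"
      using s sr True mono by (auto simp: mono_on_def)
    moreover define u v w where "u = I r - I s" and "v = I (2 * s) - I r" and "w = I (2 * r) - I (2 * s)"
    ultimately have uvw: "u \<le> A r * (r - s)" "v \<le> A (2 * s) * (2 * s - r)" "A r * (2 * s - r) \<le> v"
      "A (2 * s) * (2 * r - 2 * s) \<le> w" "A r \<le> A (2 * s)" by auto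
    have "r * (u + v) \<le> s * (v + w)"
    proof -
      have "r * u \<le> r * (A r * (r - s))" "(r - s) * v \<le> (r - s) * (A (2 * s) * (2 * s - r))"
        "s * (A (2 * s) * (2 * r - 2 * s)) \<le> s * w"
        using uvw s sr by (auto intro!: mult_left_mono)
      moreover have "r * (A r * (r - s)) \<le> r * (A (2 * s) * (r - s))"
        using uvw s sr by (auto intro!: mult_left_mono mult_right_mono)
      moreover have "r * (A (2 * s) * (r - s)) + (r - s) * (A (2 * s) * (2 * s - r))
         = s * (A (2 * s) * (2 * r - 2 * s))" by (simp add: algebra_simps)
      ultimately show ?thesis by (simp add: algebra_simps)
    qed
    then show ?thesis using s sr by (simp add: m_def u_def v_def w_def field_simps)
  next
    case False
    have "m s \<le> A (2 * s)" using m_upper s by simp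
    also have "\<dots> \<le> A r" using mono False s by (auto simp: mono_on_def)
    also have "\<dots> \<le> m r" using m_lower s sr by simp
    finally show ?thesis .
  qed
  have m0: "0 \<le> m s" if "0 < s" for s
    using m_lower[OF that] nonneg[of s] that by simp
  have "strict_mono_on {0..} \<alpha>"
  proof (rule strict_mono_onI)
    fix r s :: real assume "r \<in> {0..}" "s \<in> {0..}" "r < s"
    then show "\<alpha> r < \<alpha> s" using m0[of s] m_mono[of r s] by (auto simp: \<alpha>_def)
  qed
  moreover have "continuous_on {0..} \<alpha>"
  proof (rule continuous_on_eq_continuous_within[THEN iffD2], rule ballI)
    fix s :: real assume s: "s \<in> {0..}"
    show "continuous (at s within {0..}) \<alpha>"
    proof (cases "s = 0")
      case True
      have small: "\<exists>d>0. \<forall>t. 0 \<le> t \<and> t < d \<longrightarrow> \<bar>\<alpha> t\<bar> < e" if "e > 0" for e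
      proof -
        obtain d where d: "d > 0" "\<And>t. 0 \<le> t \<Longrightarrow> t \<le> d \<Longrightarrow> A t \<le> e / 2"
          using lim[OF half_gt_zero[OF \<open>e > 0\<close>]] by blast
        have "\<bar>\<alpha> t\<bar> < e" if "0 \<le> t" "t < min (e / 2) (d / 2)" for t
        proof (cases "t = 0")
          case False
          then have "m t \<le> e / 2" using m_upper[of t] d(2)[of "2 * t"] that by simp
          then show ?thesis using m0[of t] False that by (simp add: \<alpha>_def)
        qed (use \<open>e > 0\<close> in \<open>simp add: \<alpha>_def\<close>)
        then show ?thesis using \<open>e > 0\<close> d(1) by (intro exI[of _ "min (e / 2) (d / 2)"]) simp
      qed
      have "\<alpha> 0 = 0" by (simp add: \<alpha>_def)
      then show ?thesis
        unfolding True continuous_within_eps_delta using small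
        by (simp add: dist_real_def Ball_def) meson
    next
      case False
      then have s: "s > 0" using s by simp
      have Ic: "continuous_on {0..b} I" for b
        unfolding I_def by (rule indefinite_integral_continuous_1) (simp add: int)
      have c: "continuous_on {0<..<2 * s} (\<lambda>s. s + m s)"
        unfolding m_def
        by (intro continuous_intros continuous_on_compose2[OF Ic[of "4 * s"]]
            continuous_on_subset[OF Ic[of "4 * s"]]) auto
      then have "continuous_on {0<..<2 * s} \<alpha>"
        by (rule continuous_on_eq) (simp add: \<alpha>_def)
      then have "isCont \<alpha> s"
        using s by (simp add: continuous_on_eq_continuous_at)
      then show ?thesis using continuous_at_imp_continuous_at_within by blast
    qed
  qed
  moreover have "\<forall>s\<ge>0. \<alpha> s \<ge> 0" using m0 by (simp add: \<alpha>_def)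
  moreover have "A s \<le> \<alpha> s" if "s \<ge> 0" for s
  proof (cases "s = 0")
    case True
    have "A 0 \<le> e" if "e > 0" for e using lim[OF that] by force
    then show ?thesis using True by (auto simp: \<alpha>_def intro: field_le_epsilon)
  qed (use m_lower[of s] that in \<open>simp add: \<alpha>_def\<close>)
  ultimately show ?thesis unfolding class_K_def by (intro exI[of _ \<alpha>]) (simp add: \<alpha>_def)
qed

text \<open>Writing \<open>y c t\<close> as \<open>sqrt (y c t) * sqrt (y c t)\<close>, the first factor is bounded by a function of
  \<open>size c\<close> tending to zero at zero, the second by a product \<open>sqrt (\<beta> (size c)) * sqrt (\<gamma> t)\<close> with \<open>\<gamma>\<close> tending to
  zero at infinity. Hence the comparison function can be taken of the form \<open>\<alpha> s * G t\<close>.\<close>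

lemma class_KL_majorant:
  fixes y :: "'c \<Rightarrow> real \<Rightarrow> real" and size :: "'c \<Rightarrow> real"
  assumes size: "\<And>c. size c \<ge> 0" and y: "\<And>c t. t \<ge> 0 \<Longrightarrow> y c t \<ge> 0"
    and bounded: "\<And>r. \<exists>B. \<forall>c t. size c \<le> r \<and> 0 \<le> t \<longrightarrow> y c t \<le> B"
    and stable: "\<And>e. e > 0 \<Longrightarrow> \<exists>d>0. \<forall>c t. size c \<le> d \<and> 0 \<le> t \<longrightarrow> y c t \<le> e"
    and attractive: "\<And>r e. e > 0 \<Longrightarrow> \<exists>t0. \<forall>c t. size c \<le> r \<and> 0 \<le> t \<and> t0 \<le> t \<longrightarrow> y c t \<le> e"
  shows "\<exists>\<sigma>. class_KL \<sigma> \<and> (\<forall>c t. 0 \<le> t \<longrightarrow> y c t \<le> \<sigma> (size c) t)"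
proof -
  \<comment> \<open>The inserted 0 makes the supremum meaningful and nonnegative even if no index
    has such a size.\<close>
  define S where "S s = insert 0 {y c t | c t. size c \<le> s \<and> 0 \<le> t}" for s
  define A where "A s = Sup (S s)" for s
  have bdd: "bdd_above (S s)" for s
  proof -
    obtain B where "\<forall>c t. size c \<le> s \<and> 0 \<le> t \<longrightarrow> y c t \<le> B" using bounded by blast
    then show ?thesis unfolding S_def by (intro bdd_aboveI[of _ "max 0 B"]) fastforce
  qed
  have A_ge: "y c t \<le> A s" if "size c \<le> s" "0 \<le> t" for c t s
    unfolding A_def by (rule cSup_upper[OF _ bdd]) (use that in \<open>auto simp: S_def\<close>)
  have A0: "0 \<le> A s" for s
    unfolding A_def by (rule cSup_upper[OF _ bdd]) (simp add: S_def)
  have A_le: "A s \<le> e" if "0 \<le> e" "\<And>c t. size c \<le> s \<Longrightarrow> 0 \<le> t \<Longrightarrow> y c t \<le> e" for s e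
    unfolding A_def by (rule cSup_least) (use that in \<open>auto simp: S_def\<close>)
  have A_mono: "A s \<le> A r" if "s \<le> r" for s r
    by (rule A_le[OF A0]) (use A_ge that in force)

  have "\<exists>t0. 0 \<le> t0 \<and> (\<forall>c t. size c \<le> real n \<and> t0 \<le> t \<longrightarrow> y c t \<le> inverse (Suc n))" for n :: nat
  proof -
    obtain t0 where "\<forall>c t. size c \<le> real n \<and> 0 \<le> t \<and> t0 \<le> t \<longrightarrow> y c t \<le> inverse (Suc n)"
      using attractive[of "inverse (Suc n)" "real n"] by auto
    then show ?thesis by (intro exI[of _ "max 0 t0"]) auto
  qed
  then obtain U where U: "\<And>n. 0 \<le> U n"
    "\<And>n c t. size c \<le> real n \<Longrightarrow> U n \<le> t \<Longrightarrow> y c t \<le> inverse (Suc n)" by metis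
  \<comment> \<open>Partial sums make the settling times nondecreasing, and the added
    \<open>n\<close> sends them to infinity, so only finitely many have passed at any time.\<close>
  define W where "W n = (\<Sum>i\<le>n. U i) + real n" for n :: nat
  have W_ge: "real n \<le> W n" "U n \<le> W n" for n
    using member_le_sum[of n "{..n}" U] U(1) by (auto simp: W_def sum_nonneg)
  have W_mono: "W m \<le> W n" if "m \<le> n" for m n
    using that U(1) unfolding W_def by (intro add_mono sum_mono2) auto
  \<comment> \<open>An initial segment of the naturals, because \<open>W\<close> is nondecreasing;
    its cardinality counts the settling times that have passed.\<close>
  define J where "J t = {n. W n \<le> t}" for t
  have "n \<le> nat \<lceil>t\<rceil>" if "W n \<le> t" for n t
    using order_trans[OF W_ge(1) that] by linarith
  then have Jfin: "finite (J t)" for t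
    by (intro finite_subset[of "J t" "{..nat \<lceil>t\<rceil>}"]) (auto simp: J_def)
  define \<gamma> where "\<gamma> t = inverse (real (Suc (card (J t))))" for t
  have \<gamma>_pos: "\<gamma> t > 0" for t by (simp add: \<gamma>_def)
  have \<gamma>_anti: "\<gamma> t \<le> \<gamma> s" if "s \<le> t" for s t
  proof -
    have "J s \<subseteq> J t" using that by (auto simp: J_def)
    from card_mono[OF Jfin this] show ?thesis by (simp add: \<gamma>_def)
  qed
  have J_ge: "n < card (J t)" if "W n \<le> t" for n t
  proof -
    have "{..n} \<subseteq> J t" using order_trans[OF W_mono that] by (auto simp: J_def)
    from card_mono[OF Jfin this] show ?thesis by simp
  qed
  have J_le: "W n \<le> t" if "n < card (J t)" for n t
  proof (rule ccontr)
    assume "\<not> W n \<le> t"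
    then have "J t \<subseteq> {..<n}"
      using W_mono[of n] unfolding J_def by (metis (no_types, lifting) lessThan_iff linorder_not_le mem_Collect_eq order_trans subsetI)
    then show False using card_mono[of "{..<n}" "J t"] that by simp
  qed
  \<comment> \<open>The 2 serves sizes that have already settled, where y \<le> 1 / (n + 1) \<le> 2
    / (n + 2). The other summand serves larger sizes, for which (size + 2) times \<gamma> is at
    least 1, so that the crude bound \<open>A\<close> suffices.\<close>
  define \<beta> where "\<beta> s = 2 + A s * (s + 2)" for s
  have prod: "y c t \<le> \<beta> (size c) * \<gamma> t" if t: "0 \<le> t" for c t
  proof (cases "size c \<le> real (card (J t)) - 1")
    case True
    define n where "n = card (J t) - 1"
    have n: "card (J t) = Suc n" using True size[of c] by (simp add: n_def)
    have "W n \<le> t" by (rule J_le) (simp add: n)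
    then have "y c t \<le> inverse (Suc n)"
      using True W_ge(2)[of n] by (intro U(2)) (auto simp: n)
    also have "\<dots> \<le> 2 * \<gamma> t" by (simp add: \<gamma>_def n field_simps)
    also have "\<dots> \<le> \<beta> (size c) * \<gamma> t"
      using \<gamma>_pos[of t] A0[of "size c"] size[of c] by (intro mult_right_mono) (auto simp: \<beta>_def)
    finally show ?thesis .
  next
    case False
    have "y c t \<le> A (size c) * 1" using A_ge[of c "size c" t] t by simp
    also have "\<dots> \<le> A (size c) * ((size c + 2) * \<gamma> t)"
      using False by (intro mult_left_mono A0) (simp add: \<gamma>_def field_simps)
    also have "\<dots> \<le> \<beta> (size c) * \<gamma> t"
      using \<gamma>_pos[of t] by (simp add: \<beta>_def algebra_simps)
    finally show ?thesis .
  qed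
  have \<beta>2: "2 \<le> \<beta> s" if "0 \<le> s" for s using A0[of s] that by (simp add: \<beta>_def)
  have \<beta>0: "0 \<le> \<beta> s" if "0 \<le> s" for s using \<beta>2[OF that] by simp
  have \<beta>_mono: "\<beta> s \<le> \<beta> r" if "0 \<le> s" "s \<le> r" for s r
    using A_mono[of s r] A0[of s] that unfolding \<beta>_def by (intro add_mono mult_mono) auto
  have "\<exists>\<alpha>. class_K \<alpha> \<and> (\<forall>s\<ge>0. sqrt (A s * \<beta> s) \<le> \<alpha> s)"
  proof (rule class_K_majorant)
    show "mono_on {0..} (\<lambda>s. sqrt (A s * \<beta> s))"
      using A_mono \<beta>_mono A0 \<beta>0 by (intro mono_onI real_sqrt_le_mono mult_mono) auto
    show "0 \<le> sqrt (A s * \<beta> s)" if "0 \<le> s" for s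
      using A0[of s] \<beta>2[OF that] by simp
    fix e :: real assume e: "e > 0"
    have b1: "\<beta> 1 > 0" using \<beta>2[of 1] by simp
    \<comment> \<open>Since \<beta> is at most \<open>\<beta> 1\<close> on [0, 1], this target keeps
      \<open>A s * \<beta> s\<close> below the square of \<open>e\<close>.\<close>
    obtain d where d: "d > 0" "\<forall>c t. size c \<le> d \<and> 0 \<le> t \<longrightarrow> y c t \<le> e\<^sup>2 / \<beta> 1"
      using stable[of "e\<^sup>2 / \<beta> 1"] e b1 by auto
    have "sqrt (A s * \<beta> s) \<le> e" if "0 \<le> s" "s \<le> min d 1" for s
    proof (rule real_le_lsqrt)
      have "A s \<le> e\<^sup>2 / \<beta> 1"
        by (rule A_le) (use d that b1 in auto)
      then have "A s * \<beta> s \<le> e\<^sup>2 / \<beta> 1 * \<beta> 1"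
        using \<beta>_mono[of s 1] \<beta>2[of s] that A0[of s] by (intro mult_mono) auto
      then show "A s * \<beta> s \<le> e\<^sup>2" using b1 by simp
    qed (use e in auto)
    then show "\<exists>d>0. \<forall>s. 0 \<le> s \<and> s \<le> d \<longrightarrow> sqrt (A s * \<beta> s) \<le> e"
      using d(1) by (intro exI[of _ "min d 1"]) auto
  qed
  then obtain \<alpha> where \<alpha>: "class_K \<alpha>" "\<And>s. s \<ge> 0 \<Longrightarrow> sqrt (A s * \<beta> s) \<le> \<alpha> s" by blast
  \<comment> \<open>The substitution s = 1 / (1 + t) carries decay at infinity to behaviour at 0, so
    the majorant for class K also yields a continuous decreasing majorant in time.\<close>
  have "\<exists>\<omega>. class_K \<omega> \<and> (\<forall>s\<ge>0. (if s \<le> 0 then 0 else sqrt (\<gamma> (1 / s - 1))) \<le> \<omega> s)"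
  proof (rule class_K_majorant)
    show "mono_on {0..} (\<lambda>s. if s \<le> 0 then 0 else sqrt (\<gamma> (1 / s - 1)))"
      by (intro mono_onI) (auto intro!: \<gamma>_anti less_imp_le[OF \<gamma>_pos] divide_left_mono simp: mult_pos_pos)
    show "0 \<le> (if s \<le> 0 then 0 else sqrt (\<gamma> (1 / s - 1)))" for s
      using \<gamma>_pos[of "1 / s - 1"] by simp
    fix e :: real assume e: "e > 0"
    then obtain n :: nat where n: "inverse (real (Suc n)) < e\<^sup>2"
      using reals_Archimedean[of "e\<^sup>2"] by auto
    have "\<gamma> (W n) \<le> inverse (real (Suc n))" using J_ge[of n "W n"] by (simp add: \<gamma>_def field_simps)
    then have "sqrt (\<gamma> (W n)) \<le> e" using n e by (intro real_le_lsqrt) auto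
    have W0: "W n \<ge> 0" using W_ge(1)[of n] by (meson of_nat_0_le_iff order_trans)
    have *: "(if s \<le> 0 then 0 else sqrt (\<gamma> (1 / s - 1))) \<le> e" if "0 \<le> s" "s \<le> 1 / (W n + 1)" for s
    proof (cases "s = 0")
      case False
      then have "W n \<le> 1 / s - 1" using that W0 by (simp add: field_simps)
      then show ?thesis using \<gamma>_anti[of "W n" "1 / s - 1"] \<open>sqrt (\<gamma> (W n)) \<le> e\<close> e
        by (auto intro: order_trans[OF real_sqrt_le_mono])
    qed (use e in simp)
    show "\<exists>d>0. \<forall>s. 0 \<le> s \<and> s \<le> d \<longrightarrow> (if s \<le> 0 then 0 else sqrt (\<gamma> (1 / s - 1))) \<le> e"
    proof (intro exI conjI allI impI)
      show "1 / (W n + 1) > 0" using W0 by simp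
    qed (rule *, auto)
  qed
  then obtain \<omega> where \<omega>: "class_K \<omega>"
    and \<omega>': "\<forall>s\<ge>0. (if s \<le> 0 then 0 else sqrt (\<gamma> (1 / s - 1))) \<le> \<omega> s" by blast
  have \<omega>_ge: "sqrt (\<gamma> (1 / s - 1)) \<le> \<omega> s" if "s > 0" for s
    using \<omega>'[rule_format, of s] that by simp
  define G where "G t = \<omega> (1 / (1 + t))" for t
  have \<omega>c: "continuous_on {0..} \<omega>" and \<omega>m: "strict_mono_on {0..} \<omega>" and \<omega>0: "\<omega> 0 = 0"
    using \<omega> by (auto simp: class_K_def)
  have \<alpha>c: "continuous_on {0..} \<alpha>" and \<alpha>m: "strict_mono_on {0..} \<alpha>" and \<alpha>0: "\<alpha> 0 = 0"
    and \<alpha>n: "\<And>s. s \<ge> 0 \<Longrightarrow> \<alpha> s \<ge> 0"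
    using \<alpha>(1) by (auto simp: class_K_def)
  have Gpos: "G t > 0" if "t \<ge> 0" for t
    using strict_mono_onD[OF \<omega>m, of 0 "1 / (1 + t)"] that by (simp add: G_def \<omega>0)
  have Ganti: "G t \<le> G s" if "0 \<le> s" "s \<le> t" for s t
    unfolding G_def using that
    by (intro mono_onD[OF strict_mono_on_imp_mono_on[OF \<omega>m]]) (auto simp: frac_le)
  have Gc: "continuous_on {0..} G"
    unfolding G_def by (intro continuous_on_compose2[OF \<omega>c] continuous_intros) auto
  have Glim: "(G \<longlongrightarrow> 0) at_top"
  proof -
    have "((\<lambda>t. \<omega> (1 / (1 + t))) \<longlongrightarrow> \<omega> 0) at_top"
    proof (rule continuous_on_tendsto_compose[OF \<omega>c])
      show "((\<lambda>t. 1 / (1 + t)) \<longlongrightarrow> (0::real)) at_top"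
        by (intro tendsto_divide_0[OF tendsto_const] filterlim_at_top_imp_at_infinity
            filterlim_tendsto_add_at_top[OF tendsto_const] filterlim_ident)
      show "\<forall>\<^sub>F t in at_top. 1 / (1 + t) \<in> {0::real..}"
        using eventually_ge_at_top[of 0] by eventually_elim simp
    qed simp
    then show ?thesis by (simp add: G_def[abs_def] \<omega>0)
  qed
  have KL: "class_KL (\<lambda>s t. \<alpha> s * G t)"
    unfolding class_KL_def
  proof (intro conjI allI impI)
    show "continuous_on ({0..} \<times> {0..}) (\<lambda>(s, t). \<alpha> s * G t)"
      unfolding case_prod_beta
      by (intro continuous_intros continuous_on_compose2[OF \<alpha>c] continuous_on_compose2[OF Gc]) auto
    show "class_K (\<lambda>s. \<alpha> s * G t)" if "t \<ge> 0" for t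
      unfolding class_K_def
    proof (intro conjI allI impI)
      show "continuous_on {0..} (\<lambda>s. \<alpha> s * G t)" by (intro continuous_intros \<alpha>c)
      show "strict_mono_on {0..} (\<lambda>s. \<alpha> s * G t)"
        using strict_mono_onD[OF \<alpha>m] Gpos[OF that]
        by (intro strict_mono_onI mult_strict_right_mono)
      show "\<alpha> s * G t \<ge> 0" if "s \<ge> 0" for s
        using \<alpha>n[OF that] Gpos[OF \<open>t \<ge> 0\<close>] by simp
    qed (simp add: \<alpha>0)
    show "antimono_on {0..} (\<lambda>t. \<alpha> s * G t)" if "s \<ge> 0" for s
      using \<alpha>n[OF that] Ganti by (auto intro!: monotone_onI mult_left_mono)
    show "((\<lambda>t. \<alpha> s * G t) \<longlongrightarrow> 0) at_top" for s
      using tendsto_mult_right_zero[OF Glim] by simp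
  qed
  have "y c t \<le> \<alpha> (size c) * G t" if t: "0 \<le> t" for c t
  proof -
    have "y c t = sqrt (y c t) * sqrt (y c t)" using y[OF t] by simp
    also have "\<dots> \<le> sqrt (A (size c)) * sqrt (\<beta> (size c) * \<gamma> t)"
      using A_ge[of c "size c" t] prod[OF t, of c] t y[OF t, of c] by (intro mult_mono) auto
    also have "\<dots> = sqrt (A (size c) * \<beta> (size c)) * sqrt (\<gamma> t)"
      by (simp add: real_sqrt_mult)
    also have "\<dots> \<le> \<alpha> (size c) * G t"
      using \<alpha>(2)[OF size] \<omega>_ge[of "1 / (1 + t)"] t \<alpha>n[OF size] \<gamma>_pos[of t]
      by (intro mult_mono) (auto simp: G_def)
    finally show ?thesis .
  qed
  with KL show ?thesis by blast
qed

subsection \<open>Least squares\<close>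

lemma bounded_linear_matrix_vector_mult_left:
  fixes v :: "real^'n"
  shows "bounded_linear (\<lambda>A :: real^'n^'m. A *v v)"
  by (auto intro!: linearI simp flip: linear_conv_bounded_linear
      simp: matrix_vector_mult_add_rdistrib scaleR_matrix_vector_assoc)

text \<open>\<open>I\<close> stands for a primitive of \<open>g\<close> along the trajectory; its
  increment equals \<open>qfun\<close> for either order of the two times, which removes the oriented
  integral.\<close>

definition gram :: "(real \<Rightarrow> real^'l^'n) \<Rightarrow> real \<Rightarrow> real \<Rightarrow> real^'l^'l" where
  "gram I t \<sigma> = transpose (I t - I \<sigma>) ** (I t - I \<sigma>)"

lemma gram_mult_vec: "gram I t \<sigma> *v v = transpose (I t - I \<sigma>) *v ((I t - I \<sigma>) *v v)"
  by (simp add: gram_def matrix_vector_mul_assoc)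

lemma inner_gram_mult_vec: "v \<bullet> (gram I t \<sigma> *v v) = (norm ((I t - I \<sigma>) *v v))\<^sup>2"
  unfolding gram_mult_vec power2_norm_eq_inner
  by (metis dot_lmul_matrix vector_transpose_matrix)

lemma continuous_on_gram:
  assumes "continuous_on S I"
  shows "continuous_on (S \<times> S) (\<lambda>(t, \<sigma>). gram I t \<sigma>)"
  unfolding gram_def matrix_matrix_mult_def transpose_def case_prod_beta
  by (intro continuous_intros continuous_on_compose2[OF assms]) auto

text \<open>A bounded linear map passes through both integrals. It is applied to A \<mapsto> A
  \<theta> for the constraint and to A \<mapsto> d . A d, which is linear in A, for the
  kernel.\<close>

lemma integral_gram_mult_vec:
  fixes I :: "real \<Rightarrow> real^'l^'n" and h :: "real^'l^'l \<Rightarrow> 'b::euclidean_space"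
  assumes I: "continuous_on {a..b} I" and h: "bounded_linear h"
  shows "h (integral {a..b} (\<lambda>t. integral {a..b} (gram I t)))
    = integral {a..b} (\<lambda>t. integral {a..b} (\<lambda>\<sigma>. h (gram I t \<sigma>)))"
    and "continuous_on {a..b} (\<lambda>t. integral {a..b} (\<lambda>\<sigma>. h (gram I t \<sigma>)))"
    and "t \<in> {a..b} \<Longrightarrow> continuous_on {a..b} (\<lambda>\<sigma>. h (gram I t \<sigma>))"
proof -
  note c = continuous_on_gram[OF I]
  have c1: "continuous_on {a..b} (gram I t)" if "t \<in> {a..b}" for t
    by (rule continuous_on_compose2[OF c, where f="\<lambda>y. Pair t y", unfolded split_beta fst_conv snd_conv])
      (use that in \<open>auto intro!: continuous_intros\<close>)
  have c2: "continuous_on {a..b} (\<lambda>t. integral {a..b} (gram I t))"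
    using integral_continuous_on_param[of "{a..b}" a b "gram I"] c by simp
  have h1: "h (integral {a..b} (gram I t)) = integral {a..b} (\<lambda>\<sigma>. h (gram I t \<sigma>))" if "t \<in> {a..b}" for t
    using integral_linear[OF integrable_continuous_interval[OF c1[OF that]] h] by (simp add: o_def)
  have "h (integral {a..b} (\<lambda>t. integral {a..b} (gram I t)))
      = integral {a..b} (\<lambda>t. h (integral {a..b} (gram I t)))"
    using integral_linear[OF integrable_continuous_interval[OF c2] h] by (simp add: o_def)
  also have "\<dots> = integral {a..b} (\<lambda>t. integral {a..b} (\<lambda>\<sigma>. h (gram I t \<sigma>)))"
    by (rule integral_cong) (rule h1)
  finally show "h (integral {a..b} (\<lambda>t. integral {a..b} (gram I t)))
    = integral {a..b} (\<lambda>t. integral {a..b} (\<lambda>\<sigma>. h (gram I t \<sigma>)))" .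
  have "continuous_on {a..b} (\<lambda>t. h (integral {a..b} (gram I t)))"
    by (rule bounded_linear.continuous_on[OF h c2])
  then show "continuous_on {a..b} (\<lambda>t. integral {a..b} (\<lambda>\<sigma>. h (gram I t \<sigma>)))"
    by (rule continuous_on_eq) (rule h1)
  show "continuous_on {a..b} (\<lambda>\<sigma>. h (gram I t \<sigma>))" if "t \<in> {a..b}"
    by (rule bounded_linear.continuous_on[OF h c1[OF that]])
qed

text \<open>Pairing with \<open>d\<close> turns the hypothesis into a vanishing double integral of
  the continuous nonnegative function |(I t - I \<sigma>) d|^2, which must then be zero at every
  pair of times.\<close>

lemma integral_gram_kernel:
  fixes I :: "real \<Rightarrow> real^'l^'n"
  assumes I: "continuous_on {a..b} I" and ab: "a < b"
    and d: "integral {a..b} (\<lambda>t. integral {a..b} (gram I t)) *v d = 0"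
    and t: "t \<in> {a..b}" and \<sigma>: "\<sigma> \<in> {a..b}"
  shows "(I t - I \<sigma>) *v d = 0"
proof -
  define h where "h A = d \<bullet> (A *v d)" for A :: "real^'l^'l"
  have h: "bounded_linear h"
    unfolding h_def
    by (rule bounded_linear_compose[OF bounded_linear_inner_right bounded_linear_matrix_vector_mult_left])
  note G = integral_gram_mult_vec[OF I h]
  have nonneg: "h (gram I t \<sigma>) \<ge> 0" for t \<sigma> by (simp add: h_def inner_gram_mult_vec)
  have "integral {a..b} (\<lambda>t. integral {a..b} (\<lambda>\<sigma>. h (gram I t \<sigma>))) = 0"
    using G(1) d by (simp add: h_def)
  then have "integral {a..b} (\<lambda>\<sigma>. h (gram I t \<sigma>)) = 0"
    using integral_eq_0_iff[OF G(2) ab] t nonneg G(3)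
    by (metis (no_types, lifting) integrable_continuous_interval integral_nonneg)
  then have "h (gram I t \<sigma>) = 0"
    using integral_eq_0_iff[OF G(3)[OF t] ab] \<sigma> nonneg by blast
  then show ?thesis by (simp add: h_def inner_gram_mult_vec)
qed

text \<open>The feasible set is a nonempty closed affine subspace, so the minimiser is its nearest
  point to \<open>c\<close>, single-valued even for singular \<open>A\<close>. Projection does not
  expand distances and fixes the feasible \<theta>, whence the second claim.\<close>

lemma is_arg_min_affine_iff_closest_point:
  fixes c p :: "real^'l"
  assumes "z = A *v \<theta>"
  shows "is_arg_min (\<lambda>\<phi>. (norm (\<phi> - c))\<^sup>2) (\<lambda>\<phi>. z = A *v \<phi>) p \<longleftrightarrow> p = closest_point {\<phi>. z = A *v \<phi>} c"
    and "dist (closest_point {\<phi>. z = A *v \<phi>} c) \<theta> \<le> dist c \<theta>"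
proof -
  define S where "S = {\<phi>. z = A *v \<phi>}"
  have S: "convex S" "closed S" "\<theta> \<in> S"
  proof -
    have "(1 - u) *\<^sub>R z + u *\<^sub>R z = z" for u :: real by (simp flip: scaleR_left_distrib)
    then show "convex S"
      unfolding S_def convex_alt
      by (simp add: matrix_vector_right_distrib matrix_vector_mult_scaleR)
    show "closed S" unfolding S_def by (intro closed_Collect_eq continuous_intros)
    show "\<theta> \<in> S" using assms by (simp add: S_def)
  qed
  then have ne: "S \<noteq> {}" by blast
  have "is_arg_min (\<lambda>\<phi>. (norm (\<phi> - c))\<^sup>2) (\<lambda>\<phi>. z = A *v \<phi>) p \<longleftrightarrow> p \<in> S \<and> (\<forall>y\<in>S. dist c p \<le> dist c y)"
    unfolding is_arg_min_def S_def dist_norm norm_minus_commute[of c] by (auto simp: not_less)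
  also have "\<dots> \<longleftrightarrow> p = closest_point S c"
    using closest_point_unique[OF S(1,2)] closest_point_exists[OF S(2) ne] by blast
  finally show "is_arg_min (\<lambda>\<phi>. (norm (\<phi> - c))\<^sup>2) (\<lambda>\<phi>. z = A *v \<phi>) p \<longleftrightarrow> p = closest_point {\<phi>. z = A *v \<phi>} c"
    by (simp add: S_def)
  have "dist (closest_point S c) (closest_point S \<theta>) \<le> dist c \<theta>"
    by (rule closest_point_lipschitz[OF S(1,2) ne])
  then show "dist (closest_point {\<phi>. z = A *v \<phi>} c) \<theta> \<le> dist c \<theta>"
    using closest_point_self[OF S(3)] by (simp add: S_def)
qed

subsection \<open>The hybrid closed loop\<close>

text \<open>One true parameter is fixed here and all notions of a run refer to it; in (H3) the bound
  \<theta> shadows it. Smoothness appears through the Lipschitz property that it supplies.\<close>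

locale event_triggered_control =
  fixes f :: "real^'n \<Rightarrow> real^'m \<Rightarrow> real^'n"
    and g :: "real^'n \<Rightarrow> real^'m \<Rightarrow> real^'l^'n"
    and k :: "real^'l \<Rightarrow> real^'n \<Rightarrow> real^'m"
    and V Q :: "real^'l \<Rightarrow> real^'n \<Rightarrow> real"
    and a :: "real^'n \<Rightarrow> real"
    and T :: real and N Nt :: nat and \<theta> :: "real^'l"
  assumes f_lip: "lipschitz_on_balls (\<lambda>z. f (fst z) (snd z))"
    and g_lip: "lipschitz_on_balls (\<lambda>z. g (fst z) (snd z))"
    and k_lip: "lipschitz_on_balls (\<lambda>z. k (fst z) (snd z))"
    and f0: "f 0 0 = 0" and g0: "g 0 0 = 0" and k0: "\<And>\<phi>. k \<phi> 0 = 0"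
    and V_cont: "continuous_on UNIV (\<lambda>z. V (fst z) (snd z))"
    and Q_cont: "continuous_on UNIV (\<lambda>z. Q (fst z) (snd z))"
    and V_pd: "\<And>\<phi>. pos_def (V \<phi>)" and Q_pd: "\<And>\<phi>. pos_def (Q \<phi>)"
    and H1_GAS: "\<And>\<phi>. GAS (\<lambda>x. f x (k \<phi> x) + g x (k \<phi> x) *v \<phi>)"
    and H1_bound: "\<And>\<phi> x0 x t. ode_sol (\<lambda>x. f x (k \<phi> x) + g x (k \<phi> x) *v \<phi>) x0 x
                     \<Longrightarrow> t \<ge> 0 \<Longrightarrow> V \<phi> (x t) \<le> Q \<phi> (x 0)"
    and H2: "\<And>\<Theta> M. \<Theta> \<noteq> {} \<Longrightarrow> compact \<Theta> \<Longrightarrow> M \<ge> 0 \<Longrightarrow>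
               \<exists>R>0. \<forall>\<phi>\<in>\<Theta>. \<forall>x. V \<phi> x \<le> M \<longrightarrow> norm x \<le> R"
    and H3: "\<And>(\<tau>::nat \<Rightarrow> real) (\<theta>::real^'l) (d::nat \<Rightarrow> real^'l) (x::real \<Rightarrow> real^'n).
       \<tau> 0 = 0 \<Longrightarrow> (\<forall>i<N. \<tau> i < \<tau> (Suc i)) \<Longrightarrow> (\<forall>i\<le>N. d i \<noteq> 0) \<Longrightarrow>
       continuous_on {0..\<tau> N} x \<Longrightarrow>
       (\<exists>x'. (\<forall>t\<in>{0..\<tau> N} - \<tau> ` {0..N}. (x has_vector_derivative x' t) (at t)) \<and>
             continuous_on ({0..\<tau> N} - \<tau> ` {0..N}) x') \<Longrightarrow>
       (\<forall>t\<in>{0..<\<tau> N}. \<exists>D. (x has_vector_derivative D) (at_right t)) \<Longrightarrow>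
       (\<forall>i<N. \<forall>t\<in>{\<tau> i..<\<tau> (Suc i)}.
          (x has_vector_derivative
             (f (x t) (k (\<theta> + d i) (x t)) + g (x t) (k (\<theta> + d i) (x t)) *v \<theta>)) (at_right t)) \<Longrightarrow>
       (\<forall>i<N. \<forall>j\<le>i. \<forall>t\<in>{\<tau> j..\<tau> (Suc j)}. g (x t) (k (\<theta> + d j) (x t)) *v d (Suc i) = 0) \<Longrightarrow>
       \<forall>t\<in>{0..\<tau> N}. x t = 0"
    and T_pos: "T > 0"
    and a_cont: "continuous_on UNIV a" and a_pd: "pos_def a"
    and Nt_gt: "Nt > N"
begin

text \<open>The estimate \<phi> enters only through the feedback, while the plant keeps the true
  parameter. For \<phi> = \<theta> this is the nominal loop of (H1).\<close>

definition field :: "real^'l \<Rightarrow> real^'n \<Rightarrow> real^'n" where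
  "field \<phi> x = f x (k \<phi> x) + g x (k \<phi> x) *v \<theta>"

text \<open>The threshold at which \<open>V\<close> triggers, if \<xi> is the state at the last
  event.\<close>

definition level :: "real^'l \<Rightarrow> real^'n \<Rightarrow> real" where
  "level \<phi> \<xi> = Q \<phi> \<xi> + a \<xi>"

section \<open>Regularity and signs of the closed-loop data\<close>

lemma lip_k: "lipschitz_on_balls (k \<phi>)"
  using lipschitz_on_balls_compose[OF k_lip lipschitz_on_balls_Pair[OF lipschitz_on_balls_const lipschitz_on_balls_id], of \<phi>]
  by simp

lemma lip_f_k: "lipschitz_on_balls (\<lambda>x. f x (k \<phi> x))"
  using lipschitz_on_balls_compose[OF f_lip lipschitz_on_balls_Pair[OF lipschitz_on_balls_id lip_k], of \<phi>]
  by simp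

lemma lip_g_k: "lipschitz_on_balls (\<lambda>x. g x (k \<phi> x))"
  using lipschitz_on_balls_compose[OF g_lip lipschitz_on_balls_Pair[OF lipschitz_on_balls_id lip_k], of \<phi>]
  by simp

lemma lip_field: "lipschitz_on_balls (field \<phi>)"
  unfolding field_def[abs_def]
  by (intro lipschitz_on_balls_add lip_f_k lipschitz_on_balls_compose[OF lipschitz_on_balls_linear lip_g_k]
      bounded_linear_matrix_vector_mult_left)

lemma field_0 [simp]: "field \<phi> 0 = 0"
  by (simp add: field_def k0 f0 g0)

lemma continuous_V: "continuous_on S (V \<phi>)"
  using continuous_on_compose2[OF V_cont, of S "\<lambda>x. (\<phi>, x)"] by (simp add: continuous_on_Pair continuous_on_const continuous_on_id)

lemma level_nonneg: "0 \<le> level \<phi> x"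
  using Q_pd[of \<phi>] a_pd unfolding pos_def_def level_def by (cases "x = 0") (auto simp: less_imp_le add_nonneg_nonneg)

lemma V_0 [simp]: "V \<phi> 0 = 0"
  using V_pd[of \<phi>] by (simp add: pos_def_def)

lemma level_0 [simp]: "level \<phi> 0 = 0"
  using Q_pd[of \<phi>] a_pd by (simp add: pos_def_def level_def)

lemma Q_less_level: "\<xi> \<noteq> 0 \<Longrightarrow> Q \<phi> \<xi> < level \<phi> \<xi>"
  using a_pd unfolding pos_def_def level_def by simp

lemma V_le_Q: "V \<phi> \<xi> \<le> Q \<phi> \<xi>"
proof -
  obtain x where x: "ode_sol (\<lambda>x. f x (k \<phi> x) + g x (k \<phi> x) *v \<phi>) \<xi> x"
    using H1_GAS[of \<phi>] unfolding GAS_def by blast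
  then have "x 0 = \<xi>" by (simp add: ode_sol_def)
  then show ?thesis using H1_bound[OF x order_refl] by simp
qed

text \<open>The margin \<open>a\<close> puts the threshold strictly above the value of
  \<open>V\<close> at the last event, so the trigger is not active immediately and intervals have
  positive length.\<close>

lemma V_less_level: "\<xi> \<noteq> 0 \<Longrightarrow> V \<phi> \<xi> < level \<phi> \<xi>"
  using V_le_Q Q_less_level le_less_trans by blast

lemma GAS_field: "GAS (field \<theta>)"
  using H1_GAS[of \<theta>] by (simp add: field_def[abs_def])

lemma V_le_Q_field: "ode_sol (field \<theta>) \<xi> z \<Longrightarrow> t \<ge> 0 \<Longrightarrow> V \<theta> (z t) \<le> Q \<theta> \<xi>"
  using H1_bound[of \<theta> \<xi> z t] by (simp add: field_def[abs_def] ode_sol_def)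

text \<open>Unlike \<^const>\<open>next_event\<close>, this characterisation depends on \<open>x\<close> on \<open>{s..s'}\<close> only, so it makes sense
  for trajectories that are known up to time \<open>s'\<close>.\<close>

definition event :: "real \<Rightarrow> real \<Rightarrow> real^'l \<Rightarrow> (real \<Rightarrow> real^'n) \<Rightarrow> bool" where
  "event s s' \<phi> x \<longleftrightarrow> s < s' \<and> s' \<le> s + T
     \<and> (x s \<noteq> 0 \<longrightarrow> (\<forall>t\<in>{s..<s'}. V \<phi> (x t) < level \<phi> (x s)))
     \<and> (s' = s + T \<or> x s \<noteq> 0 \<and> V \<phi> (x s') = level \<phi> (x s))"

text \<open>The earlier of two candidates would lie exactly on the threshold for one and strictly
  below it for the other.\<close>

lemma event_unique:
  assumes "event s s1 \<phi> x" "event s s2 \<phi> x"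
  shows "s1 = s2"
  using assms
proof (induction s1 s2 rule: linorder_wlog)
  case (le s1 s2)
  show ?case
  proof (rule ccontr)
    assume "s1 \<noteq> s2"
    with le have "s1 < s2" by simp
    with le have "s1 \<in> {s..<s2}" "s1 \<noteq> s + T" unfolding event_def by auto
    with le have "V \<phi> (x s1) = level \<phi> (x s)" "V \<phi> (x s1) < level \<phi> (x s)"
      unfolding event_def by blast+
    then show False by simp
  qed
qed simp

text \<open>Continuity makes the infimum a first hitting time. Since \<open>V\<close> starts
  strictly below the threshold, the hitting set can be written with s \<le> t and is closed; the
  intermediate value theorem keeps \<open>V\<close> below the threshold until then.\<close>

lemma event_next_event:
  assumes x: "continuous_on {s..} x"
  shows "event s (next_event V Q a T x th s) (th s) x"
proof (cases "x s = 0")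
  case True
  then show ?thesis using T_pos by (simp add: next_event_def event_def)
next
  case False
  define c where "c = level (th s) (x s)"
  define S where "S = {t. t > s \<and> V (th s) (x t) = c}"
  have Vx: "continuous_on {s..} (\<lambda>t. V (th s) (x t))"
    by (rule continuous_on_compose2[OF continuous_V[of UNIV] x]) simp
  have Vs: "V (th s) (x s) < c" unfolding c_def by (rule V_less_level[OF False])
  have below: "V (th s) (x t) < c" if "s \<le> t" "\<forall>u\<in>S. t < u" for t
  proof (rule ccontr)
    assume "\<not> V (th s) (x t) < c"
    then obtain u where "s \<le> u" "u \<le> t" "V (th s) (x u) = c"
      using IVT'[of "\<lambda>t. V (th s) (x t)" s c t] Vs \<open>s \<le> t\<close> continuous_on_subset[OF Vx, of "{s..t}"]
      by auto
    then have "u \<in> S" using Vs unfolding S_def by (cases "u = s") auto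
    then show False using that(2) \<open>u \<le> t\<close> by force
  qed
  have ne: "next_event V Q a T x th s = (if S = {} then s + T else min (s + T) (Inf S))"
    unfolding next_event_def S_def c_def level_def Let_def using False by (rule if_P)
  show ?thesis
  proof (cases "S = {}")
    case True
    then show ?thesis using below T_pos ne unfolding event_def c_def by auto
  next
    case False
    have bdd: "bdd_below S" by (rule bdd_belowI[of _ s]) (auto simp: S_def)
    have "S = {t \<in> {s..}. V (th s) (x t) = c}"
      using Vs unfolding S_def by (auto simp: less_le)
    then have "closed S" using continuous_closed_preimage_constant[OF Vx] by simp
    then have m: "Inf S \<in> S" by (rule closed_contains_Inf[OF False bdd])
    have "t < Inf S \<Longrightarrow> u \<in> S \<Longrightarrow> t < u" for t u
      using cInf_lower[OF _ bdd, of u] by linarith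
    then have "V (th s) (x t) < c" if "s \<le> t" "t < Inf S" for t
      using below that by blast
    then show ?thesis
      using m ne False T_pos \<open>x s \<noteq> 0\<close> unfolding event_def by (auto simp: S_def min_def simp flip: c_def)
  qed
qed

lemma next_event_eq_iff:
  assumes "continuous_on {s..} x"
  shows "s' = next_event V Q a T x th s \<longleftrightarrow> event s s' (th s) x"
  using event_next_event[OF assms] event_unique by blast

section \<open>Runs with finitely many events\<close>

definition arc :: "(nat \<Rightarrow> real) \<Rightarrow> (real \<Rightarrow> real^'n) \<Rightarrow> (real \<Rightarrow> real^'l) \<Rightarrow> nat \<Rightarrow> bool" where
  "arc \<tau> x th j \<longleftrightarrow> \<tau> j < \<tau> (Suc j) \<and> \<tau> (Suc j) \<le> \<tau> j + T \<and>
     (\<forall>t\<in>{\<tau> j..<\<tau> (Suc j)}. th t = th (\<tau> j) \<and>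
        (x has_vector_derivative field (th (\<tau> j)) (x t)) (at t within {\<tau> j..\<tau> (Suc j)}))"

text \<open>The dynamics without trigger and update rule. The integral identities refer to this
  alone, so they can be used while the newest estimate is still to be determined.\<close>

definition flow :: "nat \<Rightarrow> (nat \<Rightarrow> real) \<Rightarrow> (real \<Rightarrow> real^'n) \<Rightarrow> (real \<Rightarrow> real^'l) \<Rightarrow> bool" where
  "flow i \<tau> x th \<longleftrightarrow> \<tau> 0 = 0 \<and> continuous_on {0..\<tau> i} x \<and> (\<forall>j<i. arc \<tau> x th j)"

definition update :: "(nat \<Rightarrow> real) \<Rightarrow> (real \<Rightarrow> real^'n) \<Rightarrow> (real \<Rightarrow> real^'l) \<Rightarrow> nat \<Rightarrow> bool" where
  "update \<tau> x th j \<longleftrightarrow> is_arg_min (\<lambda>\<phi>. (norm (\<phi> - th (\<tau> j)))\<^sup>2)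
     (\<lambda>\<phi>. Zvec f g k x th (mu_time \<tau> Nt T j) (\<tau> (Suc j))
        = Gmat g k x th (mu_time \<tau> Nt T j) (\<tau> (Suc j)) *v \<phi>) (th (\<tau> (Suc j)))"

text \<open>A hybrid solution restricted to its first \<open>i\<close> events; nothing is required beyond time \<open>\<tau> i\<close>.\<close>

definition prefix :: "nat \<Rightarrow> (nat \<Rightarrow> real) \<Rightarrow> (real \<Rightarrow> real^'n) \<Rightarrow> (real \<Rightarrow> real^'l) \<Rightarrow> bool" where
  "prefix i \<tau> x th \<longleftrightarrow> flow i \<tau> x th
     \<and> (\<forall>j<i. event (\<tau> j) (\<tau> (Suc j)) (th (\<tau> j)) x \<and> update \<tau> x th j)"

lemma arcD:
  assumes "arc \<tau> x th j"
  shows "\<tau> j < \<tau> (Suc j)" "\<tau> (Suc j) \<le> \<tau> j + T"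
    and "\<tau> j \<le> t \<Longrightarrow> t < \<tau> (Suc j) \<Longrightarrow> th t = th (\<tau> j)"
    and "\<tau> j \<le> t \<Longrightarrow> t < \<tau> (Suc j) \<Longrightarrow>
      (x has_vector_derivative field (th (\<tau> j)) (x t)) (at t within {\<tau> j..\<tau> (Suc j)})"
proof -
  show "\<tau> j < \<tau> (Suc j)" "\<tau> (Suc j) \<le> \<tau> j + T"
    using assms unfolding arc_def by blast+
  assume "\<tau> j \<le> t" "t < \<tau> (Suc j)"
  then have t: "t \<in> {\<tau> j..<\<tau> (Suc j)}" by simp
  show "th t = th (\<tau> j)"
    "(x has_vector_derivative field (th (\<tau> j)) (x t)) (at t within {\<tau> j..\<tau> (Suc j)})"
    using assms t unfolding arc_def by blast+
qed

lemma flow_arc: "flow i \<tau> x th \<Longrightarrow> j < i \<Longrightarrow> arc \<tau> x th j"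
  by (simp add: flow_def)

lemma flow_time_less: "flow i \<tau> x th \<Longrightarrow> j < j' \<Longrightarrow> j' \<le> i \<Longrightarrow> \<tau> j < \<tau> j'"
proof (induction j')
  case (Suc j')
  have "\<tau> j' < \<tau> (Suc j')" using Suc.prems by (intro arcD(1) flow_arc) auto
  then show ?case using Suc by (cases "j = j'") auto
qed simp

lemma flow_time_le: "flow i \<tau> x th \<Longrightarrow> j \<le> j' \<Longrightarrow> j' \<le> i \<Longrightarrow> \<tau> j \<le> \<tau> j'"
  using flow_time_less[of i \<tau> x th j j'] by (cases "j = j'") auto

lemma flow_time_nonneg: "flow i \<tau> x th \<Longrightarrow> j \<le> i \<Longrightarrow> 0 \<le> \<tau> j"
  using flow_time_le[of i \<tau> x th 0 j] by (simp add: flow_def)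

lemma flow_time_upper: "flow i \<tau> x th \<Longrightarrow> j \<le> i \<Longrightarrow> \<tau> j \<le> real j * T"
proof (induction j)
  case (Suc j)
  have "\<tau> (Suc j) \<le> \<tau> j + T" using Suc.prems by (intro arcD(2) flow_arc) auto
  then show ?case using Suc by (simp add: algebra_simps)
qed (simp add: flow_def)

lemma flow_mono:
  assumes "flow i \<tau> x th" "j \<le> i"
  shows "flow j \<tau> x th"
proof -
  have "{0..\<tau> j} \<subseteq> {0..\<tau> i}" using flow_time_le[OF assms order_refl] by auto
  then have "continuous_on {0..\<tau> j} x" using assms(1) continuous_on_subset unfolding flow_def by blast
  then show ?thesis using assms unfolding flow_def by simp
qed

lemma prefix_mono: "prefix i \<tau> x th \<Longrightarrow> j \<le> i \<Longrightarrow> prefix j \<tau> x th"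
  unfolding prefix_def using flow_mono by auto

lemma flow_cover:
  assumes "flow i \<tau> x th" "0 \<le> t" "t < \<tau> i"
  obtains j where "j < i" "\<tau> j \<le> t" "t < \<tau> (Suc j)"
  using assms
proof (induction i arbitrary: thesis)
  case (Suc i)
  show ?case
  proof (cases "t < \<tau> i")
    case True
    show ?thesis
    proof (rule Suc.IH[OF _ flow_mono[OF Suc.prems(2)] Suc.prems(3) True])
      show thesis if "j < i" "\<tau> j \<le> t" "t < \<tau> (Suc j)" for j
        using Suc.prems(1)[OF less_SucI] that by blast
    qed simp
  next
    case False
    then show ?thesis using Suc.prems(1)[of i] Suc.prems(4) by simp
  qed
qed (simp add: flow_def)

lemma flow_continuous:
  assumes "flow i \<tau> x th" "0 \<le> p" "q \<le> \<tau> i"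
  shows "continuous_on {p..q} x"
proof (rule continuous_on_subset)
  show "continuous_on {0..\<tau> i} x" using assms(1) by (simp add: flow_def)
  show "{p..q} \<subseteq> {0..\<tau> i}" using assms(2,3) by simp
qed

lemma flow_arc_deriv:
  assumes "flow i \<tau> x th" "j < i" "\<tau> j < t" "t < \<tau> (Suc j)"
  shows "(x has_vector_derivative field (th (\<tau> j)) (x t)) (at t)"
proof -
  have "(x has_vector_derivative field (th (\<tau> j)) (x t)) (at t within {\<tau> j..\<tau> (Suc j)})"
    using assms by (intro arcD(4) flow_arc) auto
  moreover have "at t within {\<tau> j..\<tau> (Suc j)} = at t"
    by (rule at_within_interior) (use assms in simp)
  ultimately show ?thesis by simp
qed

lemma flow_th: "flow i \<tau> x th \<Longrightarrow> j < i \<Longrightarrow> \<tau> j \<le> t \<Longrightarrow> t < \<tau> (Suc j) \<Longrightarrow> th t = th (\<tau> j)"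
  by (rule arcD(3)[OF flow_arc])

lemma flow_deriv:
  assumes "flow i \<tau> x th" "0 < t" "t < \<tau> i" "t \<notin> \<tau> ` {..i}"
  shows "(x has_vector_derivative field (th t) (x t)) (at t)"
proof -
  obtain j where j: "j < i" "\<tau> j \<le> t" "t < \<tau> (Suc j)"
    using flow_cover[OF assms(1) less_imp_le[OF assms(2)] assms(3)] .
  then have "\<tau> j < t" using assms(4) by (auto simp: less_le)
  then show ?thesis using flow_arc_deriv[OF assms(1) j(1) _ j(3)] flow_th[OF assms(1) j] by simp
qed

text \<open>The derivative of \<open>x\<close> may jump at events, so the fundamental theorem is
  used with these finitely many exceptional points.\<close>

lemma has_integral_field:
  assumes "flow i \<tau> x th" "0 \<le> p" "p \<le> q" "q \<le> \<tau> i"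
  shows "((\<lambda>s. field (th s) (x s)) has_integral x q - x p) {p..q}"
  by (rule fundamental_theorem_of_calculus_interior_strong[of "\<tau> ` {..i}"])
    (use assms flow_deriv[OF assms(1)] flow_continuous[OF assms(1)] in auto)

text \<open>On one arc the estimate is constant except possibly at the right end, where it has
  already been updated. That point is negligible, so the integrand may be replaced by a continuous
  one.\<close>

lemma arc_integral:
  fixes H :: "real^'l \<Rightarrow> real^'n \<Rightarrow> 'b::euclidean_space"
  assumes fl: "flow i \<tau> x th" and j: "j < i" and q: "\<tau> j \<le> p" "q \<le> \<tau> (Suc j)"
    and H: "continuous_on UNIV (H (th (\<tau> j)))"
  shows "continuous_on {p..q} (\<lambda>s. H (th (\<tau> j)) (x s))"
    and "(\<lambda>s. H (th s) (x s)) integrable_on {p..q}"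
    and "integral {p..q} (\<lambda>s. H (th s) (x s)) = integral {p..q} (\<lambda>s. H (th (\<tau> j)) (x s))"
proof -
  have "continuous_on {p..q} x"
    using flow_continuous[OF fl] flow_time_nonneg[OF fl, of j] flow_time_le[OF fl, of "Suc j" i] j q
    by (meson Suc_leI less_imp_le order_refl order_trans)
  then show c: "continuous_on {p..q} (\<lambda>s. H (th (\<tau> j)) (x s))"
    by (rule continuous_on_compose2[OF H]) simp
  have eq: "H (th s) (x s) = H (th (\<tau> j)) (x s)" if "s \<in> {p..q} - {\<tau> (Suc j)}" for s
    using flow_th[OF fl j, of s] that q by auto
  show "(\<lambda>s. H (th s) (x s)) integrable_on {p..q}"
    by (rule integrable_spike_finite[OF _ eq integrable_continuous_interval[OF c], of "{\<tau> (Suc j)}"]) simp_all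
  show "integral {p..q} (\<lambda>s. H (th s) (x s)) = integral {p..q} (\<lambda>s. H (th (\<tau> j)) (x s))"
    by (rule integral_spike[of "{\<tau> (Suc j)}"]) (use eq in auto)
qed

lemma flow_integrable:
  fixes H :: "real^'l \<Rightarrow> real^'n \<Rightarrow> 'b::euclidean_space"
  assumes "flow i \<tau> x th" and H: "\<And>\<phi>. continuous_on UNIV (H \<phi>)"
  shows "(\<lambda>s. H (th s) (x s)) integrable_on {0..\<tau> i}"
  using assms(1)
proof (induction i)
  case 0
  then show ?case using integrable_on_refl[of "\<lambda>s. H (th s) (x s)" "0::real"] by (simp add: flow_def)
next
  case (Suc i)
  have "(\<lambda>s. H (th s) (x s)) integrable_on {0..\<tau> i}"
    using Suc.IH flow_mono[OF Suc.prems] by simp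
  moreover have "(\<lambda>s. H (th s) (x s)) integrable_on {\<tau> i..\<tau> (Suc i)}"
    by (rule arc_integral(2)[OF Suc.prems lessI order_refl order_refl H])
  ultimately show ?case
    using Henstock_Kurzweil_Integration.integrable_combine[OF flow_time_nonneg[OF Suc.prems, of i]
      flow_time_le[OF Suc.prems, of i "Suc i"]] by simp
qed

section \<open>The regression identity and the Gram matrix along a run\<close>

definition q_int :: "(real \<Rightarrow> real^'n) \<Rightarrow> (real \<Rightarrow> real^'l) \<Rightarrow> real \<Rightarrow> real^'l^'n" where
  "q_int x th t = integral {0..t} (\<lambda>s. g (x s) (k (th s) (x s)))"

lemma flow_integrable_f: "flow i \<tau> x th \<Longrightarrow> (\<lambda>s. f (x s) (k (th s) (x s))) integrable_on {0..\<tau> i}"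
  by (rule flow_integrable[where H = "\<lambda>\<phi> x. f x (k \<phi> x)"]) (simp, rule lipschitz_on_balls_continuous_on[OF lip_f_k])

lemma flow_integrable_g: "flow i \<tau> x th \<Longrightarrow> (\<lambda>s. g (x s) (k (th s) (x s))) integrable_on {0..\<tau> i}"
  by (rule flow_integrable[where H = "\<lambda>\<phi> x. g x (k \<phi> x)"]) (simp, rule lipschitz_on_balls_continuous_on[OF lip_g_k])

lemma continuous_q_int:
  assumes "flow i \<tau> x th" "0 \<le> p" "q \<le> \<tau> i"
  shows "continuous_on {p..q} (q_int x th)"
proof -
  have "continuous_on {0..\<tau> i} (q_int x th)"
    unfolding q_int_def by (rule indefinite_integral_continuous_1[OF flow_integrable_g[OF assms(1)]])
  then show ?thesis using assms by (auto elim: continuous_on_subset)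
qed

lemma q_int_diff:
  assumes fl: "flow i \<tau> x th" and t: "0 \<le> \<sigma>" "\<sigma> \<le> t" "t \<le> \<tau> i"
  shows "integral {\<sigma>..t} (\<lambda>s. g (x s) (k (th s) (x s))) = q_int x th t - q_int x th \<sigma>"
proof -
  have "(\<lambda>s. g (x s) (k (th s) (x s))) integrable_on {0..t}"
    by (rule integrable_on_subinterval[OF flow_integrable_g[OF fl]]) (use t in auto)
  from Henstock_Kurzweil_Integration.integral_combine[OF t(1,2) this]
  show ?thesis by (simp add: q_int_def algebra_simps)
qed

lemma qfun_eq:
  assumes "flow i \<tau> x th" "0 \<le> \<sigma>" "\<sigma> \<le> \<tau> i" "0 \<le> t" "t \<le> \<tau> i"
  shows "qfun g k x th t \<sigma> = q_int x th t - q_int x th \<sigma>"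
  using q_int_diff[OF assms(1), of \<sigma> t] q_int_diff[OF assms(1), of t \<sigma>] assms
  by (auto simp: qfun_def oint_def)

text \<open>The integrated equation with the part linear in \<theta> moved to the other side;
  \<open>pfun_eq\<close> then expresses p = q \<theta>.\<close>

lemma integral_f_eq:
  assumes fl: "flow i \<tau> x th" and t: "0 \<le> \<sigma>" "\<sigma> \<le> t" "t \<le> \<tau> i"
  shows "integral {\<sigma>..t} (\<lambda>s. f (x s) (k (th s) (x s)))
    = x t - x \<sigma> - (q_int x th t - q_int x th \<sigma>) *v \<theta>"
proof -
  have sub: "{\<sigma>..t} \<subseteq> {0..\<tau> i}" using t by auto
  have fi: "(\<lambda>s. f (x s) (k (th s) (x s))) integrable_on {\<sigma>..t}"
    by (rule integrable_on_subinterval[OF flow_integrable_f[OF fl] sub])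
  have gi: "(\<lambda>s. g (x s) (k (th s) (x s))) integrable_on {\<sigma>..t}"
    by (rule integrable_on_subinterval[OF flow_integrable_g[OF fl] sub])
  have "integral {\<sigma>..t} (\<lambda>s. g (x s) (k (th s) (x s)) *v \<theta>) = (q_int x th t - q_int x th \<sigma>) *v \<theta>"
    using integral_linear[OF gi bounded_linear_matrix_vector_mult_left, of \<theta>] q_int_diff[OF assms]
    by (simp add: o_def)
  moreover have "(\<lambda>s. g (x s) (k (th s) (x s)) *v \<theta>) integrable_on {\<sigma>..t}"
    using integrable_linear[OF gi bounded_linear_matrix_vector_mult_left, of \<theta>] by (simp add: o_def)
  ultimately have "((\<lambda>s. g (x s) (k (th s) (x s)) *v \<theta>) has_integral (q_int x th t - q_int x th \<sigma>) *v \<theta>) {\<sigma>..t}"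
    by (simp add: has_integral_iff)
  from has_integral_diff[OF has_integral_field[OF assms] this]
  show ?thesis by (simp add: field_def integral_unique)
qed

lemma pfun_eq:
  assumes "flow i \<tau> x th" "0 \<le> \<sigma>" "\<sigma> \<le> \<tau> i" "0 \<le> t" "t \<le> \<tau> i"
  shows "pfun f k x th t \<sigma> = (q_int x th t - q_int x th \<sigma>) *v \<theta>"
  using integral_f_eq[OF assms(1), of \<sigma> t] integral_f_eq[OF assms(1), of t \<sigma>] assms
  by (auto simp: pfun_def oint_def matrix_vector_mult_diff_rdistrib)

lemma Gmat_eq:
  assumes "flow i \<tau> x th" "0 \<le> p" "q \<le> \<tau> i"
  shows "Gmat g k x th p q = integral {p..q} (\<lambda>t. integral {p..q} (gram (q_int x th) t))"
  unfolding Gmat_def gram_def using assms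
  by (intro integral_cong) (simp add: qfun_eq[OF assms(1)])

lemma Zvec_eq:
  assumes "flow i \<tau> x th" "0 \<le> p" "q \<le> \<tau> i"
  shows "Zvec f g k x th p q = Gmat g k x th p q *v \<theta>"
proof -
  have "Zvec f g k x th p q
      = integral {p..q} (\<lambda>t. integral {p..q} (\<lambda>\<sigma>. gram (q_int x th) t \<sigma> *v \<theta>))"
    unfolding Zvec_def gram_mult_vec using assms
    by (intro integral_cong) (simp add: qfun_eq[OF assms(1)] pfun_eq[OF assms(1)])
  then show ?thesis
    using integral_gram_mult_vec(1)[OF continuous_q_int[OF assms] bounded_linear_matrix_vector_mult_left, of \<theta>]
      Gmat_eq[OF assms] by simp
qed

text \<open>The kernel property makes the increments of \<open>q_int\<close> annihilate
  \<open>d\<close> on the window. Differentiating them within one arc gives the claim for the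
  integrand. The function \<open>h\<close> keeps the arc's own estimate up to the right end, so the
  closed interval demanded by (H3) is covered although \<open>th\<close> may jump there.\<close>

lemma Gmat_kernel:
  assumes fl: "flow i \<tau> x th" and p: "0 \<le> p" "p \<le> \<tau> j" and q: "\<tau> (Suc j) \<le> q" "q \<le> \<tau> i"
    and j: "j < i" and d: "Gmat g k x th p q *v d = 0" and t: "t \<in> {\<tau> j..\<tau> (Suc j)}"
  shows "g (x t) (k (th (\<tau> j)) (x t)) *v d = 0"
proof -
  have tj: "\<tau> j < \<tau> (Suc j)" using arcD(1)[OF flow_arc[OF fl j]] .
  define h where "h s = g (x s) (k (th (\<tau> j)) (x s))" for s
  have hc: "continuous_on {\<tau> j..\<tau> (Suc j)} h"
    unfolding h_def
    by (rule arc_integral(1)[OF fl j order_refl order_refl, of "\<lambda>\<phi> x. g x (k \<phi> x)"])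
      (rule lipschitz_on_balls_continuous_on[OF lip_g_k])
  have zero: "integral {\<tau> j..u} (\<lambda>s. h s *v d) = 0" if u: "u \<in> {\<tau> j..\<tau> (Suc j)}" for u
  proof -
    have "integral {\<tau> j..u} h = integral {\<tau> j..u} (\<lambda>s. g (x s) (k (th s) (x s)))"
      unfolding h_def
      by (rule arc_integral(3)[OF fl j order_refl, of u "\<lambda>\<phi> x. g x (k \<phi> x)", symmetric])
        (use u lipschitz_on_balls_continuous_on[OF lip_g_k] in auto)
    also have "\<dots> = q_int x th u - q_int x th (\<tau> j)"
      by (rule q_int_diff[OF fl]) (use u p q in auto)
    also have "\<dots> *v d = 0"
      using integral_gram_kernel[OF continuous_q_int[OF fl p(1) q(2)], of d u "\<tau> j"] d
        Gmat_eq[OF fl p(1) q(2)] u p q tj by auto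
    finally show ?thesis
      using integral_linear[OF integrable_continuous_interval bounded_linear_matrix_vector_mult_left, of "\<tau> j" u h d]
        continuous_on_subset[OF hc, of "{\<tau> j..u}"] u by (simp add: o_def)
  qed
  have "continuous_on {\<tau> j..\<tau> (Suc j)} (\<lambda>s. h s *v d)"
    by (rule bounded_linear.continuous_on[OF bounded_linear_matrix_vector_mult_left hc])
  from integral_has_vector_derivative[OF this t]
  have "((\<lambda>u. 0) has_vector_derivative h t *v d) (at t within {\<tau> j..\<tau> (Suc j)})"
    by (rule has_vector_derivative_transform[OF t, rotated]) (simp add: zero)
  then have "h t *v d = 0"
    using vector_derivative_unique_within_closed_interval[OF tj, of t "\<lambda>_. 0" "h t *v d" 0]
      t has_vector_derivative_const by simp
  then show ?thesis by (simp add: h_def)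
qed

subsection \<open>Identification and uniqueness\<close>

text \<open>The last interval is no longer than \<open>T\<close> and \<open>Nt\<close> is at least
  1, so \<open>\<tau> j\<close> itself qualifies and the minimum is over a nonempty set.\<close>

lemma mu_time_mem:
  assumes fl: "flow i \<tau> x th" and j: "j < i"
  shows "mu_time \<tau> Nt T j \<in> \<tau> ` {..j}"
proof -
  define M where "M = {\<tau> j' | j'. j' \<le> j \<and> \<tau> j' \<ge> \<tau> (Suc j) - real Nt * T}"
  have "finite M" by (rule finite_subset[of _ "\<tau> ` {..j}"]) (auto simp: M_def)
  moreover have "1 * T \<le> real Nt * T" using Nt_gt T_pos by (intro mult_right_mono) auto
  then have "\<tau> j \<in> M" using arcD(2)[OF flow_arc[OF fl j]] by (auto simp: M_def)
  ultimately have "Min M \<in> M" by (intro Min_in) auto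
  then show ?thesis unfolding mu_time_def M_def[symmetric] by (auto simp: M_def)
qed

lemma mu_time_bounds:
  assumes fl: "flow i \<tau> x th" and j: "j < i"
  shows "0 \<le> mu_time \<tau> Nt T j" "mu_time \<tau> Nt T j < \<tau> (Suc j)"
  using mu_time_mem[OF assms] flow_time_nonneg[OF fl] flow_time_less[OF fl, of _ "Suc j"] j by auto

text \<open>The first j + 1 intervals last at most (j + 1) \<open>T\<close>, which is within the
  horizon \<open>Nt * T\<close> as j + 1 \<le> \<open>N\<close> < \<open>Nt\<close>. Hence the
  window reaches back to the start.\<close>

lemma mu_time_early:
  assumes fl: "flow i \<tau> x th" and j: "j < i" "j < N"
  shows "mu_time \<tau> Nt T j = 0"
  unfolding mu_time_def
proof (rule Min_eqI)
  show "finite {\<tau> j' | j'. j' \<le> j \<and> \<tau> j' \<ge> \<tau> (Suc j) - real Nt * T}"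
    by (rule finite_subset[of _ "\<tau> ` {..j}"]) auto
  show "0 \<le> y" if "y \<in> {\<tau> j' | j'. j' \<le> j \<and> \<tau> j' \<ge> \<tau> (Suc j) - real Nt * T}" for y
    using that flow_time_nonneg[OF fl] j by auto
  have "\<tau> (Suc j) \<le> real (Suc j) * T" using flow_time_upper[OF fl, of "Suc j"] j by simp
  also have "\<dots> \<le> real Nt * T" using j Nt_gt T_pos by (intro mult_right_mono) auto
  finally show "0 \<in> {\<tau> j' | j'. j' \<le> j \<and> \<tau> j' \<ge> \<tau> (Suc j) - real Nt * T}"
    using fl by (auto simp: flow_def intro!: exI[of _ 0])
qed

text \<open>The update as a function of the past: in contrast to the predicate
  \<open>update\<close>, it can be used to define the value of \<open>th\<close> at the new
  event.\<close>

definition estimate :: "(nat \<Rightarrow> real) \<Rightarrow> (real \<Rightarrow> real^'n) \<Rightarrow> (real \<Rightarrow> real^'l) \<Rightarrow> nat \<Rightarrow> real^'l" where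
  "estimate \<tau> x th j = closest_point {\<phi>. Zvec f g k x th (mu_time \<tau> Nt T j) (\<tau> (Suc j))
     = Gmat g k x th (mu_time \<tau> Nt T j) (\<tau> (Suc j)) *v \<phi>} (th (\<tau> j))"

lemma Zvec_mu_time:
  assumes fl: "flow i \<tau> x th" and j: "j < i"
  shows "Zvec f g k x th (mu_time \<tau> Nt T j) (\<tau> (Suc j)) = Gmat g k x th (mu_time \<tau> Nt T j) (\<tau> (Suc j)) *v \<theta>"
  using Zvec_eq[OF fl mu_time_bounds(1)[OF assms]] flow_time_le[OF fl, of "Suc j" i] j by simp

lemma update_iff:
  assumes fl: "flow i \<tau> x th" and j: "j < i"
  shows "update \<tau> x th j \<longleftrightarrow> th (\<tau> (Suc j)) = estimate \<tau> x th j"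
  unfolding update_def estimate_def
  by (rule is_arg_min_affine_iff_closest_point(1)[OF Zvec_mu_time[OF assms]])

lemma update_dist_le:
  assumes fl: "flow i \<tau> x th" and j: "j < i" and u: "update \<tau> x th j"
  shows "dist (th (\<tau> (Suc j))) \<theta> \<le> dist (th (\<tau> j)) \<theta>"
  using is_arg_min_affine_iff_closest_point(2)[OF Zvec_mu_time[OF fl j], of "th (\<tau> j)"] u
  unfolding update_iff[OF fl j] estimate_def by simp

lemma update_Gmat:
  assumes fl: "flow i \<tau> x th" and j: "j < i" and u: "update \<tau> x th j"
  shows "Gmat g k x th (mu_time \<tau> Nt T j) (\<tau> (Suc j)) *v (th (\<tau> (Suc j)) - \<theta>) = 0"
  using u Zvec_mu_time[OF fl j] unfolding update_def is_arg_min_def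
  by (simp add: matrix_vector_mult_diff_distrib)

lemma prefix_dist_le:
  assumes p: "prefix i \<tau> x th" and "j \<le> j'" "j' \<le> i"
  shows "dist (th (\<tau> j')) \<theta> \<le> dist (th (\<tau> j)) \<theta>"
  using assms(2,3)
proof (induction j')
  case (Suc j')
  have "dist (th (\<tau> (Suc j'))) \<theta> \<le> dist (th (\<tau> j')) \<theta>"
    using p Suc.prems update_dist_le unfolding prefix_def by auto
  then show ?case using Suc by (cases "j = Suc j'") auto
qed simp

text \<open>The distance to \<theta> never grows, so once zero it stays zero.\<close>

lemma prefix_identified:
  assumes "prefix i \<tau> x th" "th (\<tau> m) = \<theta>" "m \<le> j" "j \<le> i"
  shows "th (\<tau> j) = \<theta>"
  using prefix_dist_le[OF assms(1,3,4)] assms(2) by simp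

lemma flow_arc_deriv_right:
  assumes fl: "flow i \<tau> x th" and j: "j < i" and t: "\<tau> j \<le> t" "t < \<tau> (Suc j)"
  shows "(x has_vector_derivative field (th (\<tau> j)) (x t)) (at_right t)"
proof -
  have "{t..\<tau> (Suc j)} \<subseteq> {\<tau> j..\<tau> (Suc j)}" using t by simp
  from has_vector_derivative_within_subset[OF arcD(4)[OF flow_arc[OF fl j] t] this]
  show ?thesis by (simp only: at_within_Icc_at_right[OF t(2)])
qed

text \<open>An estimate still wrong at event \<open>N\<close> was wrong at all earlier events,
  because a correct one is kept. So the errors at events 0 to \<open>N\<close> are all nonzero, and
  they satisfy the orthogonality conditions of (H3), which then forces
  \<open>x 0 = 0\<close>.\<close>

lemma identification:
  assumes p: "prefix N \<tau> x th" and x0: "x 0 \<noteq> 0"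
  shows "th (\<tau> N) = \<theta>"
proof (rule ccontr)
  assume ne: "th (\<tau> N) \<noteq> \<theta>"
  have fl: "flow N \<tau> x th" using p by (simp add: prefix_def)
  define d where "d j = th (\<tau> j) - \<theta>" for j
  have thd: "\<theta> + d j = th (\<tau> j)" for j by (simp add: d_def)
  \<comment> \<open>Away from the events the time set is a union of open arcs, so continuity of the
    derivative can be checked arc by arc.\<close>
  have U: "{0..\<tau> N} - \<tau> ` {0..N} = (\<Union>j<N. {\<tau> j<..<\<tau> (Suc j)})"
  proof (intro equalityI subsetI)
    fix t assume t: "t \<in> {0..\<tau> N} - \<tau> ` {0..N}"
    then have "0 \<le> t" "t \<le> \<tau> N" "t \<noteq> \<tau> N" by auto
    then obtain j where j: "j < N" "\<tau> j \<le> t" "t < \<tau> (Suc j)"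
      using flow_cover[OF fl, of t] by (metis order.not_eq_order_implies_strict)
    then have "t \<noteq> \<tau> j" using t by auto
    with j show "t \<in> (\<Union>j<N. {\<tau> j<..<\<tau> (Suc j)})" by force
  next
    fix t assume "t \<in> (\<Union>j<N. {\<tau> j<..<\<tau> (Suc j)})"
    then obtain j where j: "j < N" "\<tau> j < t" "t < \<tau> (Suc j)" by auto
    have "t \<noteq> \<tau> m" if "m \<le> N" for m
      using flow_time_le[OF fl, of m j] flow_time_le[OF fl, of "Suc j" m] j that by (cases "m \<le> j") auto
    then have "t \<notin> \<tau> ` {0..N}" by (metis atLeastAtMost_iff imageE)
    then show "t \<in> {0..\<tau> N} - \<tau> ` {0..N}"
      using j flow_time_nonneg[OF fl, of j] flow_time_le[OF fl, of "Suc j" N] by auto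
  qed
  have "\<forall>t\<in>{0..\<tau> N}. x t = 0"
  proof (rule H3[of \<tau> d x \<theta>])
    show "\<tau> 0 = 0" using fl by (simp add: flow_def)
    show "\<forall>i<N. \<tau> i < \<tau> (Suc i)" using arcD(1)[OF flow_arc[OF fl]] by blast
    show "\<forall>i\<le>N. d i \<noteq> 0" using prefix_identified[OF p] ne by (auto simp: d_def)
    show "continuous_on {0..\<tau> N} x" using fl by (simp add: flow_def)
    show "\<exists>x'. (\<forall>t\<in>{0..\<tau> N} - \<tau> ` {0..N}. (x has_vector_derivative x' t) (at t)) \<and>
             continuous_on ({0..\<tau> N} - \<tau> ` {0..N}) x'"
    proof (intro exI conjI)
      show "\<forall>t\<in>{0..\<tau> N} - \<tau> ` {0..N}. (x has_vector_derivative field (th t) (x t)) (at t)"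
      proof
        fix t assume "t \<in> {0..\<tau> N} - \<tau> ` {0..N}"
        then obtain j where j: "j < N" "\<tau> j < t" "t < \<tau> (Suc j)" unfolding U by auto
        show "(x has_vector_derivative field (th t) (x t)) (at t)"
          unfolding flow_th[OF fl j(1) less_imp_le[OF j(2)] j(3)] by (rule flow_arc_deriv[OF fl j])
      qed
      show "continuous_on ({0..\<tau> N} - \<tau> ` {0..N}) (\<lambda>t. field (th t) (x t))"
        unfolding U
      proof (rule continuous_on_open_UN)
        fix j assume "j \<in> {..<N}"
        then have j: "j < N" by simp
        have "continuous_on {\<tau> j<..<\<tau> (Suc j)} (\<lambda>t. field (th (\<tau> j)) (x t))"
          by (rule continuous_on_subset[OF arc_integral(1)[OF fl j order_refl order_refl, of field]])
            (auto intro: lipschitz_on_balls_continuous_on[OF lip_field])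
        then show "continuous_on {\<tau> j<..<\<tau> (Suc j)} (\<lambda>t. field (th t) (x t))"
          by (rule continuous_on_eq) (metis flow_th[OF fl j] greaterThanLessThan_iff less_imp_le)
      qed auto
    qed
    show "\<forall>t\<in>{0..<\<tau> N}. \<exists>D. (x has_vector_derivative D) (at_right t)"
      using flow_cover[OF fl] flow_arc_deriv_right[OF fl] by (metis atLeastLessThan_iff)
    show "\<forall>i<N. \<forall>t\<in>{\<tau> i..<\<tau> (Suc i)}. (x has_vector_derivative
             (f (x t) (k (\<theta> + d i) (x t)) + g (x t) (k (\<theta> + d i) (x t)) *v \<theta>)) (at_right t)"
      using flow_arc_deriv_right[OF fl] by (simp add: thd field_def)
    show "\<forall>i<N. \<forall>j\<le>i. \<forall>t\<in>{\<tau> j..\<tau> (Suc j)}. g (x t) (k (\<theta> + d j) (x t)) *v d (Suc i) = 0"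
    proof (intro allI impI ballI)
      fix i j t assume i: "i < N" and j: "j \<le> i" and t: "t \<in> {\<tau> j..\<tau> (Suc j)}"
      \<comment> \<open>The window of update \<open>i\<close> is all of
        [0, \<open>\<tau> (Suc i)\<close>], so the error after it is invisible on every arc up to
        arc \<open>i\<close>.\<close>
      have "Gmat g k x th 0 (\<tau> (Suc i)) *v d (Suc i) = 0"
        using update_Gmat[OF fl i] mu_time_early[OF fl i i] p i unfolding prefix_def d_def by simp
      then show "g (x t) (k (\<theta> + d j) (x t)) *v d (Suc i) = 0"
        unfolding thd using i j t
        by (intro Gmat_kernel[OF fl order_refl, where q = "\<tau> (Suc i)"])
          (auto intro: flow_time_nonneg[OF fl] flow_time_le[OF fl])
    qed
  qed
  moreover have "0 \<le> \<tau> N" using flow_time_nonneg[OF fl] by simp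
  ultimately show False using x0 by simp
qed

text \<open>Here \<open>y\<close> is any curve with the same field and \<open>q\<close> may lie
  before the end of the arc. It is compared with the zero solution, with a nominal solution, and
  with a second run whose next event may a priori come earlier.\<close>

lemma arc_unique:
  assumes fl: "flow i \<tau> x th" and j: "j < i" and y: "continuous_on {\<tau> j..q} y" "q \<le> \<tau> (Suc j)"
    and yd: "\<And>t. \<tau> j < t \<Longrightarrow> t < q \<Longrightarrow> (y has_vector_derivative field (th (\<tau> j)) (y t)) (at t)"
    and eq: "x (\<tau> j) = y (\<tau> j)" and t: "\<tau> j \<le> t" "t \<le> q"
  shows "x t = y t"
proof (rule ode_unique[where F = "field (th (\<tau> j))" and a = "\<tau> j" and b = q])
  show "continuous_on {\<tau> j..q} x"
    by (rule flow_continuous[OF fl flow_time_nonneg[OF fl]])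
      (use j y flow_time_le[OF fl, of "Suc j" i] in auto)
  show "(x has_vector_derivative field (th (\<tau> j)) (x t)) (at t)" if "\<tau> j < t" "t < q" for t
    using flow_arc_deriv[OF fl j] that y(2) by simp
qed (use y(1) yd eq t lip_field in auto)

lemma flow_zero:
  assumes "flow i \<tau> x th" "x 0 = 0" "0 \<le> t" "t \<le> \<tau> i"
  shows "x t = 0"
  using assms
proof (induction i arbitrary: t)
  case 0
  then show ?case by (simp add: flow_def)
next
  case (Suc i)
  have IH: "x t = 0" if "0 \<le> t" "t \<le> \<tau> i" for t
    using Suc.IH[OF flow_mono[OF Suc.prems(1)]] Suc.prems(2) that by simp
  show ?case
  proof (cases "t \<le> \<tau> i")
    case False
    show ?thesis
    proof (rule arc_unique[OF Suc.prems(1) lessI, where q = "\<tau> (Suc i)" and y = "\<lambda>_. 0"])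
      show "x (\<tau> i) = 0" using IH flow_time_nonneg[OF Suc.prems(1), of i] by simp
    qed (use False Suc.prems in auto)
  qed (use IH Suc.prems in auto)
qed

section \<open>Behaviour after identification and non-accumulation of events\<close>

lemma has_vector_derivative_shift:
  assumes "(z has_vector_derivative D) (at (t - s) within A)"
  shows "((\<lambda>t. z (t - s)) has_vector_derivative D) (at t within (+) s ` A)"
proof -
  have "((\<lambda>t. t - s) has_vector_derivative 1) (at t within (+) s ` A)"
    by (auto intro!: derivative_eq_intros)
  moreover have "(\<lambda>t. t - s) ` ((+) s ` A) = A" by (auto simp: image_image)
  ultimately show ?thesis
    using vector_diff_chain_within[of "\<lambda>t. t - s" 1 t "(+) s ` A" z] assms by (simp add: o_def)
qed

text \<open>After identification the estimate is frozen, so later events restart the same equation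
  and the arcs join to a single nominal solution.\<close>

lemma prefix_tail:
  assumes "prefix i \<tau> x th" "m \<le> i" "th (\<tau> m) = \<theta>" "ode_sol (field \<theta>) (x (\<tau> m)) z" "\<tau> m \<le> t" "t \<le> \<tau> i"
  shows "x t = z (t - \<tau> m)"
  using assms
proof (induction i arbitrary: t)
  case 0
  then show ?case by (simp add: ode_sol_def)
next
  case (Suc i)
  show ?case
  proof (cases "m = Suc i")
    case True
    then show ?thesis using Suc.prems by (simp add: ode_sol_def)
  next
    case False
    then have m: "m \<le> i" using Suc.prems by simp
    have fl: "flow (Suc i) \<tau> x th" using Suc.prems by (simp add: prefix_def)
    have mi: "\<tau> m \<le> \<tau> i" using flow_time_le[OF fl m] by simp
    have IH: "x t = z (t - \<tau> m)" if "\<tau> m \<le> t" "t \<le> \<tau> i" for t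
      using Suc.IH[OF prefix_mono[OF Suc.prems(1)] m Suc.prems(3,4) that] by simp
    have thi: "th (\<tau> i) = \<theta>" using prefix_identified[OF Suc.prems(1,3) m] by simp
    show ?thesis
    proof (cases "t \<le> \<tau> i")
      case False
      show ?thesis
      proof (rule arc_unique[OF fl lessI, where q = "\<tau> (Suc i)" and y = "\<lambda>t. z (t - \<tau> m)"])
        show "continuous_on {\<tau> i..\<tau> (Suc i)} (\<lambda>t. z (t - \<tau> m))"
        proof (rule continuous_on_compose2[where f = "\<lambda>t. t - \<tau> m" and g = z and t = "{0..}"])
          show "continuous_on {0..} z" using Suc.prems by (simp add: ode_sol_def)
        qed (use mi in \<open>auto intro!: continuous_intros\<close>)
        show "((\<lambda>t. z (t - \<tau> m)) has_vector_derivative field (th (\<tau> i)) (z (t - \<tau> m))) (at t)"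
          if "\<tau> i < t" for t
          using has_vector_derivative_shift[OF ode_sol_at[OF Suc.prems(4), of "t - \<tau> m"]] that mi thi by simp
      qed (use False Suc.prems IH mi in auto)
    qed (use IH Suc.prems in auto)
  qed
qed

lemma event_zero: "event s s' \<phi> x \<Longrightarrow> x s = 0 \<Longrightarrow> s' = s + T"
  by (simp add: event_def)

text \<open>Along the nominal loop (H1) bounds \<open>V\<close> by \<open>Q\<close> at the last
  event, strictly below the threshold by the margin \<open>a\<close>; only the clock is left to
  cause an event.\<close>

lemma prefix_tail_step:
  assumes p: "prefix (Suc j) \<tau> x th" and th: "th (\<tau> j) = \<theta>"
  shows "\<tau> (Suc j) = \<tau> j + T"
proof (rule ccontr)
  assume ne: "\<tau> (Suc j) \<noteq> \<tau> j + T"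
  have ev: "event (\<tau> j) (\<tau> (Suc j)) \<theta> x" using p th unfolding prefix_def by auto
  then have x: "x (\<tau> j) \<noteq> 0" and V: "V \<theta> (x (\<tau> (Suc j))) = level \<theta> (x (\<tau> j))" and less: "\<tau> j < \<tau> (Suc j)"
    using ne unfolding event_def by auto
  obtain z where z: "ode_sol (field \<theta>) (x (\<tau> j)) z" using GAS_field unfolding GAS_def by blast
  have "x (\<tau> (Suc j)) = z (\<tau> (Suc j) - \<tau> j)"
    using prefix_tail[OF p _ th z, of "\<tau> (Suc j)"] less by simp
  then have "V \<theta> (x (\<tau> (Suc j))) \<le> Q \<theta> (x (\<tau> j))" using V_le_Q_field[OF z] less by simp
  then show False using V Q_less_level[OF x, of \<theta>] by simp
qed

text \<open>Either the trajectory is zero, where the trigger is switched off, or the parameter is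
  known from event \<open>N\<close> on.\<close>

lemma prefix_late_step:
  assumes p: "prefix (Suc j) \<tau> x th" and "N \<le> j"
  shows "\<tau> (Suc j) = \<tau> j + T"
proof (cases "x 0 = 0")
  case True
  have fl: "flow (Suc j) \<tau> x th" and ev: "event (\<tau> j) (\<tau> (Suc j)) (th (\<tau> j)) x"
    using p unfolding prefix_def by auto
  have "x (\<tau> j) = 0"
    using flow_zero[OF fl True] flow_time_nonneg[OF fl, of j] flow_time_le[OF fl, of j "Suc j"] by simp
  then show ?thesis by (rule event_zero[OF ev])
next
  case False
  have "th (\<tau> N) = \<theta>" using identification[OF prefix_mono[OF p] False] assms(2) by simp
  then show ?thesis using prefix_tail_step[OF p] prefix_identified[OF p] assms(2) by simp
qed

text \<open>This excludes Zeno behaviour: the first \<open>N\<close> intervals may be arbitrarily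
  short and are counted as zero, all later ones have length \<open>T\<close>.\<close>

lemma prefix_time_lower: "prefix i \<tau> x th \<Longrightarrow> (real i - real N) * T \<le> \<tau> i"
proof (induction i)
  case 0
  then show ?case using T_pos by (simp add: prefix_def flow_def mult_nonpos_nonneg)
next
  case (Suc i)
  have fl: "flow (Suc i) \<tau> x th" using Suc.prems by (simp add: prefix_def)
  show ?case
  proof (cases "N \<le> i")
    case True
    then show ?thesis
      using prefix_late_step[OF Suc.prems True] Suc.IH[OF prefix_mono[OF Suc.prems]] by (simp add: algebra_simps)
  next
    case False
    then have "(real (Suc i) - real N) * T \<le> 0" using T_pos by (intro mult_nonpos_nonneg) auto
    then show ?thesis using flow_time_nonneg[OF fl, of "Suc i"] by simp
  qed
qed

text \<open>The two estimates \<open>th\<close> and \<open>th'\<close> may differ at time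
  \<open>\<tau> i\<close>: the integrals do not see a single point. So the new estimate can be
  computed from a run before being written at its end.\<close>

lemma estimate_cong:
  assumes fl: "flow i \<tau> x th" and fl': "flow i \<tau>' x' th'" and \<tau>: "\<And>j. j \<le> i \<Longrightarrow> \<tau>' j = \<tau> j"
    and x: "\<And>t. 0 \<le> t \<Longrightarrow> t \<le> \<tau> i \<Longrightarrow> x' t = x t" and th: "\<And>t. 0 \<le> t \<Longrightarrow> t < \<tau> i \<Longrightarrow> th' t = th t"
    and j: "j < i"
  shows "estimate \<tau>' x' th' j = estimate \<tau> x th j"
proof -
  have q: "q_int x' th' t = q_int x th t" if "t \<le> \<tau> i" for t
    unfolding q_int_def by (rule integral_spike[of "{\<tau> i}"]) (use that x th in auto)
  have G: "Gmat g k x' th' p q = Gmat g k x th p q" if "0 \<le> p" "q \<le> \<tau> i" for p q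
    using that \<tau>[of i] Gmat_eq[OF fl that] Gmat_eq[OF fl' that(1), of q]
    by (auto simp: gram_def q intro!: integral_cong)
  have mu: "mu_time \<tau>' Nt T j = mu_time \<tau> Nt T j"
  proof -
    have "{\<tau>' m | m. m \<le> j \<and> \<tau>' m \<ge> \<tau>' (Suc j) - real Nt * T}
        = {\<tau> m | m. m \<le> j \<and> \<tau> m \<ge> \<tau> (Suc j) - real Nt * T}"
      using \<tau> j by (intro Collect_cong ex_cong1) auto
    then show ?thesis by (simp only: mu_time_def)
  qed
  have Sj: "\<tau> (Suc j) \<le> \<tau> i" "\<tau> j < \<tau> i" using flow_time_le[OF fl, of "Suc j" i] flow_time_less[OF fl j] j by auto
  have "th' (\<tau>' j) = th (\<tau> j)" using th flow_time_nonneg[OF fl, of j] Sj \<tau>[of j] j by simp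
  then show ?thesis
    unfolding estimate_def Zvec_mu_time[OF fl j] Zvec_mu_time[OF fl' j]
    using G[OF mu_time_bounds(1)[OF fl j] Sj(1)] \<tau> j mu by simp
qed

lemma event_cong:
  assumes "\<And>t. s \<le> t \<Longrightarrow> t \<le> s' \<Longrightarrow> x' t = x t"
  shows "event s s' \<phi> x' \<longleftrightarrow> event s s' \<phi> x"
  using assms unfolding event_def by (cases "s < s'") auto

text \<open>In the induction the two next event times may differ at first, so states are compared
  only up to the earlier one. There the runs coincide, hence the earlier event is an event of both,
  and \<open>event_unique\<close> identifies the times; the estimates then agree because they are
  projections computed from equal data.\<close>

lemma prefix_unique:
  assumes "prefix i \<tau> x th" "prefix i \<tau>' x' th'" "x' 0 = x 0" "th' 0 = th 0"
  shows "(\<forall>j\<le>i. \<tau>' j = \<tau> j) \<and> (\<forall>t. 0 \<le> t \<and> t \<le> \<tau> i \<longrightarrow> x' t = x t \<and> th' t = th t)"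
  using assms
proof (induction i)
  case 0
  then show ?case by (auto simp: prefix_def flow_def)
next
  case (Suc i)
  have fl: "flow (Suc i) \<tau> x th" and fl': "flow (Suc i) \<tau>' x' th'"
    using Suc.prems by (auto simp: prefix_def)
  have IH: "\<And>j. j \<le> i \<Longrightarrow> \<tau>' j = \<tau> j" "\<And>t. 0 \<le> t \<Longrightarrow> t \<le> \<tau> i \<Longrightarrow> x' t = x t"
    "\<And>t. 0 \<le> t \<Longrightarrow> t \<le> \<tau> i \<Longrightarrow> th' t = th t"
    using Suc.IH[OF prefix_mono[OF Suc.prems(1)] prefix_mono[OF Suc.prems(2)]] Suc.prems by auto
  define s where "s = \<tau> i"
  define q where "q = min (\<tau> (Suc i)) (\<tau>' (Suc i))"
  have s: "0 \<le> s" "\<tau>' i = s" "s < \<tau> (Suc i)" "s < \<tau>' (Suc i)"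
    using flow_time_nonneg[OF fl, of i] IH(1)[of i] arcD(1)[OF flow_arc[OF fl lessI]]
      arcD(1)[OF flow_arc[OF fl' lessI]] by (auto simp: s_def)
  have \<phi>: "th' s = th s" and \<xi>: "x' s = x s" using IH s by (auto simp: s_def)
  have xq: "x' t = x t" if "s \<le> t" "t \<le> q" for t
  proof (rule arc_unique[OF fl lessI, where q = q and y = x', symmetric])
    show "continuous_on {\<tau> i..q} x'"
      by (rule flow_continuous[OF fl']) (use s in \<open>auto simp: q_def s_def\<close>)
    show "(x' has_vector_derivative field (th (\<tau> i)) (x' t)) (at t)" if "\<tau> i < t" "t < q" for t
      using flow_arc_deriv[OF fl' lessI, of t] that s \<phi> by (auto simp: q_def s_def)
  qed (use that \<xi> in \<open>auto simp: s_def q_def\<close>)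
  have ev: "event s (\<tau> (Suc i)) (th s) x" and ev': "event s (\<tau>' (Suc i)) (th s) x'"
    using Suc.prems(1,2) s \<phi> unfolding prefix_def s_def by fastforce+
  have S: "\<tau>' (Suc i) = \<tau> (Suc i)"
  proof (cases "\<tau> (Suc i) \<le> \<tau>' (Suc i)")
    case True
    then have "event s (\<tau> (Suc i)) (th s) x'" using ev event_cong[of s "\<tau> (Suc i)" x' x] xq by (simp add: q_def)
    then show ?thesis using ev' event_unique by blast
  next
    case False
    then have "event s (\<tau>' (Suc i)) (th s) x" using ev' event_cong[of s "\<tau>' (Suc i)" x' x] xq by (simp add: q_def)
    then show ?thesis using ev event_unique by blast
  qed
  have \<tau>: "\<tau>' j = \<tau> j" if "j \<le> Suc i" for j using IH(1)[of j] S that by (cases "j = Suc i") auto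
  have x: "x' t = x t" if "0 \<le> t" "t \<le> \<tau> (Suc i)" for t
    using IH(2)[of t] xq[of t] that S by (cases "t \<le> s") (auto simp: s_def q_def)
  have th: "th' t = th t" if "0 \<le> t" "t < \<tau> (Suc i)" for t
    using IH(3)[of t] flow_th[OF fl lessI, of t] flow_th[OF fl' lessI, of t] that S \<phi> s
    by (cases "t \<le> s") (auto simp: s_def)
  have "th' (\<tau> (Suc i)) = th (\<tau> (Suc i))"
    using estimate_cong[OF fl fl' \<tau> x th lessI] update_iff[OF fl lessI] update_iff[OF fl' lessI] Suc.prems(1,2) S
    unfolding prefix_def by auto
  then show ?case using \<tau> x th by (metis less_le)
qed

subsection \<open>Existence\<close>

text \<open>Finite escape cannot precede the event: until then \<open>V\<close> stays below the
  threshold, and (H2) for the single estimate bounds that sublevel set.\<close>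

lemma segment_exists:
  shows "\<exists>s' y. y s = \<xi> \<and> continuous_on {s..s'} y \<and> event s s' \<phi> y \<and>
    (\<forall>t\<in>{s..<s'}. (y has_vector_derivative field \<phi> (y t)) (at t within {s..s'}))"
proof (cases "\<xi> = 0")
  case True
  then show ?thesis
    using T_pos by (intro exI[of _ "s + T"] exI[of _ "\<lambda>_. 0"]) (auto simp: event_def)
next
  case False
  obtain R where R: "R > 0" "\<And>x. V \<phi> x \<le> level \<phi> \<xi> \<Longrightarrow> norm x \<le> R"
    using H2[of "{\<phi>}" "level \<phi> \<xi>"] level_nonneg by auto
  \<comment> \<open>composing the field with the projection onto a ball containing the sublevel set makes it
      globally Lipschitz without changing it before the event\<close>
  define P where "P = closest_point (cball (0::real^'n) R)"
  have ne: "cball (0::real^'n) R \<noteq> {}" using R(1) by simp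
  have P_lip: "1-lipschitz_on UNIV P"
    unfolding P_def by (rule lipschitz_onI) (simp_all add: closest_point_lipschitz[OF convex_cball closed_cball ne])
  have P_in: "P x \<in> cball 0 R" for x
    unfolding P_def by (rule closest_point_in_set[OF closed_cball ne])
  obtain L where L: "L-lipschitz_on (cball 0 R) (field \<phi>)" using lipschitz_on_ballsE[OF lip_field] .
  have "L-lipschitz_on (P ` UNIV) (field \<phi>)" by (rule lipschitz_on_subset[OF L]) (use P_in in auto)
  from lipschitz_on_compose2[OF P_lip this]
  obtain M where M: "M-lipschitz_on UNIV (\<lambda>x. field \<phi> (P x))" by blast
  obtain w where w0: "w 0 = \<xi>"
    and w: "\<And>t. t \<in> {0..T} \<Longrightarrow> (w has_vector_derivative field \<phi> (P (w t))) (at t within {0..T})"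
    using ode_exists_lipschitz[OF M, of T \<xi>] T_pos by auto
  have wc: "continuous_on {0..T} w"
    using w by (rule continuous_on_vector_derivative)
  define y where "y t = w (min (t - s) T)" for t
  have yc: "continuous_on {s..} y"
    unfolding y_def
    by (rule continuous_on_compose2[OF wc, where f = "\<lambda>t. min (t - s) T"])
      (use T_pos in \<open>auto intro!: continuous_intros\<close>)
  define s' where "s' = next_event V Q a T y (\<lambda>_. \<phi>) s"
  have ev: "event s s' \<phi> y" using event_next_event[OF yc, of "\<lambda>_. \<phi>"] by (simp add: s'_def)
  have ys: "y s = \<xi>" using T_pos by (simp add: y_def w0)
  have "(y has_vector_derivative field \<phi> (y t)) (at t within {s..s'})" if t: "t \<in> {s..<s'}" for t
  proof -
    have s': "s' \<le> s + T" using ev by (simp add: event_def)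
    have "V \<phi> (y t) < level \<phi> \<xi>" using ev t ys False unfolding event_def by auto
    then have "P (y t) = y t" unfolding P_def by (intro closest_point_self) (simp add: R(2))
    moreover have yw: "y u = w (u - s)" if "u \<in> {s..s'}" for u
      using that s' by (simp add: y_def min_def)
    ultimately have "field \<phi> (P (w (t - s))) = field \<phi> (y t)" using t by simp
    moreover have "(w has_vector_derivative field \<phi> (P (w (t - s)))) (at (t - s) within {0..T})"
      using t s' by (intro w) auto
    ultimately have "((\<lambda>t. w (t - s)) has_vector_derivative field \<phi> (y t)) (at t within (+) s ` {0..T})"
      using has_vector_derivative_shift by metis
    moreover have "{s..s'} \<subseteq> (+) s ` {0..T}" using s' by (simp add: add.commute)
    ultimately have "((\<lambda>t. w (t - s)) has_vector_derivative field \<phi> (y t)) (at t within {s..s'})"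
      by (rule has_vector_derivative_within_subset)
    then show ?thesis
      by (rule has_vector_derivative_transform[rotated 2]) (use t yw in auto)
  qed
  moreover have "continuous_on {s..s'} y" by (rule continuous_on_subset[OF yc]) auto
  ultimately show ?thesis using ys ev by blast
qed

lemma arc_cong:
  assumes "arc \<tau> x th j" "\<tau>' j = \<tau> j" "\<tau>' (Suc j) = \<tau> (Suc j)"
    and x: "\<And>t. \<tau> j \<le> t \<Longrightarrow> t \<le> \<tau> (Suc j) \<Longrightarrow> x' t = x t"
    and th: "\<And>t. \<tau> j \<le> t \<Longrightarrow> t < \<tau> (Suc j) \<Longrightarrow> th' t = th t"
  shows "arc \<tau>' x' th' j"
proof -
  have less: "\<tau> j < \<tau> (Suc j)" using arcD(1)[OF assms(1)] .
  have "th' t = th' (\<tau> j) \<and>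
      (x' has_vector_derivative field (th' (\<tau> j)) (x' t)) (at t within {\<tau> j..\<tau> (Suc j)})"
    if t: "\<tau> j \<le> t" "t < \<tau> (Suc j)" for t
  proof
    show "th' t = th' (\<tau> j)"
      using th[OF t] th[OF order_refl less] arcD(3)[OF assms(1) t] by metis
    have "(x' has_vector_derivative field (th (\<tau> j)) (x t)) (at t within {\<tau> j..\<tau> (Suc j)})"
    proof (rule has_vector_derivative_transform[OF _ _ arcD(4)[OF assms(1) t]])
      show "t \<in> {\<tau> j..\<tau> (Suc j)}" using t by simp
    qed (rule x, auto)
    then show "(x' has_vector_derivative field (th' (\<tau> j)) (x' t)) (at t within {\<tau> j..\<tau> (Suc j)})"
      unfolding th[OF order_refl less] x[OF t(1) less_imp_le[OF t(2)]] .
  qed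
  then show ?thesis using arcD(1,2)[OF assms(1)] unfolding arc_def assms(2,3) Ball_def atLeastLessThan_iff by blast
qed

lemma flow_cong:
  assumes fl: "flow i \<tau> x th" and \<tau>: "\<And>j. j \<le> i \<Longrightarrow> \<tau>' j = \<tau> j"
    and x: "\<And>t. 0 \<le> t \<Longrightarrow> t \<le> \<tau> i \<Longrightarrow> x' t = x t" and th: "\<And>t. 0 \<le> t \<Longrightarrow> t < \<tau> i \<Longrightarrow> th' t = th t"
  shows "flow i \<tau>' x' th'"
proof -
  have "continuous_on {0..\<tau> i} x'"
    by (rule continuous_on_eq[of _ x]) (use fl x in \<open>auto simp: flow_def\<close>)
  moreover have "arc \<tau>' x' th' j" if "j < i" for j
  proof (rule arc_cong[OF flow_arc[OF fl that]])
    have *: "0 \<le> \<tau> j" "\<tau> (Suc j) \<le> \<tau> i"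
      using flow_time_nonneg[OF fl, of j] flow_time_le[OF fl, of "Suc j" i] that by auto
    show "x' t = x t" if "\<tau> j \<le> t" "t \<le> \<tau> (Suc j)" for t by (rule x) (use * that in auto)
    show "th' t = th t" if "\<tau> j \<le> t" "t < \<tau> (Suc j)" for t by (rule th) (use * that in auto)
  qed (use \<tau> that in auto)
  ultimately show ?thesis using fl \<tau> by (simp add: flow_def)
qed

text \<open>A finite run is determined by its data on [0, \<open>\<tau> i\<close>], which is what
  permits extending and gluing.\<close>

lemma prefix_cong:
  assumes p: "prefix i \<tau> x th" and \<tau>: "\<And>j. j \<le> i \<Longrightarrow> \<tau>' j = \<tau> j"
    and x: "\<And>t. 0 \<le> t \<Longrightarrow> t \<le> \<tau> i \<Longrightarrow> x' t = x t" and th: "\<And>t. 0 \<le> t \<Longrightarrow> t \<le> \<tau> i \<Longrightarrow> th' t = th t"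
  shows "prefix i \<tau>' x' th'"
proof -
  have fl: "flow i \<tau> x th" using p by (simp add: prefix_def)
  have fl': "flow i \<tau>' x' th'" by (rule flow_cong[OF fl \<tau> x th]) auto
  have "event (\<tau>' j) (\<tau>' (Suc j)) (th' (\<tau>' j)) x' \<and> update \<tau>' x' th' j" if j: "j < i" for j
  proof
    have *: "0 \<le> \<tau> j" "\<tau> (Suc j) \<le> \<tau> i" "\<tau> j \<le> \<tau> i" "0 \<le> \<tau> (Suc j)"
      using flow_time_nonneg[OF fl, of j] flow_time_nonneg[OF fl, of "Suc j"]
        flow_time_le[OF fl, of "Suc j" i] flow_time_le[OF fl, of j i] j by auto
    have eq: "\<tau>' j = \<tau> j" "\<tau>' (Suc j) = \<tau> (Suc j)" using \<tau> j by auto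
    have "event (\<tau> j) (\<tau> (Suc j)) (th (\<tau> j)) x' \<longleftrightarrow> event (\<tau> j) (\<tau> (Suc j)) (th (\<tau> j)) x"
      by (rule event_cong) (use x * in auto)
    then show "event (\<tau>' j) (\<tau>' (Suc j)) (th' (\<tau>' j)) x'"
      using p j eq th[OF *(1) *(3)] unfolding prefix_def by simp
    have "estimate \<tau>' x' th' j = estimate \<tau> x th j"
      by (rule estimate_cong[OF fl fl' \<tau> x th j]) auto
    then show "update \<tau>' x' th' j"
      using p j eq th[OF *(4) *(2)] unfolding prefix_def update_iff[OF fl' j] update_iff[OF fl j]
      by (metis update_iff[OF fl j])
  qed
  then show ?thesis using fl' by (simp add: prefix_def)
qed

lemma prefix_extend:
  assumes p: "prefix i \<tau> x th"
  shows "\<exists>\<tau>' x' th'. prefix (Suc i) \<tau>' x' th' \<and> (\<forall>j\<le>i. \<tau>' j = \<tau> j) \<and>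
    (\<forall>t. 0 \<le> t \<and> t \<le> \<tau> i \<longrightarrow> x' t = x t \<and> th' t = th t)"
proof -
  define s where "s = \<tau> i"
  define \<phi> where "\<phi> = th s"
  have fl: "flow i \<tau> x th" using p by (simp add: prefix_def)
  have s0: "0 \<le> s" using flow_time_nonneg[OF fl, of i] by (simp add: s_def)
  obtain s' y where y: "y s = x s" "continuous_on {s..s'} y" "event s s' \<phi> y"
    "\<And>t. t \<in> {s..<s'} \<Longrightarrow> (y has_vector_derivative field \<phi> (y t)) (at t within {s..s'})"
    using segment_exists[where \<xi> = "x s"] by metis
  have ss': "s < s'" "s' \<le> s + T" using y(3) by (auto simp: event_def)
  define \<tau>' where "\<tau>' = \<tau>(Suc i := s')"
  define x' where "x' t = (if t \<le> s then x t else y t)" for t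
  \<comment> \<open>A provisional estimate, simply held after \<open>s\<close>. The new estimate is
    computed from it and overwrites it at the single time \<open>s'\<close>, which its own integrals
    ignore.\<close>
  define th1 where "th1 t = (if t \<le> s then th t else \<phi>)" for t
  define th' where "th' = th1(s' := estimate \<tau>' x' th1 i)"
  have \<tau>': "\<tau>' j = \<tau> j" if "j \<le> i" for j using that by (simp add: \<tau>'_def)
  have S: "\<tau>' (Suc i) = s'" "\<tau>' i = s" by (auto simp: \<tau>'_def s_def)
  have xy: "x' t = y t" if "s \<le> t" for t using that y(1) by (auto simp: x'_def)
  have xx: "x' t = x t" if "t \<le> s" for t using that by (simp add: x'_def)
  \<comment> \<open>Stated for a general \<open>h\<close> because it serves both the provisional and
    the final estimate.\<close>
  have flow: "flow (Suc i) \<tau>' x' h" if h: "\<And>t. t \<le> s \<Longrightarrow> h t = th t" "\<And>t. s \<le> t \<Longrightarrow> t < s' \<Longrightarrow> h t = \<phi>" for h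
    unfolding flow_def
  proof (intro conjI allI impI)
    have fli: "flow i \<tau>' x' h" by (rule flow_cong[OF fl \<tau>']) (use xx h in \<open>auto simp: s_def\<close>)
    then show "\<tau>' 0 = 0" by (simp add: flow_def)
    have "continuous_on {s..s'} x'" using continuous_on_eq[OF y(2), of x'] xy by simp
    moreover have "continuous_on {0..s} x'" using fli S by (simp add: flow_def)
    moreover have "{0..\<tau>' (Suc i)} = {0..s} \<union> {s..s'}" using s0 ss' S by auto
    ultimately show "continuous_on {0..\<tau>' (Suc i)} x'"
      using continuous_on_closed_Un[of "{0..s}" "{s..s'}" x'] by simp
    have "h t = h s \<and> (x' has_vector_derivative field (h s) (x' t)) (at t within {s..s'})" if t: "t \<in> {s..<s'}" for t
    proof
      have hs: "h s = \<phi>" by (rule h(2)) (use ss' in auto)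
      show "h t = h s" unfolding hs by (rule h(2)) (use t in auto)
      have "(x' has_vector_derivative field \<phi> (y t)) (at t within {s..s'})"
        by (rule has_vector_derivative_transform[OF _ _ y(4)[OF t]]) (use t xy in auto)
      moreover have "x' t = y t" using xy t by simp
      ultimately show "(x' has_vector_derivative field (h s) (x' t)) (at t within {s..s'})"
        unfolding hs by (simp only:)
    qed
    then have "arc \<tau>' x' h i" unfolding arc_def S using ss' by blast
    then show "arc \<tau>' x' h j" if "j < Suc i" for j
      using that flow_arc[OF fli] by (cases "j = i") auto
  qed
  have fl1: "flow (Suc i) \<tau>' x' th1" by (rule flow) (auto simp: th1_def \<phi>_def)
  have fl': "flow (Suc i) \<tau>' x' th'" by (rule flow) (use ss' in \<open>auto simp: th'_def th1_def \<phi>_def\<close>)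
  have agree: "x' t = x t" "th' t = th t" if "t \<le> \<tau> i" for t
    using that ss' by (auto simp: x'_def th'_def th1_def s_def)
  have p': "prefix i \<tau>' x' th'" by (rule prefix_cong[OF p \<tau>' agree])
  have "update \<tau>' x' th' i"
  proof -
    have "estimate \<tau>' x' th' i = estimate \<tau>' x' th1 i"
      by (rule estimate_cong[OF fl1 fl']) (auto simp: th'_def S)
    then show ?thesis unfolding update_iff[OF fl' lessI] S by (simp add: th'_def)
  qed
  moreover have "event (\<tau>' i) (\<tau>' (Suc i)) (th' (\<tau>' i)) x'"
    unfolding S using y(3) event_cong[of s s' x' y] xy agree(2)[of s] by (simp add: \<phi>_def s_def)
  ultimately have "prefix (Suc i) \<tau>' x' th'"
    using p' fl' unfolding prefix_def by (auto simp: less_Suc_eq)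
  then show ?thesis using \<tau>' agree by blast
qed

text \<open>Dependent choice gives finite runs, each extending the previous one. The limit at time
  \<open>t\<close> is read off from the first run that reaches \<open>t\<close>, which exists
  because event times are at least (n - \<open>N\<close>) \<open>T\<close>.\<close>

lemma infinite_prefix_exists:
  "\<exists>\<tau> x th. x 0 = x0 \<and> th 0 = th0 \<and> (\<forall>i. prefix i \<tau> x th)"
proof -
  define P where "P n p \<longleftrightarrow> prefix n (fst p) (fst (snd p)) (snd (snd p)) \<and> fst (snd p) 0 = x0 \<and> snd (snd p) 0 = th0"
    for n and p :: "(nat \<Rightarrow> real) \<times> (real \<Rightarrow> real^'n) \<times> (real \<Rightarrow> real^'l)"
  define E where "E n p p' \<longleftrightarrow> (\<forall>j\<le>n. fst p' j = fst p j) \<and> (\<forall>t. 0 \<le> t \<and> t \<le> fst p n \<longrightarrow>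
      fst (snd p') t = fst (snd p) t \<and> snd (snd p') t = snd (snd p) t)"
    for n and p p' :: "(nat \<Rightarrow> real) \<times> (real \<Rightarrow> real^'n) \<times> (real \<Rightarrow> real^'l)"
  have "\<exists>S. \<forall>n. P n (S n) \<and> E n (S n) (S (Suc n))"
  proof (rule dependent_nat_choice)
    show "\<exists>p. P 0 p"
      by (rule exI[of _ "(\<lambda>_. 0, \<lambda>_. x0, \<lambda>_. th0)"]) (simp add: P_def prefix_def flow_def)
    fix p n assume p: "P n p"
    then obtain \<tau>' x' th' where e: "prefix (Suc n) \<tau>' x' th'" "\<forall>j\<le>n. \<tau>' j = fst p j"
      "\<forall>t. 0 \<le> t \<and> t \<le> fst p n \<longrightarrow> x' t = fst (snd p) t \<and> th' t = snd (snd p) t"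
      using prefix_extend[of n "fst p" "fst (snd p)" "snd (snd p)"] unfolding P_def by blast
    have "0 \<le> fst p n" using p flow_time_nonneg[of n "fst p" _ _ n] unfolding P_def prefix_def by blast
    then have "P (Suc n) (\<tau>', x', th')" "E n p (\<tau>', x', th')"
      using e p unfolding P_def E_def by simp_all
    then show "\<exists>p'. P (Suc n) p' \<and> E n p p'" by blast
  qed
  then obtain S where S: "\<And>n. P n (S n)" "\<And>n. E n (S n) (S (Suc n))" by blast
  define tt xx hh where "tt n = fst (S n)" and "xx n = fst (snd (S n))" and "hh n = snd (snd (S n))" for n
  have p: "prefix n (tt n) (xx n) (hh n)" and init: "xx n 0 = x0" "hh n 0 = th0" for n
    using S(1)[of n] by (auto simp: P_def tt_def xx_def hh_def)
  have step: "j \<le> n \<Longrightarrow> tt (Suc n) j = tt n j"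
    "0 \<le> t \<Longrightarrow> t \<le> tt n n \<Longrightarrow> xx (Suc n) t = xx n t \<and> hh (Suc n) t = hh n t" for n j t
    using S(2)[of n] by (auto simp: E_def tt_def xx_def hh_def)
  have le: "tt n m \<le> tt n n" if "m \<le> n" for m n
    using p[of n] flow_time_le[OF _ that order_refl] unfolding prefix_def by blast
  have agree: "(\<forall>j\<le>m. tt n j = tt m j) \<and> (\<forall>t. 0 \<le> t \<and> t \<le> tt m m \<longrightarrow> xx n t = xx m t \<and> hh n t = hh m t)"
    if "m \<le> n" for m n
    using that
  proof (induction n rule: dec_induct)
    case (step n)
    have "tt m m \<le> tt n n" using step le[of m n] by auto
    then show ?case using step \<open>\<And>n j. j \<le> n \<Longrightarrow> tt (Suc n) j = tt n j\<close>
        \<open>\<And>n t. 0 \<le> t \<Longrightarrow> t \<le> tt n n \<Longrightarrow> xx (Suc n) t = xx n t \<and> hh (Suc n) t = hh n t\<close>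
      by simp
  qed simp
  define \<tau> where "\<tau> n = tt n n" for n
  have ex: "\<exists>n. t \<le> \<tau> n" for t
  proof -
    obtain n where "t / T + real N < real n" using reals_Archimedean2 by blast
    then have "t \<le> (real n - real N) * T" using T_pos by (simp add: field_simps)
    also have "\<dots> \<le> \<tau> n" unfolding \<tau>_def by (rule prefix_time_lower[OF p])
    finally show ?thesis by blast
  qed
  define \<nu> where "\<nu> t = (LEAST n. t \<le> \<tau> n)" for t
  define x th where "x t = xx (\<nu> t) t" and "th t = hh (\<nu> t) t" for t
  have "prefix i \<tau> x th" for i
  proof (rule prefix_cong[OF p])
    show "\<tau> j = tt i j" if "j \<le> i" for j using agree[OF that] by (simp add: \<tau>_def)
    fix t assume t: "0 \<le> t" "t \<le> tt i i"
    have "\<nu> t \<le> i" unfolding \<nu>_def using t by (intro Least_le) (simp add: \<tau>_def)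
    moreover have "t \<le> \<tau> (\<nu> t)" unfolding \<nu>_def using ex[of t] by (rule LeastI_ex)
    ultimately show "x t = xx i t" "th t = hh i t"
      using agree[of "\<nu> t" i] t by (auto simp: x_def th_def \<tau>_def)
  qed
  moreover have "x 0 = x0" "th 0 = th0" by (simp_all add: x_def th_def init)
  ultimately show ?thesis by blast
qed

lemma prefix_time_at_top:
  assumes p: "\<And>i. prefix i \<tau> x th"
  shows "filterlim \<tau> at_top sequentially"
proof (rule filterlim_at_top_mono)
  show "\<forall>\<^sub>F i in sequentially. (real i - real N) * T \<le> \<tau> i"
    using prefix_time_lower[OF p] by simp
  have "filterlim (\<lambda>i. T * (- real N + real i)) at_top sequentially"
    using T_pos by (intro filterlim_tendsto_pos_mult_at_top[OF tendsto_const]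
        filterlim_tendsto_add_at_top[OF tendsto_const] filterlim_real_sequentially)
  then show "filterlim (\<lambda>i. (real i - real N) * T) at_top sequentially"
    by (simp add: algebra_simps)
qed

lemma prefix_reaches:
  assumes p: "\<And>i. prefix i \<tau> x th"
  obtains i where "t \<le> \<tau> i" "m \<le> i"
proof -
  have "\<forall>\<^sub>F i in sequentially. t \<le> \<tau> i"
    using prefix_time_at_top[OF p] by (simp add: filterlim_at_top)
  then have "\<forall>\<^sub>F i in sequentially. t \<le> \<tau> i \<and> m \<le> i"
    using eventually_ge_at_top[of m] by eventually_elim simp
  then show ?thesis using that eventually_happens'[OF trivial_limit_sequentially] by blast
qed

text \<open>The bridge to the global definition. From right to left, divergence of the event times
  is a consequence of \<open>prefix_time_lower\<close>, and continuity on all of [0, \<infinity>)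
  makes the local and the global trigger equivalent.\<close>

lemma hybrid_sol_iff: "hybrid_sol f g k V Q a T Nt \<theta> x th \<longleftrightarrow> (\<exists>\<tau>. \<forall>i. prefix i \<tau> x th)"
proof
  assume "hybrid_sol f g k V Q a T Nt \<theta> x th"
  then obtain \<tau> where h: "\<tau> 0 = 0" "continuous_on {0..} x"
    "\<And>i. \<tau> (Suc i) = next_event V Q a T x th (\<tau> i)"
    "\<And>i. \<forall>t\<in>{\<tau> i..<\<tau> (Suc i)}. th t = th (\<tau> i) \<and>
      (x has_vector_derivative field (th (\<tau> i)) (x t)) (at t within {\<tau> i..\<tau> (Suc i)})"
    "\<And>i. update \<tau> x th i"
    unfolding hybrid_sol_def update_def field_def by blast
  have c: "continuous_on {s..} x" if "0 \<le> s" for s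
    by (rule continuous_on_subset[OF h(2)]) (use that in auto)
  have ev: "event (\<tau> i) (\<tau> (Suc i)) (th (\<tau> i)) x" if "0 \<le> \<tau> i" for i
    using h(3) next_event_eq_iff[OF c[OF that]] by blast
  have nonneg: "0 \<le> \<tau> i" for i
  proof (induction i)
    case (Suc i)
    then show ?case using ev[of i] by (simp add: event_def)
  qed (simp add: h(1))
  have "arc \<tau> x th i" for i
    using ev[OF nonneg, of i] h(4)[of i] unfolding arc_def event_def by blast
  moreover have "continuous_on {0..\<tau> i} x" for i
    by (rule continuous_on_subset[OF h(2)]) auto
  ultimately have "prefix i \<tau> x th" for i
    using h(1,5) ev nonneg unfolding prefix_def flow_def by blast
  then show "\<exists>\<tau>. \<forall>i. prefix i \<tau> x th" by blast
next
  assume "\<exists>\<tau>. \<forall>i. prefix i \<tau> x th"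
  then obtain \<tau> where p: "\<And>i. prefix i \<tau> x th" by blast
  have fl: "flow i \<tau> x th" for i using p[of i] by (simp add: prefix_def)
  have x: "continuous_on {0..} x"
    unfolding continuous_on_eq_continuous_within
  proof
    fix t :: real assume t: "t \<in> {0..}"
    obtain i where i: "t + 1 \<le> \<tau> i" using prefix_reaches[OF p] by blast
    have "continuous_on ({0..} \<inter> {..<\<tau> i}) x"
      by (rule continuous_on_subset[OF flow_continuous[OF fl[of i] order_refl order_refl]]) auto
    then have "continuous (at t within {0..} \<inter> {..<\<tau> i}) x"
      using t i by (simp add: continuous_on_eq_continuous_within)
    moreover have "at t within {0..} \<inter> {..<\<tau> i} = at t within {0..}"
      by (rule at_within_nhd[of t "{..<\<tau> i}"]) (use i in auto)
    ultimately show "continuous (at t within {0..}) x" by (simp only:)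
  qed
  have "\<tau> (Suc i) = next_event V Q a T x th (\<tau> i)" for i
  proof -
    have "continuous_on {\<tau> i..} x"
      by (rule continuous_on_subset[OF x]) (use flow_time_nonneg[OF fl[of i], of i] in auto)
    moreover have "event (\<tau> i) (\<tau> (Suc i)) (th (\<tau> i)) x" using p[of "Suc i"] by (simp add: prefix_def)
    ultimately show ?thesis using next_event_eq_iff by blast
  qed
  moreover have "\<forall>t\<in>{\<tau> i..<\<tau> (Suc i)}. th t = th (\<tau> i) \<and> (x has_vector_derivative
      (f (x t) (k (th (\<tau> i)) (x t)) + g (x t) (k (th (\<tau> i)) (x t)) *v \<theta>)) (at t within {\<tau> i..\<tau> (Suc i)})" for i
    using flow_arc[OF fl[of "Suc i"] lessI] unfolding arc_def field_def by blast
  moreover have "update \<tau> x th i" for i using p[of "Suc i"] by (simp add: prefix_def)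
  moreover have "\<tau> 0 = 0" using fl[of 0] by (simp add: flow_def)
  ultimately show "hybrid_sol f g k V Q a T Nt \<theta> x th"
    using prefix_time_at_top[OF p] x unfolding hybrid_sol_def update_def by blast
qed

lemma hybrid_sol_unique:
  assumes "\<And>i. prefix i \<tau> x th" "hybrid_sol f g k V Q a T Nt \<theta> x' th'" "x' 0 = x 0" "th' 0 = th 0" "0 \<le> t"
  shows "x' t = x t \<and> th' t = th t"
proof -
  obtain \<tau>' where p': "\<And>i. prefix i \<tau>' x' th'" using assms(2) hybrid_sol_iff by blast
  obtain i where "t \<le> \<tau> i" using prefix_reaches[OF assms(1)] by blast
  then show ?thesis using prefix_unique[OF assms(1) p' assms(3,4), of i] assms(5) by blast
qed

subsection \<open>Estimates\<close>

lemma continuous_level: "continuous_on S (\<lambda>z. level (fst z) (snd z))"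
  unfolding level_def
  by (intro continuous_on_add continuous_on_subset[OF Q_cont] continuous_on_compose2[OF a_cont] continuous_on_snd
      continuous_on_id) auto

text \<open>On compact sets of estimates and starting states the thresholds are bounded, and (H2)
  turns this into a bound on the state during the interval.\<close>

lemma sublevel_bounded:
  assumes \<Theta>: "compact \<Theta>" "\<Theta> \<noteq> {}"
  shows "\<exists>R. \<forall>\<phi>\<in>\<Theta>. \<forall>\<xi> y. norm \<xi> \<le> r \<and> V \<phi> y \<le> level \<phi> \<xi> \<longrightarrow> norm y \<le> R"
proof -
  have "bounded ((\<lambda>z. level (fst z) (snd z)) ` (\<Theta> \<times> cball 0 r))"
    by (intro compact_imp_bounded compact_continuous_image continuous_level compact_Times \<Theta> compact_cball)
  then obtain M where M: "\<forall>v\<in>(\<lambda>z. level (fst z) (snd z)) ` (\<Theta> \<times> cball 0 r). norm v \<le> M"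
    unfolding bounded_iff by blast
  \<comment> \<open>The maximum with 0 meets the sign condition on the level in (H2).\<close>
  have "level \<phi> \<xi> \<le> max 0 M" if "\<phi> \<in> \<Theta>" "norm \<xi> \<le> r" for \<phi> \<xi>
  proof -
    have "level \<phi> \<xi> \<in> (\<lambda>z. level (fst z) (snd z)) ` (\<Theta> \<times> cball 0 r)"
      by (rule image_eqI[of _ _ "(\<phi>, \<xi>)"]) (use that in auto)
    with M have "norm (level \<phi> \<xi>) \<le> M" by blast
    then show ?thesis by simp
  qed
  moreover obtain R where "\<forall>\<phi>\<in>\<Theta>. \<forall>x. V \<phi> x \<le> max 0 M \<longrightarrow> norm x \<le> R"
    using H2[OF \<Theta>(2,1), of "max 0 M"] by auto
  ultimately show ?thesis by (intro exI[of _ R]) (meson order_trans)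
qed

text \<open>On a compact annulus \<open>V\<close> has a positive minimum over all estimates
  considered, so small values of \<open>V\<close> force small states. Thresholds become that small
  near the origin, uniformly in the estimate, by uniform continuity.\<close>

lemma sublevel_small:
  assumes \<Theta>: "compact \<Theta>" "\<Theta> \<noteq> {}" and e: "e > 0"
  shows "\<exists>d>0. \<forall>\<phi>\<in>\<Theta>. \<forall>\<xi> y. norm \<xi> \<le> d \<and> V \<phi> y \<le> level \<phi> \<xi> \<longrightarrow> norm y \<le> e"
proof -
  \<comment> \<open>The level 1 is an arbitrary choice that confines the state to a ball and so
    makes the annulus in \<open>K\<close> compact.\<close>
  obtain R where R: "\<And>\<phi> x. \<phi> \<in> \<Theta> \<Longrightarrow> V \<phi> x \<le> 1 \<Longrightarrow> norm x \<le> R"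
    using H2[OF \<Theta>(2,1), of 1] by auto
  define K where "K = \<Theta> \<times> {y::real^'n. norm y \<le> R \<and> e \<le> norm y}"
  have "{y::real^'n. norm y \<le> R \<and> e \<le> norm y} = cball 0 R \<inter> {y. e \<le> norm y}" by auto
  then have "compact {y::real^'n. norm y \<le> R \<and> e \<le> norm y}"
    by (simp only: compact_Int_closed compact_cball closed_Collect_le continuous_on_const continuous_on_norm_id)
  then have K: "compact K" unfolding K_def by (intro compact_Times \<Theta>)
  have "\<exists>m>0. \<forall>z\<in>K. m \<le> V (fst z) (snd z)"
  proof (cases "K = {}")
    case False
    then obtain z where z: "z \<in> K" "\<forall>w\<in>K. V (fst z) (snd z) \<le> V (fst w) (snd w)"
      using continuous_attains_inf[OF K _ continuous_on_subset[OF V_cont]] by auto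
    have "snd z \<noteq> 0" using z(1) e by (auto simp: K_def)
    then have "V (fst z) (snd z) > 0" using V_pd[of "fst z"] by (simp add: pos_def_def)
    then show ?thesis using z(2) by blast
  qed (intro exI[of _ 1], simp)
  then obtain m where m: "m > 0" "\<And>z. z \<in> K \<Longrightarrow> m \<le> V (fst z) (snd z)" by blast
  have small: "norm y \<le> e" if "\<phi> \<in> \<Theta>" "V \<phi> y < min 1 m" for \<phi> y
  proof (rule ccontr)
    assume "\<not> norm y \<le> e"
    then have "(\<phi>, y) \<in> K" using R[OF that(1), of y] that by (simp add: K_def)
    then show False using m(2)[of "(\<phi>, y)"] that(2) by simp
  qed
  have "uniformly_continuous_on (\<Theta> \<times> cball 0 1) (\<lambda>z. level (fst z) (snd z))"
    by (intro compact_uniformly_continuous continuous_level compact_Times \<Theta> compact_cball)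
  moreover have "min 1 m > 0" using m(1) by simp
  ultimately obtain d where d: "d > 0" "\<And>z z'. z \<in> \<Theta> \<times> cball 0 1 \<Longrightarrow> z' \<in> \<Theta> \<times> cball 0 1 \<Longrightarrow> dist z' z < d \<Longrightarrow>
      dist (level (fst z') (snd z')) (level (fst z) (snd z)) < min 1 m"
    unfolding uniformly_continuous_on_def by metis
  have "norm y \<le> e" if "\<phi> \<in> \<Theta>" "norm \<xi> \<le> min 1 (d / 2)" "V \<phi> y \<le> level \<phi> \<xi>" for \<phi> \<xi> y
  proof (rule small[OF that(1)])
    have "dist (level \<phi> \<xi>) (level \<phi> 0) < min 1 m"
      using d(2)[of "(\<phi>, 0)" "(\<phi>, \<xi>)"] that d(1) by (simp add: dist_Pair_Pair)
    then show "V \<phi> y < min 1 m" using that(3) by (auto simp: dist_real_def abs_less_iff)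
  qed
  then show ?thesis using d(1) by (intro exI[of _ "min 1 (d / 2)"]) auto
qed

text \<open>Before the event the bound is part of the trigger; it passes to the event time itself by
  continuity. A zero state stays zero.\<close>

lemma prefix_segment_bound:
  assumes p: "prefix i \<tau> x th" and j: "j < i" and t: "\<tau> j \<le> t" "t \<le> \<tau> (Suc j)"
  shows "V (th (\<tau> j)) (x t) \<le> level (th (\<tau> j)) (x (\<tau> j))"
proof (cases "x (\<tau> j) = 0")
  case True
  have fl: "flow i \<tau> x th" using p by (simp add: prefix_def)
  have "x t = 0"
    by (rule arc_unique[OF fl j, where q = "\<tau> (Suc j)" and y = "\<lambda>_. 0"]) (use t True in auto)
  then show ?thesis using True by simp
next
  case False
  have fl: "flow i \<tau> x th" and ev: "event (\<tau> j) (\<tau> (Suc j)) (th (\<tau> j)) x"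
    using p j by (auto simp: prefix_def)
  have less: "\<tau> j < \<tau> (Suc j)" using ev by (simp add: event_def)
  show ?thesis
  proof (rule continuous_le_on_closure[where S = "{\<tau> j..<\<tau> (Suc j)}" and f = "\<lambda>t. V (th (\<tau> j)) (x t)"])
    show "continuous_on (closure {\<tau> j..<\<tau> (Suc j)}) (\<lambda>t. V (th (\<tau> j)) (x t))"
      using arc_integral(1)[OF fl j order_refl order_refl continuous_V] less by simp
    show "t \<in> closure {\<tau> j..<\<tau> (Suc j)}" using t less by simp
    show "V (th (\<tau> j)) (x u) \<le> level (th (\<tau> j)) (x (\<tau> j))" if "u \<in> {\<tau> j..<\<tau> (Suc j)}" for u
      using ev that False unfolding event_def by (meson less_imp_le)
  qed
qed

text \<open>The initial estimate is fixed and the initial state left free: the comparison function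
  may depend on the former but must be uniform in the latter.\<close>

definition solution :: "real^'l \<Rightarrow> (nat \<Rightarrow> real) \<Rightarrow> (real \<Rightarrow> real^'n) \<Rightarrow> (real \<Rightarrow> real^'l) \<Rightarrow> bool" where
  "solution th0 \<tau> x th \<longleftrightarrow> (\<forall>i. prefix i \<tau> x th) \<and> th 0 = th0"

lemma solution_estimates:
  assumes "solution th0 \<tau> x th"
  shows "th (\<tau> j) \<in> cball \<theta> (dist th0 \<theta>)"
  using assms prefix_dist_le[of j \<tau> x th 0 j]
  by (simp add: solution_def dist_commute prefix_def flow_def)

text \<open>Iterates the one-interval bound. A single radius serves all runs because their estimates
  share the ball about \<theta> that is determined by \<open>th0\<close>.\<close>

lemma solution_initial_bounded:
  "\<exists>R. \<forall>\<tau> x th t. solution th0 \<tau> x th \<and> norm (x 0) \<le> r \<and> 0 \<le> t \<and> t \<le> \<tau> j \<longrightarrow> norm (x t) \<le> R"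
proof (induction j)
  case 0
  show ?case by (intro exI[of _ r]) (auto simp: solution_def prefix_def flow_def)
next
  case (Suc j)
  then obtain R where R: "\<And>\<tau> x th t. solution th0 \<tau> x th \<Longrightarrow> norm (x 0) \<le> r \<Longrightarrow> 0 \<le> t \<Longrightarrow> t \<le> \<tau> j \<Longrightarrow> norm (x t) \<le> R"
    by blast
  obtain R' where R': "\<And>\<phi> \<xi> y. \<phi> \<in> cball \<theta> (dist th0 \<theta>) \<Longrightarrow> norm \<xi> \<le> R \<Longrightarrow> V \<phi> y \<le> level \<phi> \<xi> \<Longrightarrow> norm y \<le> R'"
    using sublevel_bounded[OF compact_cball, of \<theta> "dist th0 \<theta>" R] by fastforce
  have "norm (x t) \<le> max R R'" if s: "solution th0 \<tau> x th" "norm (x 0) \<le> r" and t: "0 \<le> t" "t \<le> \<tau> (Suc j)" for \<tau> x th t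
  proof (cases "t \<le> \<tau> j")
    case True
    then show ?thesis using R[OF s t(1)] by simp
  next
    case False
    have p: "prefix (Suc j) \<tau> x th" using s by (simp add: solution_def)
    then have "0 \<le> \<tau> j" using flow_time_nonneg[of "Suc j" \<tau> x th j] by (simp add: prefix_def)
    then have "norm (x t) \<le> R'"
      using R'[OF solution_estimates[OF s(1)] R[OF s _ order_refl] prefix_segment_bound[OF p lessI _ t(2)]] False by simp
    then show ?thesis by simp
  qed
  then show ?case by blast
qed

text \<open>The same iteration with tolerances chosen backwards: the last interval asks for a state
  within \<open>d'\<close> at its beginning, and \<open>min d' e\<close> also covers the earlier
  intervals.\<close>

lemma solution_initial_stable:
  assumes "e > 0"
  shows "\<exists>d>0. \<forall>\<tau> x th t. solution th0 \<tau> x th \<and> norm (x 0) \<le> d \<and> 0 \<le> t \<and> t \<le> \<tau> j \<longrightarrow> norm (x t) \<le> e"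
  using assms
proof (induction j arbitrary: e)
  case 0
  then show ?case by (intro exI[of _ e]) (auto simp: solution_def prefix_def flow_def)
next
  case (Suc j)
  obtain d' where d': "d' > 0" "\<And>\<phi> \<xi> y. \<phi> \<in> cball \<theta> (dist th0 \<theta>) \<Longrightarrow> norm \<xi> \<le> d' \<Longrightarrow> V \<phi> y \<le> level \<phi> \<xi> \<Longrightarrow> norm y \<le> e"
    using sublevel_small[of "cball \<theta> (dist th0 \<theta>)" e] Suc.prems by auto
  have "min d' e > 0" using d'(1) Suc.prems by simp
  from Suc.IH[OF this] obtain d where d: "d > 0"
    "\<And>\<tau> x th t. solution th0 \<tau> x th \<Longrightarrow> norm (x 0) \<le> d \<Longrightarrow> 0 \<le> t \<Longrightarrow> t \<le> \<tau> j \<Longrightarrow> norm (x t) \<le> min d' e"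
    by blast
  have "norm (x t) \<le> e" if s: "solution th0 \<tau> x th" "norm (x 0) \<le> d" and t: "0 \<le> t" "t \<le> \<tau> (Suc j)" for \<tau> x th t
  proof (cases "t \<le> \<tau> j")
    case True
    then show ?thesis using d(2)[OF s t(1)] by simp
  next
    case False
    have p: "prefix (Suc j) \<tau> x th" using s by (simp add: solution_def)
    then have "0 \<le> \<tau> j" using flow_time_nonneg[of "Suc j" \<tau> x th j] by (simp add: prefix_def)
    then have "norm (x (\<tau> j)) \<le> d'" using d(2)[OF s _ order_refl] by simp
    then show ?thesis
      using d'(2)[OF solution_estimates[OF s(1)] _ prefix_segment_bound[OF p lessI _ t(2)]] False by simp
  qed
  then show ?case using d(1) by blast
qed

text \<open>By \<open>flow_time_upper\<close> event \<open>N\<close> has occurred by time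
  \<open>N * T\<close>, and the identified value is kept on all later arcs.\<close>

lemma solution_identified:
  assumes s: "solution th0 \<tau> x th" and x0: "x 0 \<noteq> 0" and t: "real N * T \<le> t"
  shows "th t = \<theta>"
proof -
  have p: "\<And>i. prefix i \<tau> x th" and fl: "\<And>i. flow i \<tau> x th"
    using s by (auto simp: solution_def prefix_def)
  have \<tau>N: "0 \<le> \<tau> N" "\<tau> N \<le> t" using flow_time_upper[OF fl order_refl, of N] flow_time_nonneg[OF fl order_refl, of N] t by auto
  obtain i where "t + 1 \<le> \<tau> i" using prefix_reaches[OF p] by blast
  then obtain j where j: "j < i" "\<tau> j \<le> t" "t < \<tau> (Suc j)"
    using flow_cover[OF fl, of t i] \<tau>N by auto
  have "N \<le> j"
  proof (rule ccontr)
    assume "\<not> N \<le> j"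
    then have "\<tau> (Suc j) \<le> \<tau> N" using flow_time_le[OF fl, of "Suc j" N N] by simp
    then show False using j \<tau>N by simp
  qed
  then have "th (\<tau> j) = \<theta>" using prefix_identified[OF p identification[OF p x0] _ order_refl] by blast
  then show ?thesis using flow_th[OF fl j] by simp
qed

text \<open>For a zero start \<theta> may remain unidentified, but the zero trajectory solves the
  nominal equation too, so the description is the same in both cases.\<close>

lemma solution_tail:
  assumes s: "solution th0 \<tau> x th"
  shows "\<exists>z. ode_sol (field \<theta>) (x (\<tau> N)) z \<and> (\<forall>t\<ge>\<tau> N. x t = z (t - \<tau> N))"
proof -
  have p: "\<And>i. prefix i \<tau> x th" and fl: "\<And>i. flow i \<tau> x th"
    using s by (auto simp: solution_def prefix_def)
  have \<tau>N: "0 \<le> \<tau> N" using flow_time_nonneg[OF fl order_refl, of N] by auto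
  show ?thesis
  proof (cases "x 0 = 0")
    case True
    have "x t = 0" if "0 \<le> t" for t
    proof -
      obtain i where "t \<le> \<tau> i" using prefix_reaches[OF p] by blast
      then show ?thesis using flow_zero[OF fl True that] by blast
    qed
    then show ?thesis using \<tau>N by (intro exI[of _ "\<lambda>_. 0"]) (auto simp: ode_sol_def)
  next
    case False
    obtain z where z: "ode_sol (field \<theta>) (x (\<tau> N)) z" using GAS_field unfolding GAS_def by blast
    have "x t = z (t - \<tau> N)" if "\<tau> N \<le> t" for t
    proof -
      obtain i where "t \<le> \<tau> i" "N \<le> i" using prefix_reaches[OF p] by blast
      then show ?thesis using prefix_tail[OF p _ identification[OF p False] z that] by blast
    qed
    then show ?thesis using z by blast
  qed
qed

text \<open>The nominal loop satisfies the inequality known for one interval between events, so the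
  same sublevel lemmas apply to it with the singleton of \<theta>.\<close>

lemma ode_sol_sublevel: "ode_sol (field \<theta>) \<xi> z \<Longrightarrow> t \<ge> 0 \<Longrightarrow> V \<theta> (z t) \<le> level \<theta> \<xi>"
  using V_le_Q_field[of \<xi> z t] a_pd unfolding level_def pos_def_def
  by (cases "\<xi> = 0") (auto intro: order_trans)

text \<open>Each run is split at \<open>\<tau> N\<close>: the iterated interval bounds cover the
  part before, and the nominal loop, started from a state already bounded, the part after. The
  indices for \<open>class_KL_majorant\<close> are the initial states, measured by their
  norm.\<close>

lemma solution_KL_bound:
  fixes X :: "real^'n \<Rightarrow> real \<Rightarrow> real^'n"
  assumes X: "\<And>x0. \<exists>\<tau> th. solution th0 \<tau> (X x0) th" "\<And>x0. X x0 0 = x0"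
  shows "\<exists>\<sigma>. class_KL \<sigma> \<and> (\<forall>x0 t. 0 \<le> t \<longrightarrow> norm (X x0 t) \<le> \<sigma> (norm x0) t)"
proof (rule class_KL_majorant)
  have time: "\<tau> N \<le> real N * T" "0 \<le> \<tau> N" if "solution th0 \<tau> x th" for \<tau> x th
    using flow_time_upper[of N \<tau> x th N] flow_time_nonneg[of N \<tau> x th N] that by (auto simp: solution_def prefix_def)
  have bnd: "\<exists>B. \<forall>\<xi> z t. ode_sol (field \<theta>) \<xi> z \<and> norm \<xi> \<le> r \<and> 0 \<le> t \<longrightarrow> norm (z t) \<le> B" for r
    using sublevel_bounded[of "{\<theta>}" r] ode_sol_sublevel by simp meson
  \<comment> \<open>One block for boundedness and attractivity, since the latter reuses the radius
    \<open>R\<close> at event \<open>N\<close> and the bound \<open>B\<close>.\<close>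
  {
    fix r
    obtain R where R: "\<And>\<tau> x th t. solution th0 \<tau> x th \<Longrightarrow> norm (x 0) \<le> r \<Longrightarrow> 0 \<le> t \<Longrightarrow> t \<le> \<tau> N \<Longrightarrow> norm (x t) \<le> R"
      using solution_initial_bounded[of th0 r N] by blast
    obtain B where B: "\<And>\<xi> z t. ode_sol (field \<theta>) \<xi> z \<Longrightarrow> norm \<xi> \<le> R \<Longrightarrow> 0 \<le> t \<Longrightarrow> norm (z t) \<le> B"
      using bnd by blast
    have "norm (X c t) \<le> max R B" if "norm c \<le> r" "0 \<le> t" for c t
    proof -
      obtain \<tau> th where s: "solution th0 \<tau> (X c) th" using X(1) by blast
      have r: "norm (X c 0) \<le> r" using X(2) that by simp
      obtain z where z: "ode_sol (field \<theta>) (X c (\<tau> N)) z" "\<forall>t\<ge>\<tau> N. X c t = z (t - \<tau> N)"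
        using solution_tail[OF s] by blast
      show ?thesis
      proof (cases "t \<le> \<tau> N")
        case True
        then show ?thesis using R[OF s r that(2)] by simp
      next
        case False
        then show ?thesis
          using B[OF z(1) R[OF s r time(2)[OF s] order_refl], of "t - \<tau> N"] z(2) by simp
      qed
    qed
    then show "\<exists>B. \<forall>c t. norm c \<le> r \<and> 0 \<le> t \<longrightarrow> norm (X c t) \<le> B" by blast

    fix e :: real assume e: "e > 0"
    obtain t0 where t0: "0 \<le> t0"
      "\<And>\<xi> z t. ode_sol (field \<theta>) \<xi> z \<Longrightarrow> norm \<xi> \<le> R \<Longrightarrow> t0 \<le> t \<Longrightarrow> norm (z t) \<le> e"
      using GAS_uniformly_attractive[of "field \<theta>" R B e] lip_field GAS_field B e by blast
    \<comment> \<open>Event \<open>N\<close> occurs by \<open>N * T\<close> in every run, so this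
      waiting time leaves at least \<open>t0\<close> for the nominal loop.\<close>
    have "norm (X c t) \<le> e" if "norm c \<le> r" "0 \<le> t" "real N * T + t0 \<le> t" for c t
    proof -
      obtain \<tau> th where s: "solution th0 \<tau> (X c) th" using X(1) by blast
      have r: "norm (X c 0) \<le> r" using X(2) that by simp
      obtain z where z: "ode_sol (field \<theta>) (X c (\<tau> N)) z" "\<forall>t\<ge>\<tau> N. X c t = z (t - \<tau> N)"
        using solution_tail[OF s] by blast
      have "\<tau> N \<le> t" "t0 \<le> t - \<tau> N" using time[OF s] that(3) t0(1) by auto
      then show ?thesis
        using t0(2)[OF z(1) R[OF s r time(2)[OF s] order_refl], of "t - \<tau> N"] z(2) by simp
    qed
    then show "\<exists>t0. \<forall>c t. norm c \<le> r \<and> 0 \<le> t \<and> t0 \<le> t \<longrightarrow> norm (X c t) \<le> e" by blast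
  }
  fix e :: real assume e: "e > 0"
  obtain d' where d': "d' > 0" "\<And>\<xi> y. norm \<xi> \<le> d' \<Longrightarrow> V \<theta> y \<le> level \<theta> \<xi> \<Longrightarrow> norm y \<le> e"
    using sublevel_small[of "{\<theta>}" e] e by auto
  have "min d' e > 0" using d'(1) e by simp
  from solution_initial_stable[OF this, of th0 N] obtain d where d: "d > 0"
    "\<And>\<tau> x th t. solution th0 \<tau> x th \<Longrightarrow> norm (x 0) \<le> d \<Longrightarrow> 0 \<le> t \<Longrightarrow> t \<le> \<tau> N \<Longrightarrow> norm (x t) \<le> min d' e"
    by blast
  have "norm (X c t) \<le> e" if "norm c \<le> d" "0 \<le> t" for c t
  proof -
    obtain \<tau> th where s: "solution th0 \<tau> (X c) th" using X(1) by blast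
    have r: "norm (X c 0) \<le> d" using X(2) that by simp
    obtain z where z: "ode_sol (field \<theta>) (X c (\<tau> N)) z" "\<forall>t\<ge>\<tau> N. X c t = z (t - \<tau> N)"
      using solution_tail[OF s] by blast
    show ?thesis
    proof (cases "t \<le> \<tau> N")
      case True
      then show ?thesis using d(2)[OF s r that(2)] by simp
    next
      case False
      then show ?thesis
        using d(2)[OF s r time(2)[OF s] order_refl] z(2)
          d'(2)[OF _ ode_sol_sublevel[OF z(1), of "t - \<tau> N"]] by simp
    qed
  qed
  then show "\<exists>d>0. \<forall>c t. norm c \<le> d \<and> 0 \<le> t \<longrightarrow> norm (X c t) \<le> e" using d(1) by blast
qed auto

lemma stabilization_and_identification:
  "\<exists>\<sigma>. class_KL \<sigma> \<and> (\<forall>x0. \<exists>x th.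
      x 0 = x0 \<and> th 0 = th0 \<and> hybrid_sol f g k V Q a T Nt \<theta> x th \<and>
      (\<forall>x' th'. x' 0 = x0 \<and> th' 0 = th0 \<and> hybrid_sol f g k V Q a T Nt \<theta> x' th'
         \<longrightarrow> (\<forall>t\<ge>0. x' t = x t \<and> th' t = th t)) \<and>
      (\<forall>t\<ge>0. norm (x t) \<le> \<sigma> (norm x0) t) \<and>
      (x0 \<noteq> 0 \<longrightarrow> (\<forall>t\<ge>real N * T. th t = \<theta>)))"
proof -
  have "\<exists>\<tau> x th. x 0 = x0 \<and> solution th0 \<tau> x th" for x0
    using infinite_prefix_exists[of x0 th0] unfolding solution_def by blast
  \<comment> \<open>Runs are selected for all initial states at once, before \<sigma> is
    constructed, because \<sigma> has to majorise all of them.\<close>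
  then obtain \<tau> X h where X: "\<And>x0. X x0 0 = x0" "\<And>x0. solution th0 (\<tau> x0) (X x0) (h x0)" by metis
  obtain \<sigma> where \<sigma>: "class_KL \<sigma>" "\<And>x0 t. 0 \<le> t \<Longrightarrow> norm (X x0 t) \<le> \<sigma> (norm x0) t"
    using solution_KL_bound[of th0 X] X by blast
  show ?thesis
  proof (intro exI[of _ \<sigma>] conjI allI)
    fix x0
    have p: "prefix i (\<tau> x0) (X x0) (h x0)" for i
      using X(2) by (auto simp: solution_def)
    have h0: "h x0 0 = th0"
      using X(2) by (auto simp: solution_def)
    show "\<exists>x th. x 0 = x0 \<and> th 0 = th0 \<and> hybrid_sol f g k V Q a T Nt \<theta> x th \<and>
      (\<forall>x' th'. x' 0 = x0 \<and> th' 0 = th0 \<and> hybrid_sol f g k V Q a T Nt \<theta> x' th'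
         \<longrightarrow> (\<forall>t\<ge>0. x' t = x t \<and> th' t = th t)) \<and>
      (\<forall>t\<ge>0. norm (x t) \<le> \<sigma> (norm x0) t) \<and>
      (x0 \<noteq> 0 \<longrightarrow> (\<forall>t\<ge>real N * T. th t = \<theta>))"
    proof (intro exI[of _ "X x0"] exI[of _ "h x0"] conjI)
      show "X x0 0 = x0" "h x0 0 = th0" using X(1) h0 by auto
      show "hybrid_sol f g k V Q a T Nt \<theta> (X x0) (h x0)" using p hybrid_sol_iff by blast
      show "\<forall>x' th'. x' 0 = x0 \<and> th' 0 = th0 \<and> hybrid_sol f g k V Q a T Nt \<theta> x' th'
         \<longrightarrow> (\<forall>t\<ge>0. x' t = X x0 t \<and> th' t = h x0 t)"
        using hybrid_sol_unique[OF p] X(1) h0 by metis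
      show "\<forall>t\<ge>0. norm (X x0 t) \<le> \<sigma> (norm x0) t" using \<sigma>(2) by blast
      show "x0 \<noteq> 0 \<longrightarrow> (\<forall>t\<ge>real N * T. h x0 t = \<theta>)"
        using solution_identified[OF X(2)] X(1) by metis
    qed
  qed (rule \<sigma>(1))
qed

end

theorem theorem3p1:
  fixes f :: "real^'n \<Rightarrow> real^'m \<Rightarrow> real^'n"
    and g :: "real^'n \<Rightarrow> real^'m \<Rightarrow> real^'l^'n"
    and k :: "real^'l \<Rightarrow> real^'n \<Rightarrow> real^'m"
    and V Q :: "real^'l \<Rightarrow> real^'n \<Rightarrow> real"
    and a :: "real^'n \<Rightarrow> real"
    and T :: real and N Nt :: nat
  assumes f_smooth: "smooth_map (\<lambda>z. f (fst z) (snd z))"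
    and g_smooth: "smooth_map (\<lambda>z. g (fst z) (snd z))"
    and k_smooth: "smooth_map (\<lambda>z. k (fst z) (snd z))"
    and f0: "f 0 0 = 0" and g0: "g 0 0 = 0"
    and k0: "\<And>\<phi>. k \<phi> 0 = 0"
    and V_cont: "continuous_on UNIV (\<lambda>z. V (fst z) (snd z))"
    and Q_cont: "continuous_on UNIV (\<lambda>z. Q (fst z) (snd z))"
    and V_pd: "\<And>\<phi>. pos_def (V \<phi>)" and Q_pd: "\<And>\<phi>. pos_def (Q \<phi>)"
    and V_ru: "\<And>\<phi>. radially_unbounded (V \<phi>)"
    and Q_ru: "\<And>\<phi>. radially_unbounded (Q \<phi>)"
    and H1_GAS: "\<And>\<phi>. GAS (\<lambda>x. f x (k \<phi> x) + g x (k \<phi> x) *v \<phi>)"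
    and H1_bound: "\<And>\<phi> x0 x t. ode_sol (\<lambda>x. f x (k \<phi> x) + g x (k \<phi> x) *v \<phi>) x0 x
                     \<Longrightarrow> t \<ge> 0 \<Longrightarrow> V \<phi> (x t) \<le> Q \<phi> (x 0)"
    and H2: "\<And>\<Theta> M. \<Theta> \<noteq> {} \<Longrightarrow> compact \<Theta> \<Longrightarrow> M \<ge> 0 \<Longrightarrow>
               \<exists>R>0. \<forall>\<phi>\<in>\<Theta>. \<forall>x. V \<phi> x \<le> M \<longrightarrow> norm x \<le> R"
    and N_pos: "N > 0"
    and H3: "\<And>(\<tau>::nat \<Rightarrow> real) (\<theta>::real^'l) (d::nat \<Rightarrow> real^'l) (x::real \<Rightarrow> real^'n).
       \<tau> 0 = 0 \<Longrightarrow> (\<forall>i<N. \<tau> i < \<tau> (Suc i)) \<Longrightarrow> (\<forall>i\<le>N. d i \<noteq> 0) \<Longrightarrow>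
       continuous_on {0..\<tau> N} x \<Longrightarrow>
       (\<exists>x'. (\<forall>t\<in>{0..\<tau> N} - \<tau> ` {0..N}. (x has_vector_derivative x' t) (at t)) \<and>
             continuous_on ({0..\<tau> N} - \<tau> ` {0..N}) x') \<Longrightarrow>
       (\<forall>t\<in>{0..<\<tau> N}. \<exists>D. (x has_vector_derivative D) (at_right t)) \<Longrightarrow>
       (\<forall>i<N. \<forall>t\<in>{\<tau> i..<\<tau> (Suc i)}.
          (x has_vector_derivative
             (f (x t) (k (\<theta> + d i) (x t)) + g (x t) (k (\<theta> + d i) (x t)) *v \<theta>)) (at_right t)) \<Longrightarrow>
       (\<forall>i<N. \<forall>j\<le>i. \<forall>t\<in>{\<tau> j..\<tau> (Suc j)}. g (x t) (k (\<theta> + d j) (x t)) *v d (Suc i) = 0) \<Longrightarrow>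
       \<forall>t\<in>{0..\<tau> N}. x t = 0"
    and T_pos: "T > 0"
    and a_cont: "continuous_on UNIV a" and a_pd: "pos_def a"
    and Nt_gt: "Nt > N"
  shows "\<exists>\<sigma> :: real^'l \<Rightarrow> real^'l \<Rightarrow> real \<Rightarrow> real \<Rightarrow> real.
           (\<forall>\<theta> \<theta>h0. class_KL (\<sigma> \<theta> \<theta>h0)) \<and>
           (\<forall>\<theta> x0 \<theta>h0. \<exists>x th.
              x 0 = x0 \<and> th 0 = \<theta>h0 \<and> hybrid_sol f g k V Q a T Nt \<theta> x th \<and>
              (\<forall>x' th'. x' 0 = x0 \<and> th' 0 = \<theta>h0 \<and> hybrid_sol f g k V Q a T Nt \<theta> x' th'
                   \<longrightarrow> (\<forall>t\<ge>0. x' t = x t \<and> th' t = th t)) \<and>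
              (\<forall>t\<ge>0. norm (x t) \<le> \<sigma> \<theta> \<theta>h0 (norm x0) t) \<and>
              (x0 \<noteq> 0 \<longrightarrow> (\<forall>t\<ge>real N * T. th t = \<theta>)))"
proof -
  have "event_triggered_control f g k V Q a T N Nt"
  proof (rule event_triggered_control.intro)
    show "lipschitz_on_balls (\<lambda>z. f (fst z) (snd z))" "lipschitz_on_balls (\<lambda>z. g (fst z) (snd z))"
      "lipschitz_on_balls (\<lambda>z. k (fst z) (snd z))"
      using f_smooth g_smooth k_smooth by (auto intro: smooth_map_imp_lipschitz_on_balls)
  qed (fact assms)+
  note main = event_triggered_control.stabilization_and_identification[OF this]
  \<comment> \<open>Everything is bundled into one predicate so that choice over both parameters
    yields the family of comparison functions.\<close>
  define P where "P \<theta> \<theta>h0 \<sigma> \<longleftrightarrow> class_KL \<sigma> \<and> (\<forall>x0. \<exists>x th.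
      x 0 = x0 \<and> th 0 = \<theta>h0 \<and> hybrid_sol f g k V Q a T Nt \<theta> x th \<and>
      (\<forall>x' th'. x' 0 = x0 \<and> th' 0 = \<theta>h0 \<and> hybrid_sol f g k V Q a T Nt \<theta> x' th'
         \<longrightarrow> (\<forall>t\<ge>0. x' t = x t \<and> th' t = th t)) \<and>
      (\<forall>t\<ge>0. norm (x t) \<le> \<sigma> (norm x0) t) \<and>
      (x0 \<noteq> 0 \<longrightarrow> (\<forall>t\<ge>real N * T. th t = \<theta>)))" for \<theta> \<theta>h0 \<sigma>
  have "\<exists>\<sigma>. P \<theta> \<theta>h0 \<sigma>" for \<theta> \<theta>h0
    unfolding P_def by (rule main)
  then obtain \<sigma> where "\<And>\<theta> \<theta>h0. P \<theta> \<theta>h0 (\<sigma> \<theta> \<theta>h0)" by metis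
  then show ?thesis unfolding P_def by (intro exI[of _ \<sigma>]) blast
qed

end
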